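(* For all $q,n\in\mathbb{N}$ with $q\geq 2$ and $n\ge 1$, and every $k\in\mathbb{N}$: every semi-simple action of the Brin-Higman-Thompson group $nV_q$ on a complete CAT(0) space of topological dimension $k$ has a global fixed point. (That is, $nV_q$ has property $\mathrm{F}\mathcal{A}_k$ for semi-simple actions for every $k\in\mathbb{N}$.)
   Context: For $q\ge 2$, a standard $q$-adic interval is an interval $[a/q^b,(a+1)/q^b)\subset[0,1)$ with $a,b$ integers, $b\ge0$. The Brin-Higman-Thompson group $nV_q$ is the group of bijections of $[0,1)^n$ described by two divisions of $[0,1)^n$ into the same finite number of products of $n$ standard $q$-adic intervals, together with a bijection between the pieces, each piece of the first division being mapped onto the corresponding piece of the second by the map that is increasing and affine in each coordinate (coordinate $j$ to coordinate $j$). For $n=1$ this is the Higman-Thompson group $V_q$, and $V_2$ is Thompson's group $V$. For an isometry $\gamma$ of a metric space $(X,d)$, let $|\gamma|=\inf\{d(x,\gamma(x))\mid x\in X\}$; $\gamma$ is semi-simple if this infimum is attained. An isometric action of a group on a metric space is semi-simple if every group element acts as a semi-simple isometry. A global fixed point is a point fixed by all group elements. CAT(0) spaces are taken to be non-empty. Topological dimension means covering dimension. *)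

theory Defs
  imports "HOL-Analysis.Analysis" "HOL-Algebra.Group_Action"
begin

section \<open>The Brin-Higman-Thompson groups\<close>

definition standard_interval :: "nat \<Rightarrow> real set \<Rightarrow> bool" where
  "standard_interval q I \<longleftrightarrow>
     (\<exists>(a::int) (b::nat). I = {of_int a / real q ^ b ..< of_int (a + 1) / real q ^ b}
                        \<and> I \<subseteq> {0..<1})"

text \<open>Points of $\mathbb{R}^n$ are functions on \<open>nat\<close> that are \<open>undefined\<close> outside \<open>{..<n}\<close>.\<close>

definition unit_cube :: "nat \<Rightarrow> (nat \<Rightarrow> real) set" where
  "unit_cube n = (\<Pi>\<^sub>E j\<in>{..<n}. {0..<1})"

definition brick :: "nat \<Rightarrow> nat \<Rightarrow> (nat \<Rightarrow> real) set \<Rightarrow> bool" where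
  "brick n q B \<longleftrightarrow> (\<exists>I. (\<forall>j<n. standard_interval q (I j)) \<and> B = (\<Pi>\<^sub>E j\<in>{..<n}. I j))"

definition cube_division :: "nat \<Rightarrow> nat \<Rightarrow> (nat \<Rightarrow> real) set set \<Rightarrow> bool" where
  "cube_division n q P \<longleftrightarrow> finite P \<and> (\<forall>B\<in>P. brick n q B) \<and> partition_on (unit_cube n) P"

definition coordinatewise_increasing_affine_on ::
    "nat \<Rightarrow> (nat \<Rightarrow> real) set \<Rightarrow> ((nat \<Rightarrow> real) \<Rightarrow> (nat \<Rightarrow> real)) \<Rightarrow> bool" where
  "coordinatewise_increasing_affine_on n B f \<longleftrightarrow>
     (\<exists>s t. (\<forall>j<n. 0 < s j) \<and> (\<forall>x\<in>B. \<forall>j<n. f x j = s j * x j + t j))"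

definition BHT_elements :: "nat \<Rightarrow> nat \<Rightarrow> ((nat \<Rightarrow> real) \<Rightarrow> (nat \<Rightarrow> real)) set" where
  "BHT_elements n q =
     {f \<in> Bij (unit_cube n). \<exists>P Q \<sigma>. cube_division n q P \<and> cube_division n q Q \<and> bij_betw \<sigma> P Q \<and>
        (\<forall>B\<in>P. f ` B = \<sigma> B \<and> coordinatewise_increasing_affine_on n B f)}"

text \<open>The group $nV_q$; its multiplication is composition of bijections of the cube.\<close>

definition BHT_group :: "nat \<Rightarrow> nat \<Rightarrow> ((nat \<Rightarrow> real) \<Rightarrow> (nat \<Rightarrow> real)) monoid" where
  "BHT_group n q = (BijGroup (unit_cube n))\<lparr>carrier := BHT_elements n q\<rparr>"

section \<open>CAT(0) spaces\<close>

definition geodesic_path ::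
    "'a set \<Rightarrow> ('a \<Rightarrow> 'a \<Rightarrow> real) \<Rightarrow> 'a \<Rightarrow> 'a \<Rightarrow> (real \<Rightarrow> 'a) \<Rightarrow> bool" where
  "geodesic_path M d x y c \<longleftrightarrow>
     c ` {0..d x y} \<subseteq> M \<and> c 0 = x \<and> c (d x y) = y \<and>
     (\<forall>s\<in>{0..d x y}. \<forall>t\<in>{0..d x y}. d (c s) (c t) = \<bar>s - t\<bar>)"

definition geodesic_space :: "'a set \<Rightarrow> ('a \<Rightarrow> 'a \<Rightarrow> real) \<Rightarrow> bool" where
  "geodesic_space M d \<longleftrightarrow> (\<forall>x\<in>M. \<forall>y\<in>M. \<exists>c. geodesic_path M d x y c)"

text \<open>All pairs of a point on the side \<open>c\<close> from \<open>x\<close> to \<open>y\<close> and its comparison point on the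
  Euclidean segment from \<open>x'\<close> to \<open>y'\<close>.\<close>

definition side_comparison ::
    "('a \<Rightarrow> 'a \<Rightarrow> real) \<Rightarrow> 'a \<Rightarrow> 'a \<Rightarrow> (real \<Rightarrow> 'a) \<Rightarrow> real^2 \<Rightarrow> real^2 \<Rightarrow> ('a \<times> (real^2)) set" where
  "side_comparison d x y c x' y' =
     {(c t, z) | t z. t \<in> {0..d x y} \<and> z \<in> closed_segment x' y' \<and> dist x' z = t}"

definition CAT0_inequality :: "'a set \<Rightarrow> ('a \<Rightarrow> 'a \<Rightarrow> real) \<Rightarrow> bool" where
  "CAT0_inequality M d \<longleftrightarrow>
     (\<forall>p\<in>M. \<forall>q\<in>M. \<forall>r\<in>M. \<forall>c1 c2 c3. \<forall>p' q' r'.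
        geodesic_path M d p q c1 \<and> geodesic_path M d q r c2 \<and> geodesic_path M d r p c3 \<and>
        dist p' q' = d p q \<and> dist q' r' = d q r \<and> dist r' p' = d r p \<longrightarrow>
        (let T = side_comparison d p q c1 p' q' \<union> side_comparison d q r c2 q' r'
                   \<union> side_comparison d r p c3 r' p'
         in \<forall>(x, x')\<in>T. \<forall>(y, y')\<in>T. d x y \<le> dist x' y'))"

definition CAT0_space :: "'a set \<Rightarrow> ('a \<Rightarrow> 'a \<Rightarrow> real) \<Rightarrow> bool" where
  "CAT0_space M d \<longleftrightarrow>
     Metric_space M d \<and> M \<noteq> {} \<and> geodesic_space M d \<and> CAT0_inequality M d"

section \<open>Covering dimension\<close>

text \<open>We use finite open covers. For metrizable spaces, as for all paracompact Hausdorff spaces,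
  arbitrary open covers give the same dimension.\<close>

definition covering_dim_le :: "'a topology \<Rightarrow> nat \<Rightarrow> bool" where
  "covering_dim_le X k \<longleftrightarrow>
     (\<forall>\<U>. finite \<U> \<and> (\<forall>U\<in>\<U>. openin X U) \<and> \<Union>\<U> = topspace X \<longrightarrow>
        (\<exists>\<V>. finite \<V> \<and> (\<forall>V\<in>\<V>. openin X V) \<and> \<Union>\<V> = topspace X \<and>
             (\<forall>V\<in>\<V>. \<exists>U\<in>\<U>. V \<subseteq> U) \<and>
             (\<forall>x\<in>topspace X. card {V \<in> \<V>. x \<in> V} \<le> k + 1)))"

text \<open>Meant for nonempty spaces: the empty space, usually of dimension $-1$, gets dimension $0$.\<close>

definition has_covering_dim :: "'a topology \<Rightarrow> nat \<Rightarrow> bool" where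
  "has_covering_dim X k \<longleftrightarrow> covering_dim_le X k \<and> (\<forall>m. covering_dim_le X m \<longrightarrow> k \<le> m)"

section \<open>Semi-simple actions\<close>

definition isometry_of :: "'a set \<Rightarrow> ('a \<Rightarrow> 'a \<Rightarrow> real) \<Rightarrow> ('a \<Rightarrow> 'a) \<Rightarrow> bool" where
  "isometry_of M d \<gamma> \<longleftrightarrow> bij_betw \<gamma> M M \<and> (\<forall>x\<in>M. \<forall>y\<in>M. d (\<gamma> x) (\<gamma> y) = d x y)"

definition translation_length :: "'a set \<Rightarrow> ('a \<Rightarrow> 'a \<Rightarrow> real) \<Rightarrow> ('a \<Rightarrow> 'a) \<Rightarrow> real" where
  "translation_length M d \<gamma> = (INF x\<in>M. d x (\<gamma> x))"

definition semisimple_isometry :: "'a set \<Rightarrow> ('a \<Rightarrow> 'a \<Rightarrow> real) \<Rightarrow> ('a \<Rightarrow> 'a) \<Rightarrow> bool" where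
  "semisimple_isometry M d \<gamma> \<longleftrightarrow>
     isometry_of M d \<gamma> \<and> (\<exists>x\<in>M. d x (\<gamma> x) = translation_length M d \<gamma>)"

definition semisimple_action ::
    "('g, 'b) monoid_scheme \<Rightarrow> 'a set \<Rightarrow> ('a \<Rightarrow> 'a \<Rightarrow> real) \<Rightarrow> ('g \<Rightarrow> 'a \<Rightarrow> 'a) \<Rightarrow> bool" where
  "semisimple_action G M d \<phi> \<longleftrightarrow>
     group_action G M \<phi> \<and> (\<forall>g\<in>carrier G. semisimple_isometry M d (\<phi> g))"

definition global_fixed_point ::
    "('g, 'b) monoid_scheme \<Rightarrow> 'a set \<Rightarrow> ('g \<Rightarrow> 'a \<Rightarrow> 'a) \<Rightarrow> 'a \<Rightarrow> bool" where
  "global_fixed_point G M \<phi> x \<longleftrightarrow> x \<in> M \<and> (\<forall>g\<in>carrier G. \<phi> g x = x)"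

end

theory Submission
  imports Defs "HOL-Library.Sublist" "HOL-Combinatorics.Permutations"
begin

text \<open>A cube of geodesics whose opposite faces lie in disjoint closed convex sets is essential, so by the
  Poincare-Miranda theorem a CAT(0) space of covering dimension \<open>k\<close> has no such \<open>(k + 1)\<close>-cube. Fixed point sets
  are closed and convex. Hence, if a group has \<open>k + 1\<close> commuting conjugates, any two of its subsets that have fixed
  points have a common one: otherwise the fixed point sets of the conjugates would span an essential cube.
  So such a group has a fixed point if it is generated by finitely many elliptic elements.

  The elements of $nV_q$ supported off a cell of the regular grid of depth two form such a group. It is
  generated by finitely many swaps of two bricks, which are involutions, and finitely many baker's maps,
  whose $(q-1)$-st powers are trivial modulo the swaps. Finally, every element of $nV_q$ is a product of
  four elements each supported off some cell, so orbits are bounded, and the circumcentre of an orbit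
  is a global fixed point.\<close>

section \<open>The Poincare-Miranda theorem\<close>

text \<open>The whole group leaves no room for commuting conjugates of itself, but the elements that
  fix a cell \<open>D\<close> pointwise do: some group element carries the complement of
  \<open>D\<close> into \<open>D\<close>, and infinitely many such copies can be kept disjoint. This
  is why fixed points are found cell by cell. Depth two provides four cells for all q >= 2 and n >=
  1, and the conjugation arguments need three cells besides \<open>D\<close>.

  Swaps are involutions and therefore elliptic, but baker's maps have infinite order. The remedy is
  a relation: the baker's maps of the q slabs of a cell, followed by the inverse of the baker's map
  of the cell, exchange two leading digits, which only permutes bricks. As all these baker's maps
  act alike on points fixed by the swaps, b^-1 b^q is trivial there; hence the exponent q - 1.

  The generation argument is an induction on splits, while a division into bricks need not arise by
  repeated splitting. Refinement until the image is a regular grid avoids this difficulty, and since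
  each split adds q - 1 bricks, cardinalities show that both sides have equally many splits.\<close>

lemma compact_hilbert_cube: "compact {x :: nat \<Rightarrow> real. \<forall>j. x j \<in> {0..1}}"
proof -
  have "compactin (product_topology (\<lambda>_::nat. euclideanreal) UNIV) (PiE UNIV (\<lambda>_. {0..1}))"
    by (simp add: compactin_PiE)
  moreover have "PiE UNIV (\<lambda>_::nat. {0..1::real}) = {x. \<forall>j. x j \<in> {0..1}}"
    by auto
  ultimately show ?thesis
    by (simp add: euclidean_product_topology)
qed

text \<open>Kuhn's combinatorial lemma on the grid of mesh 1/p. The label of coordinate
  \<open>i\<close> records the sign of \<open>F i\<close>, so a grid cell on which every label
  changes supplies, for each \<open>i\<close>, nearby points of opposite sign. Coordinates are
  indexed by all of \<open>nat\<close>, so that one type serves every dimension; compactness of the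
  cube is Tychonoff's theorem.\<close>

lemma poincare_miranda_approx:
  fixes F :: "nat \<Rightarrow> (nat \<Rightarrow> real) \<Rightarrow> real"
  defines "C \<equiv> {x. \<forall>j. x j \<in> {0..1}}"
  assumes lo: "\<And>i x. i < n \<Longrightarrow> x \<in> C \<Longrightarrow> x i = 0 \<Longrightarrow> F i x \<ge> 0"
    and hi: "\<And>i x. i < n \<Longrightarrow> x \<in> C \<Longrightarrow> x i = 1 \<Longrightarrow> F i x \<le> 0"
    and "p > 0"
  shows "\<exists>q\<in>C. \<forall>i<n. \<exists>u\<in>C. \<exists>v\<in>C. F i u \<ge> 0 \<and> F i v \<le> 0 \<and>
           (\<forall>j. \<bar>u j - q j\<bar> \<le> 1 / real p \<and> \<bar>v j - q j\<bar> \<le> 1 / real p)"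
proof -
  define pt where "pt = (\<lambda>(x::nat\<Rightarrow>nat) j. if j < n then real (x j) / real p else 0)"
  \<comment> \<open>The clause \<open>x i \<noteq> p\<close> forces label 1 on the upper face, as
    Kuhn's lemma demands, also where \<open>F i\<close> vanishes; there \<open>hi\<close> still
    gives \<open>F i x \<le> 0\<close>.\<close>
  define label where "label = (\<lambda>x i. if F i (pt x) \<ge> 0 \<and> x i \<noteq> p then 0 else (1::nat))"
  have ptC: "pt x \<in> C" if "\<forall>i<n. x i \<le> p" for x
    using that \<open>p > 0\<close> by (auto simp: pt_def C_def)
  obtain q where q: "\<forall>i<n. q i < p"
    and rs: "\<forall>i<n. \<exists>r s. (\<forall>j<n. q j \<le> r j \<and> r j \<le> q j + 1) \<and> (\<forall>j<n. q j \<le> s j \<and> s j \<le> q j + 1) \<and> label r i \<noteq> label s i"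
  proof (rule kuhn_lemma[of p n label])
    show "\<forall>x. (\<forall>i<n. x i \<le> p) \<longrightarrow> (\<forall>i<n. x i = 0 \<longrightarrow> label x i = 0)"
    proof (intro allI impI)
      fix x i assume x: "\<forall>i<n. x i \<le> p" and "i < n" "x i = 0"
      then show "label x i = 0"
        using lo[OF \<open>i < n\<close> ptC[OF x]] \<open>p > 0\<close> by (simp add: label_def pt_def)
    qed
  qed (use \<open>p > 0\<close> in \<open>auto simp: label_def\<close>)
  have close: "\<bar>pt r j - pt q j\<bar> \<le> 1 / real p" if "\<forall>j<n. q j \<le> r j \<and> r j \<le> q j + 1" for r j
  proof (cases "j < n")
    case True
    then have "pt r j - pt q j = (real (r j) - real (q j)) / real p"
      by (simp add: pt_def diff_divide_distrib)
    moreover have "\<bar>real (r j) - real (q j)\<bar> \<le> 1"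
      using that True by fastforce
    ultimately show ?thesis
      by (simp add: divide_right_mono)
  qed (simp add: pt_def)
  have "\<exists>u\<in>C. \<exists>v\<in>C. F i u \<ge> 0 \<and> F i v \<le> 0 \<and>
           (\<forall>j. \<bar>u j - pt q j\<bar> \<le> 1 / real p \<and> \<bar>v j - pt q j\<bar> \<le> 1 / real p)"
    if i: "i < n" for i
  proof -
    have pos: "F i (pt r) \<ge> 0" if "label r i = 0" for r
      using that by (auto simp: label_def split: if_splits)
    have neg: "F i (pt r) \<le> 0" if "label r i \<noteq> 0" "\<forall>j<n. r j \<le> p" for r
    proof (cases "r i = p")
      case True
      then show ?thesis using hi[OF i ptC[OF that(2)]] i \<open>p > 0\<close> by (simp add: pt_def)
    qed (use that in \<open>auto simp: label_def split: if_splits\<close>)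
    obtain r s where r: "\<forall>j<n. q j \<le> r j \<and> r j \<le> q j + 1" and s: "\<forall>j<n. q j \<le> s j \<and> s j \<le> q j + 1"
      and ne: "label r i \<noteq> label s i"
      using rs i by blast
    have rp: "\<forall>j<n. r j \<le> p" and sp: "\<forall>j<n. s j \<le> p"
      using q r s by fastforce+
    show ?thesis
    proof (cases "label r i = 0")
      case True
      then show ?thesis
        using pos[OF True] neg[of s] ne rp sp ptC close[OF r] close[OF s]
        by (intro bexI[of _ "pt r"] bexI[of _ "pt s"]) auto
    next
      case False
      then have "label s i = 0" using ne by (auto simp: label_def split: if_splits)
      then show ?thesis
        using pos[of s] neg[of r] False rp sp ptC close[OF r] close[OF s]
        by (intro bexI[of _ "pt s"] bexI[of _ "pt r"]) auto
    qed
  qed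
  moreover have "pt q \<in> C"
    using ptC q by (simp add: less_imp_le)
  ultimately show ?thesis by blast
qed

text \<open>Approximate zeros on ever finer grids accumulate by compactness. The witnesses
  \<open>u\<close> and \<open>v\<close> of the two signs converge to the same limit as
  \<open>q\<close>, and continuity squeezes \<open>F i\<close> to 0 there.\<close>

lemma poincare_miranda:
  fixes F :: "nat \<Rightarrow> (nat \<Rightarrow> real) \<Rightarrow> real"
  defines "C \<equiv> {x. \<forall>j. x j \<in> {0..1}}"
  assumes cont: "\<And>i. i < n \<Longrightarrow> continuous_on C (F i)"
    and lo: "\<And>i x. i < n \<Longrightarrow> x \<in> C \<Longrightarrow> x i = 0 \<Longrightarrow> F i x \<ge> 0"
    and hi: "\<And>i x. i < n \<Longrightarrow> x \<in> C \<Longrightarrow> x i = 1 \<Longrightarrow> F i x \<le> 0"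
  shows "\<exists>x\<in>C. \<forall>i<n. F i x = 0"
proof -
  have "\<exists>q\<in>C. \<forall>i<n. \<exists>u\<in>C. \<exists>v\<in>C. F i u \<ge> 0 \<and> F i v \<le> 0 \<and>
           (\<forall>j. \<bar>u j - q j\<bar> \<le> 1 / real (Suc p) \<and> \<bar>v j - q j\<bar> \<le> 1 / real (Suc p))" for p
    using poincare_miranda_approx[of n F "Suc p"] lo hi unfolding C_def by blast
  then obtain q where qC: "\<And>p. q p \<in> C" and
    "\<And>p. \<forall>i<n. \<exists>u\<in>C. \<exists>v\<in>C. F i u \<ge> 0 \<and> F i v \<le> 0 \<and>
           (\<forall>j. \<bar>u j - q p j\<bar> \<le> 1 / real (Suc p) \<and> \<bar>v j - q p j\<bar> \<le> 1 / real (Suc p))"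
    by metis
  then obtain u v where u: "\<And>p i. i < n \<Longrightarrow> u p i \<in> C \<and> F i (u p i) \<ge> 0 \<and> (\<forall>j. \<bar>u p i j - q p j\<bar> \<le> 1 / real (Suc p))"
    and v: "\<And>p i. i < n \<Longrightarrow> v p i \<in> C \<and> F i (v p i) \<le> 0 \<and> (\<forall>j. \<bar>v p i j - q p j\<bar> \<le> 1 / real (Suc p))"
    by metis
  have "seq_compact C"
    using compact_hilbert_cube unfolding C_def by (simp add: compact_imp_seq_compact)
  then obtain x r where x: "x \<in> C" "strict_mono (r :: nat \<Rightarrow> nat)" "(q \<circ> r) \<longlonglongrightarrow> x"
    using qC by (metis seq_compactE)
  have coord: "(\<lambda>k. f k) \<longlonglongrightarrow> x \<longleftrightarrow> (\<forall>j. (\<lambda>k. f k j) \<longlonglongrightarrow> x j)" for f :: "nat \<Rightarrow> nat \<Rightarrow> real" and x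
    using limitin_componentwise[of "\<lambda>_::nat. euclideanreal" UNIV f x sequentially]
    by (simp add: euclidean_product_topology)
  have lim: "(\<lambda>k. w (r k)) \<longlonglongrightarrow> x" if w: "\<And>p j. \<bar>w p j - q p j\<bar> \<le> 1 / real (Suc p)" for w
    unfolding coord
  proof
    fix j
    have "(\<lambda>k. q (r k) j) \<longlonglongrightarrow> x j"
      using x(3) coord[of "\<lambda>k. q (r k)" x] by (simp add: o_def)
    moreover have "(\<lambda>k. w (r k) j - q (r k) j) \<longlonglongrightarrow> 0"
    proof (rule Lim_null_comparison)
      show "\<forall>\<^sub>F k in sequentially. norm (w (r k) j - q (r k) j) \<le> 1 / real (Suc (r k))"
        using w by simp
      show "(\<lambda>k. 1 / real (Suc (r k))) \<longlonglongrightarrow> 0"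
        using LIMSEQ_subseq_LIMSEQ[OF LIMSEQ_inverse_real_of_nat x(2)]
        by (simp add: o_def divide_inverse)
    qed
    ultimately show "(\<lambda>k. w (r k) j) \<longlonglongrightarrow> x j"
      using tendsto_add by force
  qed
  have Flim: "(\<lambda>k. F i (w (r k))) \<longlonglongrightarrow> F i x"
    if "i < n" "\<And>p. w p \<in> C" "\<And>p j. \<bar>w p j - q p j\<bar> \<le> 1 / real (Suc p)" for w i
    using continuous_on_tendsto_compose[OF cont[OF that(1)] lim[of w]] that x(1) by auto
  have "F i x = 0" if i: "i < n" for i
  proof (rule antisym)
    show "F i x \<le> 0"
      using Lim_bounded[OF Flim[OF i, of "\<lambda>p. v p i"]] v[OF i] by auto
    show "0 \<le> F i x"
      using Lim_bounded2[OF Flim[OF i, of "\<lambda>p. u p i"]] u[OF i] by auto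
  qed
  then show ?thesis using x(1) by blast
qed

section \<open>Geodesics and circumcentres in CAT(0) spaces\<close>

text \<open>The vertices are (0, 0), (a, 0) and (u, sqrt(c^2 - u^2)), with \<open>u\<close> from the
  law of cosines; the triangle inequalities enter as the factors that show |u| <= c.\<close>

lemma comparison_triangle_exists:
  fixes a b c :: real
  assumes "a \<ge> 0" "b \<ge> 0" "c \<ge> 0" "a \<le> b + c" "b \<le> a + c" "c \<le> a + b"
  shows "\<exists>p q r :: real^2. dist p q = a \<and> dist q r = b \<and> dist r p = c"
proof -
  have dist2: "dist u v = sqrt ((u$1 - v$1)\<^sup>2 + (u$2 - v$2)\<^sup>2)" for u v :: "real^2"
    by (simp add: dist_vec_def L2_set_def sum_2 dist_real_def)
  show ?thesis
  proof (cases "a = 0")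
    case True
    then have "b = c" using assms by auto
    then show ?thesis using True assms
      by (intro exI[of _ "vector [0, 0]"] exI[of _ "vector [c, 0]"]) (auto simp: dist2)
  next
    case False
    then have a: "a > 0" using assms by auto
    define u where "u = (a\<^sup>2 + c\<^sup>2 - b\<^sup>2) / (2 * a)"
    have ua: "2 * a * u = a\<^sup>2 + c\<^sup>2 - b\<^sup>2" using a by (simp add: u_def)
    have "u \<le> c"
    proof -
      have "a\<^sup>2 + c\<^sup>2 - b\<^sup>2 - 2 * a * c = (a - c - b) * (a - c + b)"
        by (simp add: power2_eq_square algebra_simps)
      also have "\<dots> \<le> 0"
        using assms by (intro mult_nonpos_nonneg) auto
      finally have "2 * a * u \<le> 2 * a * c" using ua by simp
      then show ?thesis using a by simp
    qed
    moreover have "- c \<le> u"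
    proof -
      have "a\<^sup>2 + c\<^sup>2 - b\<^sup>2 + 2 * a * c = (a + c - b) * (a + c + b)"
        by (simp add: power2_eq_square algebra_simps)
      also have "\<dots> \<ge> 0"
        using assms by (intro mult_nonneg_nonneg) auto
      finally have "2 * a * (- c) \<le> 2 * a * u" using ua by simp
      then show ?thesis by (rule mult_left_le_imp_le) (use a in simp)
    qed
    ultimately have "u\<^sup>2 \<le> c\<^sup>2"
      by (simp add: abs_le_square_iff[symmetric])
    then have v: "(sqrt (c\<^sup>2 - u\<^sup>2))\<^sup>2 = c\<^sup>2 - u\<^sup>2" by simp
    have "(a - u)\<^sup>2 + (c\<^sup>2 - u\<^sup>2) = b\<^sup>2"
      using ua by (simp add: power2_eq_square algebra_simps)
    then show ?thesis using assms v
      by (intro exI[of _ "vector [0, 0]"] exI[of _ "vector [a, 0]"] exI[of _ "vector [u, sqrt (c\<^sup>2 - u\<^sup>2)]"])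
        (auto simp: dist2)
  qed
qed

lemma geodesic_path_reverse:
  assumes "Metric_space M d" "x \<in> M" "y \<in> M" "geodesic_path M d x y c"
  shows "geodesic_path M d y x (\<lambda>s. c (d x y - s))"
proof -
  interpret Metric_space M d by fact
  have "d y x = d x y" by (rule commute)
  then show ?thesis
    using assms(4) unfolding geodesic_path_def by (auto simp: image_subset_iff)
qed

locale CAT0 = Metric_space M d for M :: "'a set" and d :: "'a \<Rightarrow> 'a \<Rightarrow> real" +
  assumes cat0: "CAT0_space M d"
begin

text \<open>Constant-speed parametrisation by the unit interval; \<open>geodesic_unique\<close>
  shows that the choice does not matter.\<close>

definition geod :: "'a \<Rightarrow> 'a \<Rightarrow> real \<Rightarrow> 'a" where
  "geod x y t = (SOME c. geodesic_path M d x y c) (t * d x y)"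

lemma geodesic_some:
  assumes "x \<in> M" "y \<in> M"
  shows "geodesic_path M d x y (SOME c. geodesic_path M d x y c)"
  using cat0 assms unfolding CAT0_space_def geodesic_space_def by (metis someI_ex)

lemma scaled_dist_mem: "t \<in> {0..1} \<Longrightarrow> t * d x y \<in> {0..d x y}"
  by (simp add: mult_left_le_one_le)

lemma geodesic_point:
  assumes "geodesic_path M d x y c" "t \<in> {0..1}"
  shows "c (t * d x y) \<in> M"
  using assms scaled_dist_mem[of t x y] unfolding geodesic_path_def by blast

lemma geod_in [simp]: "x \<in> M \<Longrightarrow> y \<in> M \<Longrightarrow> t \<in> {0..1} \<Longrightarrow> geod x y t \<in> M"
  unfolding geod_def by (rule geodesic_point[OF geodesic_some])

lemma geod_0 [simp]: "x \<in> M \<Longrightarrow> y \<in> M \<Longrightarrow> geod x y 0 = x"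
  and geod_1 [simp]: "x \<in> M \<Longrightarrow> y \<in> M \<Longrightarrow> geod x y 1 = y"
  using geodesic_some[of x y] unfolding geod_def geodesic_path_def by auto

lemma dist_gd_gd:
  assumes "x \<in> M" "y \<in> M" "s \<in> {0..1}" "t \<in> {0..1}"
  shows "d (geod x y s) (geod x y t) = \<bar>s - t\<bar> * d x y"
proof -
  have "d (geod x y s) (geod x y t) = \<bar>s * d x y - t * d x y\<bar>"
    using geodesic_some[OF assms(1,2)] scaled_dist_mem[OF assms(3)] scaled_dist_mem[OF assms(4)]
    unfolding geod_def geodesic_path_def by blast
  then show ?thesis by (simp add: left_diff_distrib[symmetric] abs_mult)
qed

lemma comparison_triangle:
  assumes "x \<in> M" "y \<in> M" "z \<in> M"
  obtains x' y' z' :: "real^2" where "dist x' y' = d x y" "dist y' z' = d y z" "dist z' x' = d z x"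
proof -
  have "d x y \<le> d y z + d z x" "d y z \<le> d x y + d z x" "d z x \<le> d x y + d y z"
    using triangle[of x z y] triangle[of y x z] triangle[of z y x] assms commute by (auto simp: algebra_simps)
  then show thesis
    using comparison_triangle_exists[of "d x y" "d y z" "d z x"] that by auto
qed

lemma CAT0_sides:
  assumes "x \<in> M" "y \<in> M" "z \<in> M"
    and "geodesic_path M d x y c1" "geodesic_path M d y z c2" "geodesic_path M d z x c3"
    and "dist x' y' = d x y" "dist y' z' = d y z" "dist z' x' = d z x"
    and "(p, p') \<in> side_comparison d x y c1 x' y' \<union> side_comparison d y z c2 y' z' \<union> side_comparison d z x c3 z' x'"
    and "(r, r') \<in> side_comparison d x y c1 x' y' \<union> side_comparison d y z c2 y' z' \<union> side_comparison d z x c3 z' x'"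
  shows "d p r \<le> dist p' r'"
proof -
  have "CAT0_inequality M d" using cat0 by (simp add: CAT0_space_def)
  then have "let T = side_comparison d x y c1 x' y' \<union> side_comparison d y z c2 y' z' \<union> side_comparison d z x c3 z' x'
         in \<forall>(x, x')\<in>T. \<forall>(y, y')\<in>T. d x y \<le> dist x' y'"
    unfolding CAT0_inequality_def using assms(1-9) by blast
  then show ?thesis using assms(10,11) unfolding Let_def by fast
qed

lemma side_comparison_point:
  assumes "dist x' y' = d x y" "t \<in> {0..1}"
  shows "(c (t * d x y), x' + t *\<^sub>R (y' - x')) \<in> side_comparison d x y c x' y'"
proof -
  have "dist x' (x' + t *\<^sub>R (y' - x')) = t * d x y"
    using assms by (simp add: dist_norm norm_minus_commute)
  moreover have "x' + t *\<^sub>R (y' - x') \<in> closed_segment x' y'"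
    using assms(2) by (auto simp: in_segment algebra_simps intro!: exI[of _ t])
  ultimately show ?thesis
    using scaled_dist_mem[OF assms(2), of x y] unfolding side_comparison_def by blast
qed

text \<open>By the intercept theorem the comparison points at parameter \<open>t\<close> differ by
  t(y' - z'). Comparison triangles are traversed cyclically, so the second geodesic is reversed and
  its point has parameter \<open>1 - t\<close> on the side from \<open>z\<close> to
  \<open>x\<close>.\<close>

lemma geodesics_from_common_point:
  assumes "x \<in> M" "y \<in> M" "z \<in> M" and c: "geodesic_path M d x y c" and c': "geodesic_path M d x z c'"
    and t: "t \<in> {0..1}"
  shows "d (c (t * d x y)) (c' (t * d x z)) \<le> t * d y z"
proof -
  obtain x' y' z' :: "real^2" where tri: "dist x' y' = d x y" "dist y' z' = d y z" "dist z' x' = d z x"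
    using comparison_triangle assms(1-3) by blast
  define c3 where "c3 = (\<lambda>s. c' (d x z - s))"
  have c3: "geodesic_path M d z x c3"
    unfolding c3_def using geodesic_path_reverse[OF Metric_space_axioms _ _ c'] assms by blast
  have "c3 ((1 - t) * d z x) = c' (t * d x z)"
    by (simp add: c3_def commute algebra_simps)
  then have "d (c (t * d x y)) (c' (t * d x z)) \<le> dist (x' + t *\<^sub>R (y' - x')) (z' + (1 - t) *\<^sub>R (x' - z'))"
    using CAT0_sides[OF assms(1-3) c geodesic_some c3 tri, of "c (t * d x y)" _ "c3 ((1 - t) * d z x)"]
      side_comparison_point[OF tri(1) t, of c] side_comparison_point[OF tri(3), of "1 - t" c3] t assms by auto
  also have "\<dots> = norm (t *\<^sub>R (y' - z'))"
    by (simp add: dist_norm algebra_simps)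
  also have "\<dots> = t * d y z"
    using t tri by (simp add: dist_norm)
  finally show ?thesis .
qed

text \<open>The degenerate triangle with vertices \<open>x\<close>, \<open>y\<close>,
  \<open>y\<close>: its third side has length 0.\<close>

lemma geodesic_unique:
  assumes "x \<in> M" "y \<in> M" "geodesic_path M d x y c" "t \<in> {0..1}"
  shows "c (t * d x y) = geod x y t"
proof -
  have "d (c (t * d x y)) (geod x y t) \<le> 0"
    using geodesics_from_common_point[OF assms(1,2,2) assms(3) geodesic_some assms(4)] assms
    unfolding geod_def by simp
  then show ?thesis
    using geodesic_point[OF assms(3,4)] geod_in[OF assms(1,2,4)] nonneg zero by (metis order_antisym)
qed

lemma geod_reverse:
  assumes "x \<in> M" "y \<in> M" "t \<in> {0..1}"
  shows "geod y x t = geod x y (1 - t)"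
proof -
  have "(\<lambda>s. (SOME c. geodesic_path M d x y c) (d x y - s)) (t * d y x) = geod y x t"
    using assms geodesic_path_reverse[OF Metric_space_axioms _ _ geodesic_some]
    by (intro geodesic_unique) auto
  then show ?thesis
    unfolding geod_def by (simp add: commute algebra_simps)
qed

lemma geod_common_source:
  assumes "x \<in> M" "y \<in> M" "z \<in> M" "t \<in> {0..1}"
  shows "d (geod x y t) (geod x z t) \<le> t * d y z"
  unfolding geod_def using geodesics_from_common_point[OF assms(1-3) geodesic_some geodesic_some assms(4)] assms by blast

text \<open>One end point is moved at a time, the source by way of the reversed geodesics; the last
  term is the change of parameter.\<close>

lemma geod_lipschitz:
  assumes "a \<in> M" "b \<in> M" "a' \<in> M" "b' \<in> M" "t \<in> {0..1}" "s \<in> {0..1}"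
  shows "d (geod a b t) (geod a' b' s) \<le> d a a' + d b b' + \<bar>t - s\<bar> * d a' b'"
proof -
  have 1: "d (geod a b t) (geod a b' t) \<le> t * d b b'"
    using geod_common_source assms by blast
  have 2: "d (geod a b' t) (geod a' b' t) \<le> (1 - t) * d a a'"
    using geod_common_source[of b' a a' "1 - t"] geod_reverse[of a b' "1 - t"] geod_reverse[of a' b' "1 - t"] assms by simp
  have 3: "d (geod a' b' t) (geod a' b' s) = \<bar>t - s\<bar> * d a' b'"
    using dist_gd_gd assms by blast
  have "t * d b b' \<le> d b b'" "(1 - t) * d a a' \<le> d a a'"
    using assms by (simp_all add: mult_left_le_one_le)
  moreover have "d (geod a b t) (geod a' b' s) \<le> d (geod a b t) (geod a b' t) + (d (geod a b' t) (geod a' b' t) + d (geod a' b' t) (geod a' b' s))"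
    using triangle[of "geod a b t" "geod a b' t" "geod a' b' s"] triangle[of "geod a b' t" "geod a' b' t" "geod a' b' s"] assms geod_in
    by (smt (verit))
  ultimately show ?thesis using 1 2 3 by linarith
qed

text \<open>The Bruhat-Tits inequality: \<open>p\<close> is compared with the midpoint of the
  opposite side, and the Euclidean comparison triangle obeys the median formula.\<close>

lemma CN_inequality:
  assumes "p \<in> M" "q \<in> M" "r \<in> M"
  shows "(d p (geod q r (1/2)))\<^sup>2 \<le> (d p q)\<^sup>2 / 2 + (d p r)\<^sup>2 / 2 - (d q r)\<^sup>2 / 4"
proof -
  obtain p' q' r' :: "real^2" where tri: "dist p' q' = d p q" "dist q' r' = d q r" "dist r' p' = d r p"
    using comparison_triangle assms by blast
  let ?m = "q' + (1/2) *\<^sub>R (r' - q')"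
  have "p = (SOME c. geodesic_path M d p q c) (0 * d p q)"
    using geodesic_some[OF assms(1,2)] unfolding geodesic_path_def by simp
  then have "(p, p') \<in> side_comparison d p q (SOME c. geodesic_path M d p q c) p' q'"
    using side_comparison_point[OF tri(1), of 0 "SOME c. geodesic_path M d p q c"] by simp
  moreover have "(geod q r (1/2), ?m) \<in> side_comparison d q r (SOME c. geodesic_path M d q r c) q' r'"
    using side_comparison_point[OF tri(2), of "1/2" "SOME c. geodesic_path M d q r c"] unfolding geod_def by simp
  ultimately have "d p (geod q r (1/2)) \<le> dist p' ?m"
    using CAT0_sides[OF assms geodesic_some geodesic_some geodesic_some tri] assms by blast
  then have "(d p (geod q r (1/2)))\<^sup>2 \<le> (dist p' ?m)\<^sup>2"
    by (simp add: power_mono)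
  also have "\<dots> = (dist p' q')\<^sup>2 / 2 + (dist r' p')\<^sup>2 / 2 - (dist q' r')\<^sup>2 / 4"
    unfolding dist_norm power2_norm_eq_inner
    by (simp add: inner_simps inner_commute field_simps)
  finally show ?thesis using tri commute by simp
qed

section \<open>Convex sets, fixed points and circumcentres\<close>

definition convex_subset :: "'a set \<Rightarrow> bool" where
  "convex_subset Y \<longleftrightarrow> Y \<subseteq> M \<and> (\<forall>x\<in>Y. \<forall>y\<in>Y. \<forall>t\<in>{0..1}. geod x y t \<in> Y)"

lemma isometry_gd:
  assumes h: "isometry_of M d h" and "x \<in> M" "y \<in> M" "t \<in> {0..1}"
  shows "h (geod x y t) = geod (h x) (h y) t"
proof -
  have hM: "\<And>x. x \<in> M \<Longrightarrow> h x \<in> M" and hd: "\<And>x y. x \<in> M \<Longrightarrow> y \<in> M \<Longrightarrow> d (h x) (h y) = d x y"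
    using h by (auto simp: isometry_of_def bij_betw_def)
  have "geodesic_path M d (h x) (h y) (h \<circ> (SOME c. geodesic_path M d x y c))"
    using geodesic_some[OF assms(2,3)] hM hd assms unfolding geodesic_path_def
    by (auto simp: image_subset_iff)
  from geodesic_unique[OF _ _ this assms(4)] show ?thesis
    using hM hd assms by (simp add: geod_def)
qed

lemma closedin_fixed_points:
  assumes h: "isometry_of M d h"
  shows "closedin mtopology {x \<in> M. h x = x}"
  unfolding closedin_metric
proof (intro conjI allI impI)
  fix x assume "x \<in> M - {x \<in> M. h x = x}"
  then have x: "x \<in> M" "h x \<noteq> x" by auto
  have hM: "\<And>x. x \<in> M \<Longrightarrow> h x \<in> M" and hd: "\<And>x y. x \<in> M \<Longrightarrow> y \<in> M \<Longrightarrow> d (h x) (h y) = d x y"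
    using h by (auto simp: isometry_of_def bij_betw_def)
  have "d x (h x) > 0" using x hM by auto
  moreover have "disjnt {x \<in> M. h x = x} (mball x (d x (h x) / 2))"
  proof -
    have "\<not> d x y < d x (h x) / 2" if "y \<in> M" "h y = y" for y
    proof -
      have "d x (h x) \<le> d x y + d y (h x)" using triangle x that hM by blast
      also have "d y (h x) = d x y" using hd[of x y] x that commute by simp
      finally show ?thesis by simp
    qed
    then show ?thesis unfolding disjnt_def by auto
  qed
  ultimately show "\<exists>r>0. disjnt {x \<in> M. h x = x} (mball x r)"
    by (intro exI[of _ "d x (h x) / 2"]) simp
qed auto

text \<open>By the Bruhat-Tits inequality the circumradius function attains its infimum over
  \<open>Y\<close> at exactly one point, so every isometry preserving \<open>B\<close> and
  \<open>Y\<close> fixes that point. Admitting a closed convex \<open>Y\<close> instead of only the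
  whole space pays off when \<open>B\<close> is a single point: the centre is then its nearest point
  projection onto \<open>Y\<close>.\<close>

lemma circumcenter_exists:
  assumes "mcomplete" and Y: "convex_subset Y" "closedin mtopology Y" "Y \<noteq> {}"
    and B: "B \<subseteq> M" "B \<noteq> {}" and bdd: "x0 \<in> M" "\<And>b. b \<in> B \<Longrightarrow> d x0 b \<le> R"
  shows "\<exists>c\<in>Y. \<forall>h. isometry_of M d h \<and> h ` B = B \<and> h ` Y \<subseteq> Y \<longrightarrow> h c = c"
proof -
  define r where "r = (\<lambda>y. SUP b\<in>B. d y b)"
  define \<rho> where "\<rho> = (INF y\<in>Y. r y)"
  have YM: "y \<in> M" if "y \<in> Y" for y using Y that by (auto simp: convex_subset_def)
  have bdd_above: "bdd_above ((\<lambda>b. d y b) ` B)" if "y \<in> M" for y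
  proof (rule bdd_aboveI2)
    fix b assume "b \<in> B"
    then show "d y b \<le> d y x0 + R"
      using triangle[of y x0 b] bdd that B by fastforce
  qed
  have r_upper: "d y b \<le> r y" if "y \<in> M" "b \<in> B" for y b
    unfolding r_def by (rule cSUP_upper[OF that(2) bdd_above[OF that(1)]])
  have r_least: "r y \<le> K" if "\<And>b. b \<in> B \<Longrightarrow> d y b \<le> K" for y K
    unfolding r_def by (rule cSUP_least[OF B(2) that])
  have r_nonneg: "0 \<le> r y" if "y \<in> M" for y
  proof -
    obtain b where "b \<in> B" using B by blast
    then show ?thesis using r_upper[OF that, of b] nonneg[of y b] by linarith
  qed
  have \<rho>_le: "\<rho> \<le> r y" if "y \<in> Y" for y
    unfolding \<rho>_def using that r_nonneg YM by (intro cINF_lower bdd_belowI2[of _ 0]) auto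
  have \<rho>_nonneg: "0 \<le> \<rho>"
    unfolding \<rho>_def using Y r_nonneg YM by (intro cINF_greatest) auto
  \<comment> \<open>The circumradius at the midpoint of \<open>y\<close> and \<open>y'\<close> is
    still at least \<rho>, which bounds the distance of two almost minimal points.\<close>
  have key: "(d y y')\<^sup>2 \<le> 2 * ((r y)\<^sup>2 + (r y')\<^sup>2) - 4 * \<rho>\<^sup>2" if "y \<in> Y" "y' \<in> Y" for y y'
  proof -
    define m where "m = geod y y' (1/2)"
    define K where "K = (r y)\<^sup>2 / 2 + (r y')\<^sup>2 / 2 - (d y y')\<^sup>2 / 4"
    have m: "m \<in> Y" using Y that unfolding convex_subset_def m_def by simp
    have *: "(d m b)\<^sup>2 \<le> K" if b: "b \<in> B" for b
    proof -
      have "(d b m)\<^sup>2 \<le> (d b y)\<^sup>2 / 2 + (d b y')\<^sup>2 / 2 - (d y y')\<^sup>2 / 4"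
        unfolding m_def using CN_inequality B b YM \<open>y \<in> Y\<close> \<open>y' \<in> Y\<close> by blast
      moreover have "(d b y)\<^sup>2 \<le> (r y)\<^sup>2" "(d b y')\<^sup>2 \<le> (r y')\<^sup>2"
        using r_upper[OF YM b] \<open>y \<in> Y\<close> \<open>y' \<in> Y\<close> commute[of b] by (auto intro!: power_mono)
      ultimately show ?thesis unfolding K_def using commute[of b m] by simp
    qed
    then have "K \<ge> 0" using B zero_le_power2 order_trans by blast
    have "r m \<le> sqrt K"
      using * by (intro r_least real_le_rsqrt)
    then have "\<rho> \<le> sqrt K" using \<rho>_le[OF m] by simp
    then have "\<rho>\<^sup>2 \<le> (sqrt K)\<^sup>2" using \<rho>_nonneg by (intro power_mono)
    then have "\<rho>\<^sup>2 \<le> K" using \<open>K \<ge> 0\<close> by simp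
    then show ?thesis unfolding K_def by simp
  qed
  have lin: "D \<le> 4 * E - 4 * P" if "D \<le> 2 * (A + B) - 4 * P" "A \<le> E" "B \<le> E" for A B D E P :: real
    using that by argo
  have "\<exists>y\<in>Y. r y < \<rho> + 1 / real (Suc n)" for n
  proof (rule ccontr)
    assume "\<not> (\<exists>y\<in>Y. r y < \<rho> + 1 / real (Suc n))"
    then have "\<rho> + 1 / real (Suc n) \<le> (INF y\<in>Y. r y)"
      using Y(3) by (intro cINF_greatest) (auto simp: not_less)
    then show False unfolding \<rho>_def by (simp add: field_simps)
  qed
  then obtain y where y: "\<And>n. y n \<in> Y" and ry: "\<And>n. r (y n) < \<rho> + 1 / real (Suc n)"
    by metis
  have dist_y: "(d (y m) (y n))\<^sup>2 \<le> (8 * \<rho> + 4) * (1 / real (Suc N))" if "N \<le> m" "N \<le> n" for N m n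
  proof -
    define e where "e = 1 / real (Suc N)"
    have e: "0 \<le> e" "e \<le> 1" by (auto simp: e_def)
    have rr: "(r (y k))\<^sup>2 \<le> (\<rho> + e)\<^sup>2" if "N \<le> k" for k
    proof (rule power_mono)
      have "1 / real (Suc k) \<le> e" unfolding e_def using that by (intro divide_left_mono) auto
      then show "r (y k) \<le> \<rho> + e" using ry[of k] by linarith
    qed (use r_nonneg YM y in auto)
    have "(d (y m) (y n))\<^sup>2 \<le> 4 * (\<rho> + e)\<^sup>2 - 4 * \<rho>\<^sup>2"
      using lin[OF key[OF y y] rr[OF that(1)] rr[OF that(2)]] .
    also have "\<dots> = (8 * \<rho> + 4 * e) * e" by (simp add: power2_eq_square algebra_simps)
    also have "\<dots> \<le> (8 * \<rho> + 4) * e" using e by (intro mult_right_mono) auto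
    finally show ?thesis unfolding e_def .
  qed
  have "MCauchy y"
    unfolding MCauchy_def
  proof (intro conjI allI impI)
    fix \<epsilon> :: real assume "\<epsilon> > 0"
    have pos: "8 * \<rho> + 4 > 0" using \<rho>_nonneg by simp
    then obtain N where N: "1 / real (Suc N) < \<epsilon>\<^sup>2 / (8 * \<rho> + 4)"
      using \<open>\<epsilon> > 0\<close> nat_approx_posE[of "\<epsilon>\<^sup>2 / (8 * \<rho> + 4)"] by (metis divide_pos_pos zero_less_power)
    have "(8 * \<rho> + 4) * (1 / real (Suc N)) < \<epsilon>\<^sup>2"
      using mult_strict_left_mono[OF N pos] pos by simp
    then have "d (y m) (y n) < \<epsilon>" if "N \<le> m" "N \<le> n" for m n
      using dist_y[OF that] \<open>\<epsilon> > 0\<close> by (smt (verit) power_mono)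
    then show "\<exists>N. \<forall>n n'. N \<le> n \<longrightarrow> N \<le> n' \<longrightarrow> d (y n) (y n') < \<epsilon>" by blast
  qed (use y YM in auto)
  then obtain c where lim: "limitin mtopology y c sequentially"
    using \<open>mcomplete\<close> unfolding mcomplete_def by blast
  have c: "c \<in> Y"
    by (rule limitin_closedin[OF lim Y(2)]) (use y in auto)
  \<comment> \<open>The circumradius function is 1-Lipschitz, so the limit of a minimising sequence
    is a minimiser.\<close>
  have rc: "r c \<le> \<rho>"
  proof (rule field_le_epsilon)
    fix e :: real assume "e > 0"
    obtain N where N: "\<And>n. n \<ge> N \<Longrightarrow> d (y n) c < e / 2"
      using lim \<open>e > 0\<close> unfolding limit_metric_sequentially by (meson half_gt_zero)
    obtain N' where N': "1 / real (Suc N') < e / 2"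
      using \<open>e > 0\<close> nat_approx_posE[of "e / 2"] by (metis half_gt_zero)
    define n where "n = max N N'"
    have "1 / real (Suc n) \<le> 1 / real (Suc N')" unfolding n_def by (intro divide_left_mono) auto
    then have rn: "r (y n) < \<rho> + e / 2" using ry[of n] N' by linarith
    show "r c \<le> \<rho> + e"
    proof (rule r_least)
      fix b assume "b \<in> B"
      then have "d c b \<le> d (y n) c + r (y n)"
        using triangle[of c "y n" b] r_upper[of "y n" b] YM[OF c] YM[OF y[of n]] B(1) commute[of c "y n"]
        by (auto simp: subset_iff)
      then show "d c b \<le> \<rho> + e" using rn N[of n] by (simp add: n_def)
    qed
  qed
  have "h c = c" if h: "isometry_of M d h" "h ` B = B" "h ` Y \<subseteq> Y" for h
  proof -
    have hc: "h c \<in> Y" using h c by blast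
    have "r (h c) \<le> \<rho>"
    proof (rule r_least)
      fix b assume "b \<in> B"
      then obtain b' where b': "b' \<in> B" "b = h b'" using h by blast
      then have "d (h c) b = d c b'" using h B YM[OF c] unfolding isometry_of_def by blast
      then show "d (h c) b \<le> \<rho>" using r_upper[OF YM[OF c] b'(1)] rc by simp
    qed
    then have "(r (h c))\<^sup>2 \<le> \<rho>\<^sup>2" "(r c)\<^sup>2 \<le> \<rho>\<^sup>2"
      using rc r_nonneg YM c hc by (auto intro!: power_mono)
    then have "(d (h c) c)\<^sup>2 \<le> 0"
      using lin[OF key[OF hc c]] by fastforce
    then show ?thesis using zero[of "h c" c] YM c hc by simp
  qed
  then show ?thesis using c by blast
qed

end

section \<open>Cubes and covering dimension\<close>

text \<open>The bound involves finitely many coordinates, and each of them is continuous in the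
  product topology.\<close>

lemma continuous_on_l1_lipschitz:
  fixes f :: "(nat \<Rightarrow> real) \<Rightarrow> real"
  assumes "\<And>x y. x \<in> C \<Longrightarrow> y \<in> C \<Longrightarrow> \<bar>f x - f y\<bar> \<le> K * (\<Sum>j<n. \<bar>x j - y j\<bar>)"
  shows "continuous_on C f"
  unfolding continuous_on_def
proof
  fix x assume x: "x \<in> C"
  have coord: "((\<lambda>y. y j) \<longlongrightarrow> x j) (at x within C)" for j
    using continuous_on_product_then_coordinatewise[OF continuous_on_id, of C j] x
    unfolding continuous_on_def by auto
  have "((\<lambda>y. K * (\<Sum>j<n. \<bar>y j - x j\<bar>)) \<longlongrightarrow> K * (\<Sum>j<n. \<bar>x j - x j\<bar>)) (at x within C)"
    by (intro tendsto_intros coord)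
  then have lim0: "((\<lambda>y. K * (\<Sum>j<n. \<bar>y j - x j\<bar>)) \<longlongrightarrow> 0) (at x within C)" by simp
  have "((\<lambda>y. f y - f x) \<longlongrightarrow> 0) (at x within C)"
    by (rule Lim_null_comparison[OF _ lim0])
      (use assms x in \<open>auto simp: eventually_at_filter\<close>)
  then show "(f \<longlongrightarrow> f x) (at x within C)"
    by (simp add: LIM_zero_iff)
qed

context Metric_space
begin

text \<open>The infimal convolution of the indicator function of \<open>D\<close> with the metric is
  min(1, distance to the complement of \<open>D\<close>); in this form an empty complement is no
  special case.\<close>

lemma open_indicator_lipschitz:
  assumes D: "openin mtopology D"
  shows "\<exists>\<mu>::'a \<Rightarrow> real. \<forall>y\<in>M. 0 \<le> \<mu> y \<and> (0 < \<mu> y \<longleftrightarrow> y \<in> D) \<and> (\<forall>z\<in>M. \<bar>\<mu> y - \<mu> z\<bar> \<le> d y z)"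
proof -
  define g where "g = (\<lambda>y z. (if z \<in> D then 1 else 0) + d y z)"
  define \<mu> where "\<mu> = (\<lambda>y. INF z\<in>M. g y z)"
  have bdd: "bdd_below (g y ` M)" for y
    by (rule bdd_belowI2[of _ 0]) (auto simp: g_def)
  have lower: "\<mu> y \<le> g y z" if "z \<in> M" for y z
    unfolding \<mu>_def by (rule cINF_lower[OF bdd that])
  have half: "\<mu> y \<le> \<mu> z + d y z" if "y \<in> M" "z \<in> M" for y z
  proof -
    have "\<mu> y - d y z \<le> (INF w\<in>M. g z w)"
    proof (rule cINF_greatest)
      fix w assume "w \<in> M"
      then show "\<mu> y - d y z \<le> g z w"
        using lower[of w y] triangle[OF that \<open>w \<in> M\<close>] unfolding g_def by linarith
    qed (use that in auto)
    then show ?thesis unfolding \<mu>_def by simp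
  qed
  show ?thesis
  proof (intro exI[of _ \<mu>] ballI conjI)
    fix y assume y: "y \<in> M"
    show nn: "0 \<le> \<mu> y"
      unfolding \<mu>_def using y by (intro cINF_greatest) (auto simp: g_def)
    show "0 < \<mu> y \<longleftrightarrow> y \<in> D"
    proof
      assume "y \<in> D"
      then obtain r where r: "r > 0" "mball y r \<subseteq> D"
        using D openin_mtopology by blast
      have "min 1 r \<le> \<mu> y"
        unfolding \<mu>_def
      proof (rule cINF_greatest)
        fix z assume "z \<in> M"
        then show "min 1 r \<le> g y z"
          using r(2) y nonneg[of y z] by (cases "z \<in> D") (auto simp: g_def subset_iff not_less[symmetric])
      qed (use y in auto)
      then show "0 < \<mu> y" using r by linarith
    next
      assume "0 < \<mu> y"
      then show "y \<in> D" using lower[OF y, of y] y by (auto simp: g_def split: if_splits)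
    qed
    fix z assume z: "z \<in> M"
    show "\<bar>\<mu> y - \<mu> z\<bar> \<le> d y z"
      using half[OF y z] half[OF z y] commute[of y z] by linarith
  qed
qed

end

section \<open>Essential cubes of geodesics\<close>

context CAT0
begin

text \<open>The vertex of the cube with coordinate 1 exactly on \<open>F\<close> goes to \<open>p F\<close>.\<close>

primrec cube_map :: "(nat set \<Rightarrow> 'a) \<Rightarrow> nat \<Rightarrow> nat set \<Rightarrow> (nat \<Rightarrow> real) \<Rightarrow> 'a" where
  "cube_map p 0 F x = p F"
| "cube_map p (Suc m) F x = geod (cube_map p m F x) (cube_map p m (insert m F) x) (x m)"

text \<open>Stage \<open>m\<close> with base vertex \<open>F\<close> only uses the vertices that
  agree with \<open>F\<close> in the coordinates from \<open>m\<close> on, and geodesics between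
  points of a convex set stay inside it.\<close>

lemma cube_map_in_convex:
  assumes "convex_subset S" "\<And>j. x j \<in> {0..1}" "\<And>F'. F' \<inter> {m..} = F \<inter> {m..} \<Longrightarrow> p F' \<in> S"
  shows "cube_map p m F x \<in> S"
  using assms(3)
proof (induction m arbitrary: F)
  case (Suc m)
  have "F' \<inter> {Suc m..} = F \<inter> {Suc m..}" if "F' \<inter> {m..} = F \<inter> {m..} \<or> F' \<inter> {m..} = insert m F \<inter> {m..}" for F'
  proof -
    have "X \<inter> {Suc m..} = X \<inter> {m..} \<inter> {Suc m..}" "insert m X \<inter> {Suc m..} = X \<inter> {Suc m..}" for X :: "nat set"
      by auto
    then show ?thesis using that by metis
  qed
  then have "cube_map p m F x \<in> S" "cube_map p m (insert m F) x \<in> S"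
    by (auto intro!: Suc.IH intro: Suc.prems)
  then show ?case using assms(1) assms(2)[of m] unfolding convex_subset_def by simp
qed auto

lemma convex_subset_M: "convex_subset M"
  unfolding convex_subset_def by auto

lemma cube_map_in:
  assumes "\<And>F. p F \<in> M" "\<And>j. x j \<in> {0..1}"
  shows "cube_map p m F x \<in> M"
  using cube_map_in_convex[OF convex_subset_M] assms by blast

text \<open>Coordinate 0 in direction \<open>i\<close> selects the starting points of the geodesics,
  so only vertices without \<open>i\<close> contribute. The stages insert indices into
  \<open>F\<close> and never delete them; hence the assumption \<open>i \<notin> F\<close>, which
  has no counterpart on the opposite face.\<close>

lemma cube_map_face0:
  assumes S: "convex_subset S" "\<And>F'. i \<notin> F' \<Longrightarrow> p F' \<in> S" and x: "\<And>j. x j \<in> {0..1}" and p: "\<And>F. p F \<in> M"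
    and "x i = 0" "i < m" "i \<notin> F"
  shows "cube_map p m F x \<in> S"
  using assms(6,7)
proof (induction m arbitrary: F)
  case (Suc m)
  show ?case
  proof (cases "i = m")
    case True
    have "cube_map p m F x \<in> S"
      using Suc.prems True by (intro cube_map_in_convex S x) blast
    then show ?thesis using True \<open>x i = 0\<close> cube_map_in[of p x] p x by simp
  next
    case False
    then have "cube_map p m F x \<in> S" "cube_map p m (insert m F) x \<in> S"
      using Suc by auto
    then show ?thesis using S(1) x unfolding convex_subset_def by auto
  qed
qed auto

lemma cube_map_face1:
  assumes S: "convex_subset S" "\<And>F'. i \<in> F' \<Longrightarrow> p F' \<in> S" and x: "\<And>j. x j \<in> {0..1}" and p: "\<And>F. p F \<in> M"
    and "x i = 1" "i < m"
  shows "cube_map p m F x \<in> S"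
  using assms(6)
proof (induction m arbitrary: F)
  case (Suc m)
  show ?case
  proof (cases "i = m")
    case True
    have "cube_map p m (insert m F) x \<in> S"
      using True by (intro cube_map_in_convex S x) blast
    then show ?thesis using True \<open>x i = 1\<close> cube_map_in[of p x] p x by simp
  next
    case False
    then have "cube_map p m F x \<in> S" "cube_map p m (insert m F) x \<in> S"
      using Suc by auto
    then show ?thesis using S(1) x unfolding convex_subset_def by auto
  qed
qed auto

text \<open>By \<open>geod_lipschitz\<close> the induction step needs a bound \<open>K\<close> on
  the lengths of the geodesics that join two opposite faces. It comes from the length at the corner
  0 and the Lipschitz constants of the two faces.\<close>

lemma cube_map_lipschitz:
  assumes p: "\<And>F. p F \<in> M"
  shows "\<exists>L\<ge>0. \<forall>x y. (\<forall>j. x j \<in> {0..1}) \<longrightarrow> (\<forall>j. y j \<in> {0..1}) \<longrightarrow>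
           d (cube_map p m F x) (cube_map p m F y) \<le> L * (\<Sum>j<m. \<bar>x j - y j\<bar>)"
proof (induction m arbitrary: F)
  case 0
  then show ?case using p by (auto intro!: exI[of _ 0])
next
  case (Suc m)
  let ?C = "\<lambda>x::nat\<Rightarrow>real. \<forall>j. x j \<in> {0..1}"
  obtain L1 where L1: "L1 \<ge> 0" "\<And>x y. ?C x \<Longrightarrow> ?C y \<Longrightarrow> d (cube_map p m F x) (cube_map p m F y) \<le> L1 * (\<Sum>j<m. \<bar>x j - y j\<bar>)"
    using Suc.IH[of F] by blast
  obtain L2 where L2: "L2 \<ge> 0" "\<And>x y. ?C x \<Longrightarrow> ?C y \<Longrightarrow> d (cube_map p m (insert m F) x) (cube_map p m (insert m F) y) \<le> L2 * (\<Sum>j<m. \<bar>x j - y j\<bar>)"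
    using Suc.IH[of "insert m F"] by blast
  define z where "z = (\<lambda>_::nat. 0::real)"
  define K where "K = L1 * m + d (cube_map p m F z) (cube_map p m (insert m F) z) + L2 * m"
  have z: "?C z" by (simp add: z_def)
  have inM: "cube_map p m F' x \<in> M" if "?C x" for F' x
    using cube_map_in[of p x] p that by blast
  have K: "d (cube_map p m F y) (cube_map p m (insert m F) y) \<le> K" if y: "?C y" for y
  proof -
    have s: "(\<Sum>j<m. \<bar>y j - z j\<bar>) \<le> m" "(\<Sum>j<m. \<bar>z j - y j\<bar>) \<le> m"
      using sum_bounded_above[of "{..<m}" "\<lambda>j. \<bar>y j - z j\<bar>" 1] sum_bounded_above[of "{..<m}" "\<lambda>j. \<bar>z j - y j\<bar>" 1] y
      by (auto simp: z_def)
    have "d (cube_map p m F y) (cube_map p m F z) \<le> L1 * m"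
      using L1(2)[OF y z] mult_left_mono[OF s(1) L1(1)] by linarith
    moreover have "d (cube_map p m (insert m F) z) (cube_map p m (insert m F) y) \<le> L2 * m"
      using L2(2)[OF z y] mult_left_mono[OF s(2) L2(1)] by linarith
    ultimately show ?thesis
      unfolding K_def
      using triangle[of "cube_map p m F y" "cube_map p m F z" "cube_map p m (insert m F) y"]
        triangle[of "cube_map p m F z" "cube_map p m (insert m F) z" "cube_map p m (insert m F) y"] inM y z
      by (auto simp: algebra_simps)
  qed
  have K0: "K \<ge> 0" using order_trans[OF nonneg K[OF z]] .
  show ?case
  proof (intro exI[of _ "L1 + L2 + K"] conjI allI impI)
    fix x y assume x: "?C x" and y: "?C y"
    define s where "s = (\<Sum>j<m. \<bar>x j - y j\<bar>)"
    have s: "s \<ge> 0" unfolding s_def by (simp add: sum_nonneg)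
    have "d (cube_map p (Suc m) F x) (cube_map p (Suc m) F y) \<le> L1 * s + L2 * s + \<bar>x m - y m\<bar> * K"
      using geod_lipschitz[of "cube_map p m F x" "cube_map p m (insert m F) x" "cube_map p m F y" "cube_map p m (insert m F) y" "x m" "y m"]
        L1(2)[OF x y] L2(2)[OF x y] mult_left_mono[OF K[OF y], of "\<bar>x m - y m\<bar>"] inM x y
      unfolding s_def[symmetric] by simp
    also have "\<dots> \<le> (L1 + L2 + K) * (s + \<bar>x m - y m\<bar>)"
      using L1(1) L2(1) K0 s by (simp add: algebra_simps)
    finally show "d (cube_map p (Suc m) F x) (cube_map p (Suc m) F y) \<le> (L1 + L2 + K) * (\<Sum>j<Suc m. \<bar>x j - y j\<bar>)"
      by (simp add: s_def)
  qed (use L1 L2 K0 in auto)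
qed

text \<open>If all the pairs were disjoint, the cube spanned by the points \<open>p F\<close> would be essential,
  which Poincare-Miranda makes impossible in covering dimension \<open>k\<close>.\<close>

lemma opposite_faces_meet:
  assumes dim: "covering_dim_le mtopology k"
    and A: "\<And>i. i \<le> k \<Longrightarrow> convex_subset (A i) \<and> closedin mtopology (A i)"
    and B: "\<And>i. i \<le> k \<Longrightarrow> convex_subset (B i) \<and> closedin mtopology (B i)"
    and pA: "\<And>i F. i \<le> k \<Longrightarrow> i \<notin> F \<Longrightarrow> p F \<in> A i"
    and pB: "\<And>i F. i \<le> k \<Longrightarrow> i \<in> F \<Longrightarrow> p F \<in> B i"
  shows "\<exists>i\<le>k. A i \<inter> B i \<noteq> {}"
proof (rule ccontr)
  assume "\<not> ?thesis"
  then have disj: "A i \<inter> B i = {}" if "i \<le> k" for i using that by blast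
  have AM: "A i \<subseteq> M" if "i \<le> k" for i using A[OF that] by (simp add: convex_subset_def)
  have pM: "p F \<in> M" for F
    using pA[of 0 F] pB[of 0 F] A[of 0] B[of 0] by (auto simp: convex_subset_def)
  \<comment> \<open>The common refinement of the covers by the complements of \<open>A i\<close> and
    of \<open>B i\<close>: points of \<open>U F\<close> avoid \<open>B i\<close> for
    \<open>i \<in> F\<close> and \<open>A i\<close> otherwise, so no member of a refinement meets
    both sets of a pair.\<close>
  define U where "U = (\<lambda>F. M - (\<Union>i\<in>{..k}. if i \<in> F then B i else A i))"
  have Uopen: "openin mtopology (U F)" for F
  proof -
    have "closedin mtopology (\<Union>i\<in>{..k}. if i \<in> F then B i else A i)"
      using A B by (intro closedin_Union) auto
    then show ?thesis unfolding U_def using openin_diff[OF openin_topspace] by fastforce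
  qed
  have Ucover: "\<Union>(U ` Pow {..k}) = topspace mtopology"
  proof -
    have mem: "y \<in> U {i\<in>{..k}. y \<notin> B i}" if "y \<in> M" for y
      using that disj unfolding U_def by auto
    have sub: "U F \<subseteq> M" for F unfolding U_def by (rule Diff_subset)
    show ?thesis
      unfolding topspace_mtopology
    proof (intro equalityI UN_least sub subsetI)
      fix y assume "y \<in> M"
      show "y \<in> \<Union>(U ` Pow {..k})"
        using mem[OF \<open>y \<in> M\<close>] by (rule UN_I[of "{i\<in>{..k}. y \<notin> B i}" "Pow {..k}" y U, rotated]) blast
    qed
  qed
  have pre: "finite (U ` Pow {..k}) \<and> (\<forall>W\<in>U ` Pow {..k}. openin mtopology W) \<and> \<Union>(U ` Pow {..k}) = topspace mtopology"
    by (intro conjI Ucover ballI finite_imageI) (use Uopen in auto)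
  obtain \<V> where "finite \<V> \<and> (\<forall>V\<in>\<V>. openin mtopology V) \<and> \<Union>\<V> = topspace mtopology \<and>
             (\<forall>V\<in>\<V>. \<exists>W\<in>U ` Pow {..k}. V \<subseteq> W) \<and>
             (\<forall>x\<in>topspace mtopology. card {V \<in> \<V>. x \<in> V} \<le> k + 1)"
    using mp[OF spec[OF dim[unfolded covering_dim_le_def]] pre] by (elim exE)
  then have V: "finite \<V>" "\<And>V. V \<in> \<V> \<Longrightarrow> openin mtopology V" "\<Union>\<V> = M"
    "\<And>V. V \<in> \<V> \<Longrightarrow> \<exists>W\<in>U ` Pow {..k}. V \<subseteq> W" "\<And>x. x \<in> M \<Longrightarrow> card {V \<in> \<V>. x \<in> V} \<le> k + 1"
    by simp_all
  have VAB: "V \<inter> A i = {} \<or> V \<inter> B i = {}" if VV: "V \<in> \<V>" and ik: "i \<le> k" for V i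
  proof -
    obtain F where F: "V \<subseteq> U F" using V(4)[OF VV] by blast
    show ?thesis
    proof (cases "i \<in> F")
      case True
      then have "V \<inter> B i = {}" using F ik unfolding U_def by fastforce
      then show ?thesis ..
    next
      case False
      then have "V \<inter> A i = {}" using F ik unfolding U_def by fastforce
      then show ?thesis ..
    qed
  qed
  \<comment> \<open>Colour a member of the refinement by the first \<open>A i\<close> that it meets,
    and by \<open>Suc k\<close> if it meets none. There are k + 2 colours.\<close>
  define idx where "idx = (\<lambda>V. LEAST i. k < i \<or> V \<inter> A i \<noteq> {})"
  have idx_prop: "k < idx V \<or> V \<inter> A (idx V) \<noteq> {}" for V
    unfolding idx_def by (rule LeastI[of _ "Suc k"]) simp
  have idx_least: "V \<inter> A i = {}" if "i < idx V" for V i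
    using not_less_Least[OF that[unfolded idx_def]] by simp
  have idx_le: "idx V \<le> Suc k" for V
    unfolding idx_def by (rule Least_le) simp
  define D where "D = (\<lambda>i. \<Union>{V \<in> \<V>. idx V = i})"
  have Dopen: "openin mtopology (D i)" for i
    unfolding D_def using V(2) by blast
  have "\<exists>\<mu>. \<forall>y\<in>M. 0 \<le> \<mu> y \<and> (0 < \<mu> y \<longleftrightarrow> y \<in> D i) \<and> (\<forall>z\<in>M. \<bar>\<mu> y - \<mu> z\<bar> \<le> d y z)" for i
    using open_indicator_lipschitz[OF Dopen] .
  then obtain \<mu> :: "nat \<Rightarrow> 'a \<Rightarrow> real" where \<mu>: "\<And>i y. y \<in> M \<Longrightarrow> 0 \<le> \<mu> i y" "\<And>i y. y \<in> M \<Longrightarrow> 0 < \<mu> i y \<longleftrightarrow> y \<in> D i"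
    "\<And>i y z. y \<in> M \<Longrightarrow> z \<in> M \<Longrightarrow> \<bar>\<mu> i y - \<mu> i z\<bar> \<le> d y z"
    by metis
  have \<mu>0: "\<mu> i y = 0" if "y \<in> M" "y \<notin> D i" for i y
    using \<mu>(1,2)[OF that(1), of i] that(2) by linarith
  define c where "c = cube_map p (Suc k) {}"
  \<comment> \<open>Triangular in the colours: on the face in \<open>A i\<close> all colours above
    \<open>i\<close> vanish, on the face in \<open>B i\<close> the colour \<open>i\<close> vanishes,
    which gives the signs for Poincare-Miranda. At a common zero each \<mu> of colour
    \<open>i \<le> k\<close> is the sum of the later ones.\<close>
  define F where "F = (\<lambda>i x. \<mu> i (c x) - (\<Sum>j\<in>{i<..Suc k}. \<mu> j (c x)))"
  let ?C = "{x :: nat \<Rightarrow> real. \<forall>j. x j \<in> {0..1}}"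
  have cM: "c x \<in> M" if "x \<in> ?C" for x
    unfolding c_def using cube_map_in[of p x] pM that by blast
  obtain L where L: "L \<ge> 0" "\<And>x y. x \<in> ?C \<Longrightarrow> y \<in> ?C \<Longrightarrow> d (c x) (c y) \<le> L * (\<Sum>j<Suc k. \<bar>x j - y j\<bar>)"
    using cube_map_lipschitz[of p "Suc k" "{}"] pM unfolding c_def by blast
  have "\<exists>x\<in>?C. \<forall>i<Suc k. F i x = 0"
  proof (rule poincare_miranda)
    fix i assume "i < Suc k"
    have \<mu>c: "continuous_on ?C (\<lambda>x. \<mu> j (c x))" for j
      using order_trans[OF \<mu>(3) L(2)] cM by (intro continuous_on_l1_lipschitz) blast
    then show "continuous_on ?C (F i)"
      unfolding F_def by (intro continuous_intros)
  next
    fix i x assume i: "i < Suc k" and x: "x \<in> ?C" and "x i = 0"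
    then have "c x \<in> A i"
      unfolding c_def using A pA pM by (intro cube_map_face0) auto
    then have "c x \<notin> D j" if "i < j" for j
      using idx_least that unfolding D_def by blast
    then have "(\<Sum>j\<in>{i<..Suc k}. \<mu> j (c x)) = 0"
      using \<mu>0[OF cM[OF x]] by (intro sum.neutral) auto
    then show "0 \<le> F i x" unfolding F_def using \<mu>(1)[OF cM[OF x]] by simp
  next
    fix i x assume i: "i < Suc k" and x: "x \<in> ?C" and "x i = 1"
    then have cB: "c x \<in> B i"
      unfolding c_def using B pB pM by (intro cube_map_face1) auto
    have "c x \<notin> D i"
    proof
      assume "c x \<in> D i"
      then obtain V where "V \<in> \<V>" "idx V = i" "c x \<in> V" unfolding D_def by blast
      then show False using VAB[of V i] idx_prop[of V] i cB by auto
    qed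
    then show "F i x \<le> 0"
      unfolding F_def using \<mu>0[OF cM[OF x]] \<mu>(1)[OF cM[OF x]] by (simp add: sum_nonneg)
  qed
  then obtain x where x: "x \<in> ?C" "\<And>i. i \<le> k \<Longrightarrow> F i x = 0" by (auto simp: less_Suc_eq_le)
  define y where "y = c x"
  have y: "y \<in> M" using cM[OF x(1)] by (simp add: y_def)
  have eq: "\<mu> i y = (\<Sum>j\<in>{i<..Suc k}. \<mu> j y)" if "i \<le> k" for i
    using x(2)[OF that] by (simp add: F_def y_def)
  \<comment> \<open>Otherwise the relations \<open>eq\<close>, solved downwards from
    \<open>Suc k\<close>, make the \<mu> of every colour vanish, although \<open>y\<close> is
    covered.\<close>
  have top: "\<mu> (Suc k) y > 0"
  proof (rule ccontr)
    assume "\<not> \<mu> (Suc k) y > 0"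
    then have last: "\<mu> (Suc k) y = 0" using \<mu>(1)[OF y, of "Suc k"] by linarith
    have zero: "\<mu> (Suc k - l) y = 0" if "l \<le> Suc k" for l
      using that
    proof (induction l rule: less_induct)
      case (less l)
      show ?case
      proof (cases "l = 0")
        case False
        have "(\<Sum>j\<in>{Suc k - l<..Suc k}. \<mu> j y) = 0"
        proof (rule sum.neutral, rule ballI)
          fix j assume "j \<in> {Suc k - l<..Suc k}"
          then have "Suc k - j < l" "Suc k - (Suc k - j) = j" by auto
          then show "\<mu> j y = 0" using less.IH[of "Suc k - j"] by auto
        qed
        then show ?thesis using eq[of "Suc k - l"] False by auto
      qed (use last in auto)
    qed
    obtain V where "V \<in> \<V>" "y \<in> V" using V(3) y by blast
    then have "y \<in> D (idx V)" unfolding D_def by blast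
    then have "\<mu> (idx V) y > 0" using \<mu>(2)[OF y] by blast
    moreover have "\<mu> (idx V) y = 0"
      using zero[of "Suc k - idx V"] idx_le[of V] by simp
    ultimately show False by simp
  qed
  have "\<mu> i y > 0" if "i \<le> Suc k" for i
  proof (cases "i = Suc k")
    case False
    then have i: "i \<le> k" using that by simp
    have "\<mu> (Suc k) y \<le> (\<Sum>j\<in>{i<..Suc k}. \<mu> j y)"
      using i \<mu>(1)[OF y] by (intro member_le_sum) auto
    then show ?thesis using eq[OF i] top by simp
  qed (use top in simp)
  then have "\<exists>V\<in>\<V>. idx V = i \<and> y \<in> V" if "i \<in> {..Suc k}" for i
    using \<mu>(2)[OF y, of i] that unfolding D_def by auto
  then obtain W where W: "\<And>i. i \<in> {..Suc k} \<Longrightarrow> W i \<in> \<V> \<and> idx (W i) = i \<and> y \<in> W i"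
    by metis
  \<comment> \<open>Members of k + 2 different colours contain \<open>y\<close>, one more than the
    order of the refinement allows.\<close>
  have "inj_on W {..Suc k}" by (rule inj_on_inverseI[of _ idx]) (use W in blast)
  then have "card {..Suc k} \<le> card {V \<in> \<V>. y \<in> V}"
    using W V(1) by (intro card_inj_on_le) auto
  then show False using V(5)[OF y] by simp
qed

end

section \<open>Fixed points of commuting isometries\<close>

context CAT0
begin

definition fixset :: "('a \<Rightarrow> 'a) set \<Rightarrow> 'a set" where
  "fixset S = {x \<in> M. \<forall>h\<in>S. h x = x}"

lemma fixset_Un: "fixset (S \<union> T) = fixset S \<inter> fixset T"
  unfolding fixset_def by auto

lemma fixset_Inter: "fixset S = M \<inter> (\<Inter>h\<in>S. {x \<in> M. h x = x})"
  unfolding fixset_def by auto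

lemma closedin_fixset:
  assumes "\<And>h. h \<in> S \<Longrightarrow> isometry_of M d h"
  shows "closedin mtopology (fixset S)"
proof (cases "S = {}")
  case True
  then show ?thesis using closedin_topspace[of mtopology] by (simp add: fixset_def)
next
  case False
  have "closedin mtopology (M \<inter> (\<Inter>h\<in>S. {x \<in> M. h x = x}))"
    using closedin_topspace[of mtopology] assms False
    by (intro closedin_Int closedin_INT closedin_fixed_points) auto
  then show ?thesis by (simp add: fixset_Inter)
qed

lemma convex_fixset:
  assumes "\<And>h. h \<in> S \<Longrightarrow> isometry_of M d h"
  shows "convex_subset (fixset S)"
proof -
  have "h (geod x y t) = geod x y t" if "h \<in> S" "x \<in> fixset S" "y \<in> fixset S" "t \<in> {0..1}" for h x y t
  proof -
    have "h x = x" "h y = y" "x \<in> M" "y \<in> M"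
      using that unfolding fixset_def by blast+
    then show ?thesis using isometry_gd[OF assms[OF that(1)], of x y t] that(4) by simp
  qed
  then show ?thesis unfolding convex_subset_def by (auto simp: fixset_def)
qed

text \<open>The point of \<open>Y\<close> nearest to a common fixed point \<open>p\<close>, obtained
  as the circumcentre of {p} in \<open>Y\<close>, is kept by every isometry that fixes
  \<open>p\<close> and maps \<open>Y\<close> into itself.\<close>

lemma fixed_point_in_invariant_subset:
  assumes "mcomplete" "convex_subset Y" "closedin mtopology Y" "Y \<noteq> {}"
    and S: "\<And>h. h \<in> S \<Longrightarrow> isometry_of M d h" "\<And>h. h \<in> S \<Longrightarrow> h ` Y \<subseteq> Y" and "fixset S \<noteq> {}"
  shows "Y \<inter> fixset S \<noteq> {}"
proof -
  obtain p where p: "p \<in> M" "\<And>h. h \<in> S \<Longrightarrow> h p = p"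
    using assms(7) unfolding fixset_def by blast
  obtain c where c: "c \<in> Y" "\<And>h. isometry_of M d h \<Longrightarrow> h ` {p} = {p} \<Longrightarrow> h ` Y \<subseteq> Y \<Longrightarrow> h c = c"
    using circumcenter_exists[OF assms(1-4), of "{p}" p 0] p by auto
  have "c \<in> M" using c(1) assms(2) by (auto simp: convex_subset_def)
  then have "c \<in> fixset S" unfolding fixset_def using c(2) S p(2) by simp
  then show ?thesis using c(1) by blast
qed

text \<open>The isometries in \<open>L n\<close> commute with all earlier ones and therefore
  preserve their common fixed point set, to which \<open>fixed_point_in_invariant_subset\<close>
  applies. Within one \<open>L i\<close> no commutation is assumed.\<close>

lemma commuting_fixset_nonempty:
  fixes L :: "nat \<Rightarrow> ('a \<Rightarrow> 'a) set"
  assumes "mcomplete" and iso: "\<And>i h. i < n \<Longrightarrow> h \<in> L i \<Longrightarrow> isometry_of M d h"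
    and "\<And>i. i < n \<Longrightarrow> fixset (L i) \<noteq> {}"
    and comm: "\<And>i j f g x. i < n \<Longrightarrow> j < n \<Longrightarrow> i \<noteq> j \<Longrightarrow> f \<in> L i \<Longrightarrow> g \<in> L j \<Longrightarrow> x \<in> M \<Longrightarrow> f (g x) = g (f x)"
  shows "fixset (\<Union>i<n. L i) \<noteq> {}"
  using assms(2-4)
proof (induction n)
  case 0
  then show ?case using cat0 by (simp add: fixset_def CAT0_space_def)
next
  case (Suc n)
  let ?Y = "fixset (\<Union>i<n. L i)"
  have "?Y \<noteq> {}"
  proof (rule Suc.IH)
    fix i j f g x assume "i < n" "j < n" "i \<noteq> j" "f \<in> L i" "g \<in> L j" "x \<in> M"
    then show "f (g x) = g (f x)" using Suc.prems(3)[of i j f g x] by simp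
  next
    fix i h assume "i < n" "h \<in> L i"
    then show "isometry_of M d h" using Suc.prems(1)[of i h] by simp
  qed (use Suc.prems(2) in simp)
  have iso': "h \<in> (\<Union>i<n. L i) \<Longrightarrow> isometry_of M d h" for h
    using Suc.prems(1)[of _ h] less_SucI by blast
  have "?Y \<inter> fixset (L n) \<noteq> {}"
  proof (rule fixed_point_in_invariant_subset[OF \<open>mcomplete\<close> convex_fixset[OF iso'] closedin_fixset[OF iso'] \<open>?Y \<noteq> {}\<close>])
    fix g assume g: "g \<in> L n"
    then show isog: "isometry_of M d g" using Suc.prems(1) by blast
    show "g ` ?Y \<subseteq> ?Y"
    proof
      fix y assume "y \<in> g ` ?Y"
      then obtain x where x: "x \<in> M" "\<And>h. h \<in> (\<Union>i<n. L i) \<Longrightarrow> h x = x" "y = g x"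
        unfolding fixset_def by blast
      have "h (g x) = g x" if h: "i < n" "h \<in> L i" for h i
      proof -
        have "h (g x) = g (h x)" using Suc.prems(3)[of i n h g x] h g x(1) by auto
        moreover have "h x = x" using x(2)[of h] h by blast
        ultimately show ?thesis by simp
      qed
      moreover have "g x \<in> M" using isog x(1) by (auto simp: isometry_of_def bij_betw_def)
      ultimately show "y \<in> ?Y" unfolding fixset_def x(3) by auto
    qed
  qed (use Suc.prems(2) in auto)
  then show ?case by (simp add: lessThan_Suc fixset_Un Int_commute)
qed

text \<open>The analogue, for fixed point sets, of the join of commuting actions raising dimension:
  \<open>k + 1\<close> disjoint commuting pairs of fixed point sets would span an essential \<open>(k + 1)\<close>-cube.\<close>

lemma commuting_pairs_meet:
  fixes A B :: "nat \<Rightarrow> ('a \<Rightarrow> 'a) set"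
  assumes "mcomplete" "covering_dim_le mtopology k"
    and isoA: "\<And>i h. i \<le> k \<Longrightarrow> h \<in> A i \<Longrightarrow> isometry_of M d h"
    and isoB: "\<And>i h. i \<le> k \<Longrightarrow> h \<in> B i \<Longrightarrow> isometry_of M d h"
    and ne: "\<And>i. i \<le> k \<Longrightarrow> fixset (A i) \<noteq> {} \<and> fixset (B i) \<noteq> {}"
    and comm: "\<And>i j f g x. i \<le> k \<Longrightarrow> j \<le> k \<Longrightarrow> i \<noteq> j \<Longrightarrow> f \<in> A i \<union> B i \<Longrightarrow> g \<in> A j \<union> B j \<Longrightarrow> x \<in> M \<Longrightarrow> f (g x) = g (f x)"
  shows "\<exists>i\<le>k. fixset (A i \<union> B i) \<noteq> {}"
proof -
  \<comment> \<open>\<open>L F\<close> is the choice that belongs to the vertex \<open>F\<close> of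
    the cube; a common fixed point of the chosen sets becomes the vertex \<open>p F\<close>.\<close>
  define L where "L = (\<lambda>F i. if i \<in> F then B i else A i)"
  have "fixset (\<Union>i<Suc k. L F i) \<noteq> {}" for F
  proof (rule commuting_fixset_nonempty[OF \<open>mcomplete\<close>])
    fix i j f g x assume "i < Suc k" "j < Suc k" "i \<noteq> j" "f \<in> L F i" "g \<in> L F j" "x \<in> M"
    then show "f (g x) = g (f x)"
      using comm[of i j f g x] unfolding L_def by (auto split: if_splits)
  next
    fix i h assume "i < Suc k" "h \<in> L F i"
    then show "isometry_of M d h"
      using isoA[of i h] isoB[of i h] unfolding L_def by (simp split: if_splits)
  qed (use ne in \<open>simp add: L_def\<close>)
  then have "\<exists>y. y \<in> fixset (\<Union>i<Suc k. L F i)" for F by blast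
  then obtain p where p: "\<And>F. p F \<in> fixset (\<Union>i<Suc k. L F i)" by metis
  have pL: "p F \<in> fixset (L F i)" if "i \<le> k" for F i
    using p[of F] that unfolding fixset_def by auto
  have "\<exists>i\<le>k. fixset (A i) \<inter> fixset (B i) \<noteq> {}"
  proof (rule opposite_faces_meet[OF assms(2)])
    fix i F assume "i \<le> k" "i \<notin> F"
    then show "p F \<in> fixset (A i)" using pL[of i F] by (simp add: L_def)
  next
    fix i F assume "i \<le> k" "i \<in> F"
    then show "p F \<in> fixset (B i)" using pL[of i F] by (simp add: L_def)
  qed (use convex_fixset closedin_fixset isoA isoB in blast)+
  then show ?thesis by (simp add: fixset_Un)
qed

end

section \<open>Bricks and words\<close>

locale adic_bricks =
  fixes n q :: nat
  assumes q2: "2 \<le> q" and n1: "1 \<le> n"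
begin

text \<open>A word \<open>l\<close> of \<open>q\<close>-adic digits encodes the standard interval with left end point $0.l$;
  a brick is encoded by one word per coordinate, and words are empty in the coordinates beyond \<open>n\<close>.\<close>

definition digits :: "nat list \<Rightarrow> bool" where
  "digits l \<longleftrightarrow> set l \<subseteq> {..<q}"

text \<open>The increasing affine bijection from [0, 1) onto the standard interval of
  \<open>l\<close>: it writes the digits \<open>l\<close> in front of the expansion of
  \<open>y\<close>.\<close>

definition digit_map :: "nat list \<Rightarrow> real \<Rightarrow> real" where
  "digit_map l y = foldr (\<lambda>c y. (real c + y) / real q) l y"

lemma digit_map_Nil [simp]: "digit_map [] y = y"
  and digit_map_Cons: "digit_map (c # l) y = (real c + digit_map l y) / real q"
  and digit_map_append: "digit_map (l @ l') y = digit_map l (digit_map l' y)"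
  by (simp_all add: digit_map_def)

lemma q_pos: "real q > 0" using q2 by simp

lemma digit_map_in: "digits l \<Longrightarrow> y \<in> {0..<1} \<Longrightarrow> digit_map l y \<in> {0..<1}"
proof (induction l)
  case (Cons c l)
  then have "real c + 1 \<le> real q" "digit_map l y \<in> {0..<1}" by (auto simp: digits_def)
  then show ?case using q_pos by (auto simp: digit_map_Cons)
qed simp

lemma digit_map_affine: "\<exists>a::nat. \<forall>y. digit_map l y = (real a + y) / real q ^ length l"
proof (induction l)
  case Nil
  show ?case by (intro exI[of _ 0]) simp
next
  case (Cons c l)
  then obtain a where "\<And>y. digit_map l y = (real a + y) / real q ^ length l" by blast
  then show ?case using q_pos
    by (intro exI[of _ "c * q ^ length l + a"]) (simp add: digit_map_Cons field_simps)
qed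

lemma digit_map_digit_unique:
  assumes "(real c + y) / real q = (real c' + y') / real q" "y \<in> {0..<1}" "y' \<in> {0..<1}"
  shows "c = c'" "y = y'"
proof -
  have eq: "real c + y = real c' + y'" using assms(1) q_pos by simp
  show "c = c'"
  proof (rule ccontr)
    assume "c \<noteq> c'"
    then have "real c + 1 \<le> real c' \<or> real c' + 1 \<le> real c" by linarith
    then show False using eq assms(2,3) by auto
  qed
  then show "y = y'" using eq by simp
qed

text \<open>Standard intervals are nested or disjoint: a common point determines the leading digit
  of both words, which is stripped in the induction.\<close>

lemma digit_map_eq_imp_comparable:
  assumes "digit_map l y = digit_map l' y'" "digits l" "digits l'" "y \<in> {0..<1}" "y' \<in> {0..<1}"
  shows "\<not> parallel l l'"
  using assms
proof (induction l arbitrary: l')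
  case (Cons c l)
  show ?case
  proof (cases l')
    case (Cons c' k)
    have d: "digits l" "digits k" using Cons.prems Cons by (auto simp: digits_def)
    have "c = c'" "digit_map l y = digit_map k y'"
      using Cons.prems digit_map_digit_unique[of c "digit_map l y" c' "digit_map k y'"] digit_map_in[OF d(1)] digit_map_in[OF d(2)]
      unfolding Cons digit_map_Cons by auto
    then show ?thesis using Cons.IH[of k] d Cons.prems unfolding Cons by (auto simp: parallel_def)
  qed auto
qed auto

lemma digit_map_inj:
  assumes "digit_map l y = digit_map l y'"
  shows "y = y'"
proof -
  obtain a where "\<And>y. digit_map l y = (real a + y) / real q ^ length l" using digit_map_affine by blast
  then show ?thesis using assms q_pos by simp
qed

lemma digit_map_cover:
  assumes "x \<in> {0..<1}"
  shows "\<exists>l y. digits l \<and> length l = m \<and> y \<in> {0..<1} \<and> x = digit_map l y"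
  using assms
proof (induction m arbitrary: x)
  case 0
  then show ?case by (intro exI[of _ "[]"] exI[of _ x]) (auto simp: digits_def)
next
  case (Suc m)
  define c where "c = nat \<lfloor>real q * x\<rfloor>"
  have "real q * x \<ge> 0" "real q * x < real q" using Suc.prems q_pos by auto
  then have c: "real c = of_int \<lfloor>real q * x\<rfloor>" "c < q" unfolding c_def by linarith+
  have "real q * x - real c \<in> {0..<1}" unfolding c by auto linarith
  then obtain l y where l: "digits l" "length l = m" "y \<in> {0..<1}" "real q * x - real c = digit_map l y"
    using Suc.IH by blast
  have "x = digit_map (c # l) y"
    using l(4)[symmetric] q_pos by (simp add: digit_map_Cons)
  then show ?case using l c by (intro exI[of _ "c # l"] exI[of _ y]) (auto simp: digits_def)
qed

lemma digit_map_image: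
  assumes "\<And>y. digit_map l y = (real a + y) / real q ^ length l"
  shows "digit_map l ` {0..<1} = {real a / real q ^ length l ..< (real a + 1) / real q ^ length l}"
proof
  show "digit_map l ` {0..<1} \<subseteq> {real a / real q ^ length l ..< (real a + 1) / real q ^ length l}"
    using q_pos by (auto simp: assms divide_right_mono divide_strict_right_mono)
  show "{real a / real q ^ length l ..< (real a + 1) / real q ^ length l} \<subseteq> digit_map l ` {0..<1}"
  proof
    fix x assume x: "x \<in> {real a / real q ^ length l ..< (real a + 1) / real q ^ length l}"
    have "x = digit_map l (x * real q ^ length l - real a)" using q_pos by (simp add: assms)
    moreover have "x * real q ^ length l - real a \<in> {0..<1}"
      using x q_pos by (auto simp: field_simps)
    ultimately show "x \<in> digit_map l ` {0..<1}" by blast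
  qed
qed

lemma standard_interval_iff:
  "standard_interval q I \<longleftrightarrow> (\<exists>l. digits l \<and> I = digit_map l ` {0..<1})"
proof
  assume "standard_interval q I"
  then obtain a :: int and b where I: "I = {of_int a / real q ^ b ..< of_int (a + 1) / real q ^ b}" "I \<subseteq> {0..<1}"
    unfolding standard_interval_def by blast
  have "of_int a / real q ^ b \<in> I" unfolding I using q_pos by (simp add: divide_strict_right_mono)
  then have "of_int a / real q ^ b \<in> {0..<1::real}" using I(2) by blast
  then obtain l y where l: "digits l" "length l = b" "y \<in> {0..<1}" "of_int a / real q ^ b = digit_map l y"
    using digit_map_cover by blast
  obtain a' where a': "\<And>y. digit_map l y = (real a' + y) / real q ^ length l" using digit_map_affine by blast
  have "of_int a = real a' + y" using l(4) q_pos unfolding a' l(2) by simp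
  \<comment> \<open>\<open>y\<close> is a difference of two integers and lies in [0, 1), so it is
    0.\<close>
  then have "a = int a'" using l(3) by auto
  then show "\<exists>l. digits l \<and> I = digit_map l ` {0..<1}"
    using l digit_map_image[OF a'] by (intro exI[of _ l]) (simp add: I(1))
next
  assume "\<exists>l. digits l \<and> I = digit_map l ` {0..<1}"
  then obtain l where l: "digits l" "I = digit_map l ` {0..<1}" by blast
  obtain a where a: "\<And>y. digit_map l y = (real a + y) / real q ^ length l" using digit_map_affine by blast
  show "standard_interval q I"
    unfolding standard_interval_def
  proof (intro exI[of _ "int a"] exI[of _ "length l"] conjI)
    show "I \<subseteq> {0..<1}" unfolding l(2) using digit_map_in[OF l(1)] by blast
  qed (use l digit_map_image[OF a] in simp)
qed

section \<open>Bricks and words in \<open>n\<close> coordinates\<close>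

abbreviation X :: "(nat \<Rightarrow> real) set" where "X \<equiv> unit_cube n"

definition word :: "(nat \<Rightarrow> nat list) \<Rightarrow> bool" where
  "word w \<longleftrightarrow> (\<forall>j<n. digits (w j)) \<and> (\<forall>j\<ge>n. w j = [])"

definition wcat :: "(nat \<Rightarrow> nat list) \<Rightarrow> (nat \<Rightarrow> nat list) \<Rightarrow> nat \<Rightarrow> nat list" (infixr "\<cdot>" 70) where
  "w \<cdot> u = (\<lambda>j. w j @ u j)"

text \<open>The canonical map of the cube onto the brick \<open>w\<close>; by \<open>T_wcat\<close>,
  passing to a sub-brick is concatenation of words.\<close>

definition T :: "(nat \<Rightarrow> nat list) \<Rightarrow> (nat \<Rightarrow> real) \<Rightarrow> nat \<Rightarrow> real" where
  "T w x = (\<lambda>j\<in>{..<n}. digit_map (w j) (x j))"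

definition words :: "(nat \<Rightarrow> nat) \<Rightarrow> (nat \<Rightarrow> nat list) set" where
  "words e = {w. word w \<and> (\<forall>j<n. length (w j) = e j)}"

text \<open>Disjointness of bricks, read off from words. Unlike intervals, bricks that are not apart
  need not be nested, because the coordinates may be nested in opposite directions.\<close>

definition apart :: "(nat \<Rightarrow> nat list) \<Rightarrow> (nat \<Rightarrow> nat list) \<Rightarrow> bool" where
  "apart w v \<longleftrightarrow> (\<exists>j<n. parallel (w j) (v j))"

lemma wcat_assoc: "(w \<cdot> u) \<cdot> v = w \<cdot> u \<cdot> v"
  by (simp add: wcat_def)

lemma word_wcat [simp]: "word (w \<cdot> u) \<longleftrightarrow> word w \<and> word u"
  by (auto simp: word_def wcat_def digits_def)

lemma wcat_left_cancel [simp]: "w \<cdot> u = w \<cdot> v \<longleftrightarrow> u = v"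
  by (auto simp: wcat_def fun_eq_iff)

lemma wcat_empty [simp]: "w \<cdot> (\<lambda>_. []) = w"
  by (simp add: wcat_def)

lemma word_empty [simp]: "word (\<lambda>_. [])"
  by (simp add: word_def digits_def)

lemma mem_X: "x \<in> X \<longleftrightarrow> x \<in> extensional {..<n} \<and> (\<forall>j<n. x j \<in> {0..<1})"
  by (auto simp: unit_cube_def PiE_iff)

lemma X_ne: "(\<lambda>j\<in>{..<n}. 0) \<in> X"
  by (simp add: mem_X)

lemma T_in: "word w \<Longrightarrow> x \<in> X \<Longrightarrow> T w x \<in> X"
  using digit_map_in by (simp add: mem_X T_def word_def)

lemma T_wcat: "T (w \<cdot> u) x = T w (T u x)"
  by (auto simp: T_def wcat_def digit_map_append)

lemma T_inj:
  assumes "x \<in> X" "y \<in> X" "T w x = T w y"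
  shows "x = y"
proof (rule extensionalityI[of _ "{..<n}"])
  fix j assume "j \<in> {..<n}"
  then have "digit_map (w j) (x j) = digit_map (w j) (y j)"
    using fun_cong[OF assms(3), of j] by (simp add: T_def)
  then show "x j = y j" by (rule digit_map_inj)
qed (use assms in \<open>auto simp: mem_X\<close>)

lemma T_cover:
  assumes x: "x \<in> X"
  shows "\<exists>u\<in>words e. \<exists>y\<in>X. x = T u y"
proof -
  have "\<forall>j. \<exists>l y. j < n \<longrightarrow> digits l \<and> length l = e j \<and> y \<in> {0..<1} \<and> x j = digit_map l y"
    using x digit_map_cover unfolding mem_X by blast
  then obtain l y where ly: "\<And>j. j < n \<Longrightarrow> digits (l j) \<and> length (l j) = e j \<and> y j \<in> {0..<1} \<and> x j = digit_map (l j) (y j)"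
    by metis
  define u where "u = (\<lambda>j. if j < n then l j else [])"
  define z where "z = (\<lambda>j\<in>{..<n}. y j)"
  have "u \<in> words e" using ly by (auto simp: words_def word_def u_def)
  moreover have "z \<in> X" using ly by (auto simp: mem_X z_def)
  moreover have "x = T u z"
    using x ly by (auto simp: T_def u_def z_def mem_X fun_eq_iff extensional_def)
  ultimately show ?thesis by blast
qed

lemma T_disj:
  assumes "apart w v" "word w" "word v" "x \<in> X" "y \<in> X"
  shows "T w x \<noteq> T v y"
proof
  assume eq: "T w x = T v y"
  obtain j where j: "j < n" "parallel (w j) (v j)" using assms(1) apart_def by blast
  have "digit_map (w j) (x j) = digit_map (v j) (y j)" using fun_cong[OF eq, of j] j by (simp add: T_def)
  then show False using digit_map_eq_imp_comparable j assms by (auto simp: word_def mem_X)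
qed

text \<open>In each coordinate the two words are comparable, and the length condition excludes that
  \<open>v\<close> is the coarser one anywhere.\<close>

lemma not_disj_extend:
  assumes "\<not> apart w v" "word w" "word v" "\<And>j. j < n \<Longrightarrow> length (w j) \<le> length (v j)"
  shows "\<exists>u. word u \<and> v = w \<cdot> u"
proof -
  have "\<exists>s. v j = w j @ s" for j
  proof (cases "j < n")
    case True
    then have "prefix (w j) (v j) \<or> prefix (v j) (w j)"
      using assms(1) by (auto simp: apart_def)
    then show ?thesis
    proof
      assume "prefix (v j) (w j)"
      then have "v j = w j" using assms(4)[OF True] by (metis not_equal_is_parallel prefix_length_le le_antisym prefix_order.eq_iff parallelE)
      then show ?thesis by simp
    qed (auto simp: prefix_def)
  next
    case False
    then show ?thesis using assms by (auto simp: word_def)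
  qed
  then obtain u where u: "\<And>j. v j = w j @ u j" by metis
  then have "v = w \<cdot> u" by (auto simp: wcat_def)
  then show ?thesis using assms(3) by auto
qed

lemma apart_sym: "apart w v \<longleftrightarrow> apart v w"
  by (auto simp: apart_def)

lemma apart_irrefl: "\<not> apart w w"
  by (auto simp: apart_def)

lemma apart_wcat: "apart w v \<Longrightarrow> apart (w \<cdot> u) (v \<cdot> u')"
  unfolding apart_def wcat_def by (metis parallel_append)

lemma apart_wcat_left: "apart w v \<Longrightarrow> apart (w \<cdot> u) v"
  and apart_wcat_right: "apart w v \<Longrightarrow> apart w (v \<cdot> u)"
  using apart_wcat[of w v u "\<lambda>_. []"] apart_wcat[of w v "\<lambda>_. []" u] by auto

lemma apart_wcat_cancel [simp]: "apart (w \<cdot> u) (w \<cdot> v) \<longleftrightarrow> apart u v"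
  unfolding apart_def wcat_def by (auto simp: parallel_def)

lemma words_disj:
  assumes "w \<in> words e" "v \<in> words e" "w \<noteq> v"
  shows "apart w v"
proof (rule ccontr)
  assume "\<not> apart w v"
  then obtain u where u: "word u" "v = w \<cdot> u"
    using not_disj_extend[of w v] assms by (auto simp: words_def)
  have "u j = []" for j
    using u assms by (cases "j < n") (auto simp: words_def wcat_def word_def)
  then have "u = (\<lambda>_. [])" by auto
  then show False using u assms(3) by simp
qed

lemma words_wd: "w \<in> words e \<Longrightarrow> word w"
  by (simp add: words_def)

lemma finite_words: "finite (words e)"
proof -
  have "inj_on (\<lambda>w. restrict w {..<n}) (words e)"
  proof (rule inj_onI)
    fix w v assume w: "w \<in> words e" and v: "v \<in> words e" and eq: "restrict w {..<n} = restrict v {..<n}"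
    show "w = v"
    proof
      fix j show "w j = v j"
        using fun_cong[OF eq, of j] w v by (cases "j < n") (auto simp: words_def word_def)
    qed
  qed
  moreover have "(\<lambda>w. restrict w {..<n}) ` words e \<subseteq> (\<Pi>\<^sub>E j\<in>{..<n}. {l. set l \<subseteq> {..<q} \<and> length l = e j})"
    by (auto simp: words_def word_def digits_def subset_iff split: if_splits)
  moreover have "finite (\<Pi>\<^sub>E j\<in>{..<n}. {l. set l \<subseteq> {..<q} \<and> length l = e j})"
    by (intro finite_PiE finite_lists_length_eq) auto
  ultimately show ?thesis by (meson finite_imageD finite_subset)
qed

lemma brick_iff: "brick n q B \<longleftrightarrow> (\<exists>w. word w \<and> B = T w ` X)"
proof -
  have PiE_eq: "(\<Pi>\<^sub>E j\<in>{..<n}. digit_map (w j) ` {0..<1}) = T w ` X" for w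
  proof
    show "T w ` X \<subseteq> (\<Pi>\<^sub>E j\<in>{..<n}. digit_map (w j) ` {0..<1})"
      by (auto simp: T_def mem_X split: if_splits)
    show "(\<Pi>\<^sub>E j\<in>{..<n}. digit_map (w j) ` {0..<1}) \<subseteq> T w ` X"
    proof
      fix x assume x: "x \<in> (\<Pi>\<^sub>E j\<in>{..<n}. digit_map (w j) ` {0..<1})"
      have "\<exists>y. j < n \<longrightarrow> y \<in> {0..<1} \<and> x j = digit_map (w j) y" for j
      proof (cases "j < n")
        case True
        then have "x j \<in> digit_map (w j) ` {0..<1}" using PiE_mem[OF x] by blast
        then show ?thesis by (rule imageE) blast
      qed blast
      then obtain y where y: "\<And>j. j < n \<Longrightarrow> y j \<in> {0..<1} \<and> x j = digit_map (w j) (y j)" by metis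
      have "restrict y {..<n} \<in> X" using y by (auto simp: mem_X)
      moreover have "x = T w (restrict y {..<n})"
        unfolding T_def
      proof (rule extensionalityI[of _ "{..<n}"])
        show "x \<in> extensional {..<n}" using x by (simp add: PiE_iff)
      qed (use y in auto)
      ultimately show "x \<in> T w ` X" by blast
    qed
  qed
  show ?thesis
  proof
    assume "brick n q B"
    then obtain I where I: "\<And>j. j < n \<Longrightarrow> standard_interval q (I j)" "B = (\<Pi>\<^sub>E j\<in>{..<n}. I j)"
      unfolding brick_def by blast
    then have "\<forall>j. \<exists>l. j < n \<longrightarrow> digits l \<and> I j = digit_map l ` {0..<1}"
      using standard_interval_iff by blast
    then obtain l where l: "\<And>j. j < n \<Longrightarrow> digits (l j) \<and> I j = digit_map (l j) ` {0..<1}" by metis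
    define w where "w = (\<lambda>j. if j < n then l j else [])"
    have "B = (\<Pi>\<^sub>E j\<in>{..<n}. digit_map (w j) ` {0..<1})"
      unfolding I(2) using l by (intro PiE_cong) (auto simp: w_def)
    moreover have "word w" using l by (auto simp: word_def w_def)
    ultimately show "\<exists>w. word w \<and> B = T w ` X" using PiE_eq by blast
  next
    assume "\<exists>w. word w \<and> B = T w ` X"
    then obtain w where "word w" "B = T w ` X" by blast
    then show "brick n q B"
      unfolding brick_def PiE_eq[of w, symmetric] using standard_interval_iff
      by (intro exI[of _ "\<lambda>j. digit_map (w j) ` {0..<1}"]) (auto simp: word_def)
  qed
qed

end

section \<open>Elements of the group as maps of words\<close>

context adic_bricks
begin

text \<open>\<open>f\<close> restricts to the canonical map between two bricks. Products, supports
  and membership in the group are computed with this relation on words; \<open>maps f w w\<close>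
  says that \<open>f\<close> fixes the brick \<open>w\<close> pointwise.\<close>

definition maps :: "((nat \<Rightarrow> real) \<Rightarrow> nat \<Rightarrow> real) \<Rightarrow> (nat \<Rightarrow> nat list) \<Rightarrow> (nat \<Rightarrow> nat list) \<Rightarrow> bool" where
  "maps f w v \<longleftrightarrow> (\<forall>x\<in>X. f (T w x) = T v x)"

lemma mapsD: "maps f w v \<Longrightarrow> x \<in> X \<Longrightarrow> f (T w x) = T v x"
  by (simp add: maps_def)

lemma maps_wcat: "maps f w v \<Longrightarrow> word u \<Longrightarrow> maps f (w \<cdot> u) (v \<cdot> u)"
  unfolding maps_def T_wcat using T_in by blast

lemma maps_image: "maps f w v \<Longrightarrow> f ` (T w ` X) = T v ` X"
  unfolding maps_def by (force simp: image_image)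

abbreviation G :: "((nat \<Rightarrow> real) \<Rightarrow> nat \<Rightarrow> real) set" where "G \<equiv> BHT_elements n q"

lemma T_affine: "\<exists>a b. (\<forall>j. 0 < b j) \<and> (\<forall>x. \<forall>j<n. T w x j = b j * (a j + x j))"
proof -
  have "\<forall>j. \<exists>a::nat. \<forall>y. digit_map (w j) y = (real a + y) / real q ^ length (w j)" using digit_map_affine by blast
  then obtain a where "\<And>j y. digit_map (w j) y = (real (a j) + y) / real q ^ length (w j)" by metis
  then show ?thesis using q_pos
    by (intro exI[of _ "\<lambda>j. real (a j)"] exI[of _ "\<lambda>j. 1 / real q ^ length (w j)"]) (simp add: T_def)
qed

lemma affine_images_eq:
  fixes \<alpha> \<beta> \<gamma> \<delta> :: real
  assumes "\<alpha> > 0" "\<gamma> > 0"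
    and "\<And>y. y \<in> {0..<1} \<Longrightarrow> \<exists>z\<in>{0..<1}. \<alpha> * y + \<beta> = \<gamma> * z + \<delta>"
    and "\<And>z. z \<in> {0..<1} \<Longrightarrow> \<exists>y\<in>{0..<1}. \<alpha> * y + \<beta> = \<gamma> * z + \<delta>"
  shows "\<alpha> = \<gamma>" "\<beta> = \<delta>"
proof -
  have im: "(\<lambda>y. a * y + b) ` {0..<1} = {b..<a + b}" if "a > 0" for a b :: real
  proof
    show "{b..<a + b} \<subseteq> (\<lambda>y. a * y + b) ` {0..<1}"
    proof
      fix x assume "x \<in> {b..<a + b}"
      then have "(x - b) / a \<in> {0..<1}" "x = a * ((x - b) / a) + b" using that by (auto simp: field_simps)
      then show "x \<in> (\<lambda>y. a * y + b) ` {0..<1}" by blast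
    qed
  qed (use that in auto)
  have "(\<lambda>y. \<alpha> * y + \<beta>) ` {0..<1} = (\<lambda>y. \<gamma> * y + \<delta>) ` {0..<1}"
    using assms(3,4) by (auto simp: image_iff) metis+
  then have "{\<beta>..<\<alpha> + \<beta>} = {\<delta>..<\<gamma> + \<delta>}" using im assms by simp
  then show "\<beta> = \<delta>" "\<alpha> = \<gamma>"
    using assms(1,2) by (auto simp: Ico_eq_Ico)
qed

text \<open>An increasing affine bijection between two half-open intervals is determined by their
  end points. The diagonal points \<open>pt y\<close> let coordinate \<open>j\<close> run through
  [0, 1), so the other coordinates do not interfere.\<close>

lemma affine_on_brick_imp_maps:
  assumes f: "f \<in> Bij X" and w: "word w" and v: "word v" and im: "f ` (T w ` X) = T v ` X"
    and aff: "coordinatewise_increasing_affine_on n (T w ` X) f"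
  shows "maps f w v"
  unfolding maps_def
proof
  fix x assume x: "x \<in> X"
  obtain s t where st: "\<And>j. j < n \<Longrightarrow> 0 < s j" "\<And>x j. x \<in> X \<Longrightarrow> j < n \<Longrightarrow> f (T w x) j = s j * T w x j + t j"
    using aff unfolding coordinatewise_increasing_affine_on_def by blast
  obtain a b where ab: "\<And>j. 0 < b j" "\<And>x j. j < n \<Longrightarrow> T w x j = b j * (a j + x j)"
    using T_affine[of w] by blast
  obtain a' b' where ab': "\<And>j. 0 < b' j" "\<And>x j. j < n \<Longrightarrow> T v x j = b' j * (a' j + x j)"
    using T_affine[of v] by blast
  show "f (T w x) = T v x"
  proof (rule extensionalityI[of _ "{..<n}"])
    have "f (T w x) \<in> X" using f T_in[OF w x] by (auto simp: Bij_def bij_betw_def)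
    then show "f (T w x) \<in> extensional {..<n}" by (simp add: mem_X)
    show "T v x \<in> extensional {..<n}" by (simp add: T_def)
    fix j assume "j \<in> {..<n}"
    then have j: "j < n" by simp
    define pt where "pt = (\<lambda>y::real. \<lambda>i\<in>{..<n}. y)"
    have pt: "pt y \<in> X" "pt y j = y" if "y \<in> {0..<1}" for y
      using that j by (auto simp: pt_def mem_X)
    have fj: "f (T w x) j = (s j * b j) * x j + (s j * b j * a j + t j)" if "x \<in> X" for x
      using st(2)[OF that j] ab(2)[OF j] by (simp add: algebra_simps)
    have vj: "T v x j = b' j * x j + b' j * a' j" for x
      using ab'(2)[OF j] by (simp add: algebra_simps)
    have "s j * b j = b' j \<and> s j * b j * a j + t j = b' j * a' j"
    proof (intro conjI affine_images_eq[of "s j * b j" "b' j"])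
      show 1: "\<exists>z\<in>{0..<1}. (s j * b j) * y + (s j * b j * a j + t j) = b' j * z + b' j * a' j" if "y \<in> {0..<1}" for y
      proof -
        have "f (T w (pt y)) \<in> T v ` X" using im pt that by blast
        then obtain z where "z \<in> X" "f (T w (pt y)) = T v z" by blast
        then show ?thesis using fj[of "pt y"] vj[of z] pt[OF that] j
          by (intro bexI[of _ "z j"]) (auto simp: mem_X)
      qed
      show 2: "\<exists>y\<in>{0..<1}. (s j * b j) * y + (s j * b j * a j + t j) = b' j * z + b' j * a' j" if "z \<in> {0..<1}" for z
      proof -
        have "T v (pt z) \<in> f ` (T w ` X)" using im pt that by blast
        then obtain y where "y \<in> X" "f (T w y) = T v (pt z)" by force
        then show ?thesis using fj[of y] vj[of "pt z"] pt[OF that] j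
          by (intro bexI[of _ "y j"]) (auto simp: mem_X)
      qed
      show "0 < s j * b j" "0 < b' j" using st(1)[OF j] ab(1) ab'(1) by auto
      then show "0 < s j * b j" "0 < b' j" .
      show "\<exists>z\<in>{0..<1}. (s j * b j) * y + (s j * b j * a j + t j) = b' j * z + b' j * a' j" if "y \<in> {0..<1}" for y
        using 1[OF that] .
      show "\<exists>y\<in>{0..<1}. (s j * b j) * y + (s j * b j * a j + t j) = b' j * z + b' j * a' j" if "z \<in> {0..<1}" for z
        using 2[OF that] .
    qed
    then have c: "s j * b j = b' j" "s j * b j * a j + t j = b' j * a' j" by blast+
    show "f (T w x) j = T v x j" unfolding fj[OF x] vj c(2) by (simp only: c(1))
  qed
qed

lemma G_Bij: "f \<in> G \<Longrightarrow> f \<in> Bij X"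
  by (simp add: BHT_elements_def)

text \<open>A brick of a regular grid that is finer than all words of the division lies inside a
  single piece; its corner tells which one. The images are bricks, but possibly of varying
  shapes.\<close>

lemma G_maps:
  assumes "f \<in> G"
  shows "\<exists>m. \<forall>w\<in>words (\<lambda>_. m). \<exists>v. word v \<and> maps f w v"
proof -
  obtain P Q \<sigma> where P: "cube_division n q P" and Q: "cube_division n q Q" and \<sigma>: "bij_betw \<sigma> P Q"
    and f: "f \<in> Bij X" "\<And>B. B \<in> P \<Longrightarrow> f ` B = \<sigma> B \<and> coordinatewise_increasing_affine_on n B f"
    using assms unfolding BHT_elements_def mem_Collect_eq by (elim conjE exE) blast
  have "\<forall>B. \<exists>w. B \<in> P \<longrightarrow> word w \<and> B = T w ` X"
    using P brick_iff unfolding cube_division_def by blast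
  then obtain w where w: "\<And>B. B \<in> P \<Longrightarrow> word (w B) \<and> B = T (w B) ` X" by metis
  have fin: "finite P" and part: "\<Union>P = X"
    using P by (auto simp: cube_division_def partition_on_def)
  define m where "m = (\<Sum>B\<in>P. \<Sum>j<n. length (w B j))"
  have m: "length (w B j) \<le> m" if "B \<in> P" "j < n" for B j
  proof -
    have "length (w B j) \<le> (\<Sum>j<n. length (w B j))" using that by (intro member_le_sum) auto
    also have "\<dots> \<le> m" unfolding m_def using that fin by (intro member_le_sum) auto
    finally show ?thesis .
  qed
  show ?thesis
  proof (intro exI[of _ m] ballI)
    fix z assume z: "z \<in> words (\<lambda>_. m)"
    have "T z (\<lambda>j\<in>{..<n}. 0) \<in> X" using T_in[OF words_wd[OF z] X_ne] .
    then obtain B where B: "B \<in> P" "T z (\<lambda>j\<in>{..<n}. 0) \<in> B" using part by blast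
    then obtain y where y: "y \<in> X" "T z (\<lambda>j\<in>{..<n}. 0) = T (w B) y" using w by blast
    then have "\<not> apart (w B) z" using T_disj[of "w B" z y "\<lambda>j\<in>{..<n}. 0"] w[OF B(1)] words_wd[OF z] X_ne by metis
    then obtain u where u: "word u" "z = w B \<cdot> u"
      using not_disj_extend[of "w B" z] w[OF B(1)] words_wd[OF z] m[OF B(1)] z by (auto simp: words_def)
    have "\<sigma> B \<in> Q" using \<sigma> B(1) by (auto simp: bij_betw_def)
    then obtain v where v: "word v" "\<sigma> B = T v ` X" using Q brick_iff unfolding cube_division_def by blast
    have "maps f (w B) v"
      using affine_on_brick_imp_maps[OF f(1) _ v(1), of "w B"] w[OF B(1)] f(2)[OF B(1)] v(2) by auto
    then show "\<exists>v. word v \<and> maps f z v" using u v(1) maps_wcat[of f "w B" v u] by (intro exI[of _ "v \<cdot> u"]) simp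
  qed
qed

lemma maps_imp_affine:
  assumes "maps f w v"
  shows "coordinatewise_increasing_affine_on n (T w ` X) f"
proof -
  obtain a b where ab: "\<And>j. 0 < b j" "\<And>x j. j < n \<Longrightarrow> T w x j = b j * (a j + x j)"
    using T_affine[of w] by blast
  obtain a' b' where ab': "\<And>j. 0 < b' j" "\<And>x j. j < n \<Longrightarrow> T v x j = b' j * (a' j + x j)"
    using T_affine[of v] by blast
  show ?thesis
    unfolding coordinatewise_increasing_affine_on_def
  proof (rule exI[of _ "\<lambda>j. b' j / b j"], rule exI[of _ "\<lambda>j. b' j * (a' j - a j)"], intro conjI allI impI ballI)
    fix y j assume "y \<in> T w ` X" and j: "j < n"
    then obtain x where x: "x \<in> X" "y = T w x" by blast
    show "f y j = b' j / b j * y j + b' j * (a' j - a j)"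
      using mapsD[OF assms x(1)] ab(1)[of j] ab(2)[OF j] ab'(2)[OF j] x(2) by (simp add: algebra_simps)
  qed (use ab(1) ab'(1) in simp)
qed

text \<open>Converse to \<open>G_maps\<close>; from here on the group is handled through words only.
  The grid and its image under \<open>f\<close> serve as the two divisions.\<close>

lemma G_I:
  assumes f: "f \<in> Bij X" and m: "\<And>w. w \<in> words (\<lambda>_. m) \<Longrightarrow> \<exists>v. word v \<and> maps f w v"
  shows "f \<in> G"
proof -
  let ?P = "(\<lambda>w. T w ` X) ` words (\<lambda>_. m)"
  have inj: "inj_on f X" and fX: "f ` X = X" using f by (auto simp: Bij_def bij_betw_def)
  have TX: "T w ` X \<subseteq> X" if "w \<in> words (\<lambda>_. m)" for w using T_in words_wd[OF that] by blast
  have union: "\<Union>?P = X"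
  proof
    show "X \<subseteq> \<Union>?P" using T_cover[of _ "\<lambda>_. m"] by blast
  qed (use TX in blast)
  have Pdisj: "T w ` X \<inter> T v ` X = {}" if "w \<in> words (\<lambda>_. m)" "v \<in> words (\<lambda>_. m)" "w \<noteq> v" for w v
    using T_disj[OF words_disj[OF that]] words_wd that by blast
  have ne: "T w ` X \<noteq> {}" for w using X_ne by blast
  have PX: "B \<subseteq> X" if "B \<in> ?P" for B using that TX by blast
  have P: "cube_division n q ?P"
    unfolding cube_division_def
  proof (intro conjI ballI partition_onI)
    show "finite ?P" by (intro finite_imageI finite_words)
    show "brick n q B" if "B \<in> ?P" for B using that brick_iff words_wd by blast
    show "\<Union>?P = X" by (rule union)
    show "{} \<notin> ?P" using ne by blast
    show "disjnt p p'" if "p \<in> ?P" "p' \<in> ?P" "p \<noteq> p'" for p p'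
      using that Pdisj unfolding disjnt_def by blast
  qed
  have Q: "cube_division n q ((`) f ` ?P)"
    unfolding cube_division_def
  proof (intro conjI ballI partition_onI)
    show "finite ((`) f ` ?P)" by (intro finite_imageI finite_words)
    show "brick n q B" if "B \<in> (`) f ` ?P" for B
    proof -
      obtain w where w: "w \<in> words (\<lambda>_. m)" "B = f ` (T w ` X)" using \<open>B \<in> (`) f ` ?P\<close> by blast
      obtain v where "word v" "maps f w v" using m[OF w(1)] by blast
      then show ?thesis using w(2) maps_image brick_iff by auto
    qed
    show "\<Union>((`) f ` ?P) = X" using union fX by (metis image_Union)
    show "{} \<notin> (`) f ` ?P" using ne by blast
    show "disjnt p p'" if p: "p \<in> (`) f ` ?P" and p': "p' \<in> (`) f ` ?P" and "p \<noteq> p'" for p p'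
    proof -
      obtain B B' where B: "B \<in> ?P" "B' \<in> ?P" "p = f ` B" "p' = f ` B'" using p p' by blast
      then have "B \<noteq> B'" using \<open>p \<noteq> p'\<close> by blast
      then have "B \<inter> B' = {}" using B(1,2) Pdisj by blast
      then have "f ` B \<inter> f ` B' = {}"
        using inj_on_image_Int[OF inj PX[OF B(1)] PX[OF B(2)]] by simp
      then show ?thesis using B by (simp add: disjnt_def)
    qed
  qed
  have "bij_betw ((`) f) ?P ((`) f ` ?P)"
    using PX inj by (intro inj_on_imp_bij_betw inj_onI) (metis inj_on_image_eq_iff)
  moreover have "coordinatewise_increasing_affine_on n B f" if "B \<in> ?P" for B
    using that m maps_imp_affine by blast
  ultimately show ?thesis
    unfolding BHT_elements_def using f P Q by blast
qed

end

section \<open>Swaps and baker's maps\<close>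

context adic_bricks
begin

lemma Bij_in: "f \<in> Bij X \<Longrightarrow> x \<in> X \<Longrightarrow> f x \<in> X"
  by (auto simp: Bij_def bij_betw_def)

lemma Bij_inj: "f \<in> Bij X \<Longrightarrow> x \<in> X \<Longrightarrow> y \<in> X \<Longrightarrow> f x = f y \<Longrightarrow> x = y"
  by (auto simp: Bij_def bij_betw_def inj_on_def)

lemma Bij_eqI:
  assumes "f \<in> Bij X" "g \<in> Bij X" "\<And>x. x \<in> X \<Longrightarrow> f x = g x"
  shows "f = g"
  using assms by (intro extensionalityI[of f X g]) (auto simp: Bij_def)

lemma maps_compose:
  assumes "maps g w v" "maps f v z" "word w"
  shows "maps (compose X f g) w z"
  using assms T_in by (simp add: maps_def compose_eq)

text \<open>If the image bricks met, they would share a sub-brick, given by the longer word in each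
  coordinate. It would be the image of disjoint sub-bricks of \<open>w\<close> and \<open>v\<close>,
  against injectivity.\<close>

lemma maps_disj:
  assumes f: "f \<in> Bij X" and "maps f w w'" "maps f v v'" "word w" "word v" "word w'" "word v'" "apart w v"
  shows "apart w' v'"
proof (rule ccontr)
  assume nd: "\<not> apart w' v'"
  define e where "e = (\<lambda>j. max (length (w' j)) (length (v' j)))"
  have "\<exists>s. \<exists>s'. w' j @ s = v' j @ s' \<and> digits s \<and> digits s' \<and> (j \<ge> n \<longrightarrow> s = [] \<and> s' = [])" for j
  proof (cases "j < n")
    case True
    then have "prefix (w' j) (v' j) \<or> prefix (v' j) (w' j)" "digits (w' j)" "digits (v' j)"
      using nd assms by (auto simp: apart_def word_def)
    then show ?thesis
    proof (elim disjE prefixE)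
      fix s assume "v' j = w' j @ s" and "digits (w' j)" "digits (v' j)"
      then show ?thesis using True by (intro exI[of _ s] exI[of _ "[]"]) (auto simp: digits_def)
    next
      fix s assume "w' j = v' j @ s" and "digits (w' j)" "digits (v' j)"
      then show ?thesis using True by (intro exI[of _ "[]"] exI[of _ s]) (auto simp: digits_def)
    qed
  next
    case False
    then show ?thesis using assms by (intro exI[of _ "[]"]) (auto simp: word_def digits_def)
  qed
  then obtain s s' where s: "\<And>j. w' j @ s j = v' j @ s' j \<and> digits (s j) \<and> digits (s' j) \<and> (j \<ge> n \<longrightarrow> s j = [] \<and> s' j = [])"
    by metis
  then have eq: "w' \<cdot> s = v' \<cdot> s'" and "word s" "word s'" by (auto simp: wcat_def word_def)
  define x where "x = (\<lambda>j\<in>{..<n}. 0::real)"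
  have "maps f (w \<cdot> s) (w' \<cdot> s)" "maps f (v \<cdot> s') (w' \<cdot> s)"
    using maps_wcat[OF assms(2) \<open>word s\<close>] maps_wcat[OF assms(3) \<open>word s'\<close>] eq by auto
  then have "f (T (w \<cdot> s) x) = f (T (v \<cdot> s') x)"
    using X_ne unfolding x_def by (simp add: maps_def)
  then have "T (w \<cdot> s) x = T (v \<cdot> s') x"
    using Bij_inj[OF f] T_in X_ne assms \<open>word s\<close> \<open>word s'\<close> unfolding x_def by simp
  then show False
    using T_disj[OF apart_wcat[OF \<open>apart w v\<close>]] X_ne assms \<open>word s\<close> \<open>word s'\<close> unfolding x_def by simp
qed

lemma word_cut:
  assumes "word w" "\<And>j. j < n \<Longrightarrow> k \<le> length (w j)"
  shows "\<exists>u u'. u \<in> words (\<lambda>_. k) \<and> word u' \<and> w = u \<cdot> u'"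
proof (intro exI conjI)
  show "(\<lambda>j. take k (w j)) \<in> words (\<lambda>_. k)" "word (\<lambda>j. drop k (w j))"
    using assms by (auto simp: words_def word_def digits_def subset_iff dest: in_set_takeD in_set_dropD)
  show "w = (\<lambda>j. take k (w j)) \<cdot> (\<lambda>j. drop k (w j))" by (simp add: wcat_def)
qed

text \<open>With \<open>m\<close> further digits in the domain, every image brick of
  \<open>g\<close> has at least \<open>m\<close> digits per coordinate and so lies in a grid brick
  on which \<open>f\<close> is canonical.\<close>

lemma compose_G:
  assumes f: "f \<in> G" and g: "g \<in> G"
  shows "compose X f g \<in> G"
proof -
  obtain m where m: "\<And>w. w \<in> words (\<lambda>_. m) \<Longrightarrow> \<exists>v. word v \<and> maps f w v" using G_maps[OF f] by blast
  obtain l where l: "\<And>w. w \<in> words (\<lambda>_. l) \<Longrightarrow> \<exists>v. word v \<and> maps g w v" using G_maps[OF g] by blast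
  show ?thesis
  proof (rule G_I)
    show "compose X f g \<in> Bij X" using f g G_Bij compose_Bij by blast
    fix w assume w: "w \<in> words (\<lambda>_. l + m)"
    then obtain u u' where u: "u \<in> words (\<lambda>_. l)" "word u'" "w = u \<cdot> u'" using word_cut[of w l] w by (auto simp: words_def)
    have len: "length (u' j) = m" if "j < n" for j using u w that by (auto simp: words_def wcat_def)
    obtain v where v: "word v" "maps g u v" using l[OF u(1)] by blast
    have "word (v \<cdot> u')" using u v by simp
    moreover have "m \<le> length ((v \<cdot> u') j)" if "j < n" for j using len[OF that] by (simp add: wcat_def)
    ultimately obtain z z' where z: "z \<in> words (\<lambda>_. m)" "word z'" "v \<cdot> u' = z \<cdot> z'"
      using word_cut[of "v \<cdot> u'" m] by blast
    obtain t where t: "word t" "maps f z t" using m[OF z(1)] by blast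
    have "maps g w (z \<cdot> z')" using maps_wcat[OF v(2) u(2)] u z by simp
    moreover have "maps f (z \<cdot> z') (t \<cdot> z')" using maps_wcat[OF t(2) z(2)] .
    ultimately have "maps (compose X f g) w (t \<cdot> z')" using maps_compose words_wd[OF w] by blast
    then show "\<exists>v. word v \<and> maps (compose X f g) w v" using t z by (intro exI[of _ "t \<cdot> z'"]) simp
  qed
qed

lemma id_G: "(\<lambda>x\<in>X. x) \<in> G"
proof (rule G_I)
  fix w assume "w \<in> words (\<lambda>_. 0)"
  then show "\<exists>v. word v \<and> maps (\<lambda>x\<in>X. x) w v"
    using T_in words_wd by (intro exI[of _ w]) (auto simp: maps_def)
qed (rule id_Bij)

lemma maps_idI: "(\<And>x. x \<in> X \<Longrightarrow> f (T w x) = T w x) \<Longrightarrow> maps f w w"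
  by (simp add: maps_def)

text \<open>The common source of swaps, baker's maps and movers: the two families must have the same
  union, outside of which the element is the identity. In a grid finer than all \<open>a i\<close>,
  every brick lies inside one \<open>a i\<close> or avoids them all.\<close>

lemma glue:
  assumes fin: "finite I" and wda: "\<And>i. i \<in> I \<Longrightarrow> word (a i)" and wdb: "\<And>i. i \<in> I \<Longrightarrow> word (b i)"
    and da: "\<And>i j. i \<in> I \<Longrightarrow> j \<in> I \<Longrightarrow> i \<noteq> j \<Longrightarrow> apart (a i) (a j)"
    and db: "\<And>i j. i \<in> I \<Longrightarrow> j \<in> I \<Longrightarrow> i \<noteq> j \<Longrightarrow> apart (b i) (b j)"
    and un: "(\<Union>i\<in>I. T (a i) ` X) = (\<Union>i\<in>I. T (b i) ` X)"
  shows "\<exists>f\<in>G. (\<forall>i\<in>I. maps f (a i) (b i)) \<and> (\<forall>x\<in>X. x \<notin> (\<Union>i\<in>I. T (a i) ` X) \<longrightarrow> f x = x)"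
proof -
  define S where "S = (\<Union>i\<in>I. T (a i) ` X)"
  define f where "f = (\<lambda>x\<in>X. if x \<in> S then (THE z. \<exists>i\<in>I. \<exists>y\<in>X. x = T (a i) y \<and> z = T (b i) y) else x)"
  have fT: "f (T (a i) y) = T (b i) y" if i: "i \<in> I" and y: "y \<in> X" for i y
  proof -
    have "(THE z. \<exists>i'\<in>I. \<exists>y'\<in>X. T (a i) y = T (a i') y' \<and> z = T (b i') y') = T (b i) y"
    proof (rule the_equality)
      fix z assume "\<exists>i'\<in>I. \<exists>y'\<in>X. T (a i) y = T (a i') y' \<and> z = T (b i') y'"
      then obtain i' y' where i': "i' \<in> I" "y' \<in> X" "T (a i) y = T (a i') y'" "z = T (b i') y'" by blast
      have "i = i'" using T_disj[of "a i" "a i'" y y'] da[OF i i'(1)] wda i i' y by blast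
      then show "z = T (b i) y" using T_inj[OF y i'(2)] i' by blast
    qed (use i y in blast)
    moreover have "T (a i) y \<in> S" unfolding S_def using i y by blast
    ultimately show ?thesis using T_in[OF wda[OF i] y] by (simp add: f_def)
  qed
  have foff: "f x = x" if "x \<in> X" "x \<notin> S" for x using that by (simp add: f_def)
  have S_cases: "\<exists>i\<in>I. \<exists>y\<in>X. x = T (a i) y" if "x \<in> S" for x using that unfolding S_def by blast
  have S_b: "T (b i) y \<in> S" if "i \<in> I" "y \<in> X" for i y unfolding S_def un using that by blast
  have SX: "x \<in> X" if "x \<in> S" for x using S_cases[OF that] T_in wda by blast
  have fS: "f x \<in> S" if "x \<in> S" for x
    using S_cases[OF that] fT S_b by auto
  have "inj_on f X"
  proof (rule inj_onI)
    fix x x' assume x: "x \<in> X" "x' \<in> X" and eq: "f x = f x'"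
    show "x = x'"
    proof (cases "x \<in> S")
      case True
      then have "x' \<in> S" using fS[OF True] eq foff[OF x(2)] by metis
      then obtain i y i' y' where *: "i \<in> I" "y \<in> X" "x = T (a i) y" "i' \<in> I" "y' \<in> X" "x' = T (a i') y'"
        using S_cases True by meson
      then have e: "T (b i) y = T (b i') y'" using eq fT by auto
      then have "i = i'" using T_disj[of "b i" "b i'" y y'] db[OF *(1,4)] wdb * by blast
      then show ?thesis using T_inj[OF *(2,5)] e * by blast
    next
      case False
      then have "x' \<notin> S" using fS[of x'] eq foff[OF x(1)] by metis
      then show ?thesis using foff x False eq by metis
    qed
  qed
  moreover have "f ` X = X"
  proof
    show "f ` X \<subseteq> X" using fS SX foff by (metis image_subsetI)
    show "X \<subseteq> f ` X"
    proof
      fix x assume x: "x \<in> X"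
      show "x \<in> f ` X"
      proof (cases "x \<in> S")
        case True
        then obtain i y where "i \<in> I" "y \<in> X" "x = T (b i) y" unfolding S_def un by blast
        then have "x = f (T (a i) y)" "T (a i) y \<in> X" using fT T_in wda by auto
        then show ?thesis by (rule image_eqI)
      qed (metis foff x imageI)
    qed
  qed
  ultimately have Bij: "f \<in> Bij X" by (simp add: Bij_def bij_betw_def f_def)
  have mp: "maps f (a i) (b i)" if "i \<in> I" for i using fT that by (simp add: maps_def)
  define m where "m = (\<Sum>i\<in>I. \<Sum>j<n. length (a i j))"
  have m: "length (a i j) \<le> m" if "i \<in> I" "j < n" for i j
  proof -
    have "length (a i j) \<le> (\<Sum>j<n. length (a i j))" using that by (intro member_le_sum) auto
    also have "\<dots> \<le> m" unfolding m_def using that fin by (intro member_le_sum) auto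
    finally show ?thesis .
  qed
  have "f \<in> G"
  proof (rule G_I[OF Bij])
    fix z assume z: "z \<in> words (\<lambda>_. m)"
    show "\<exists>v. word v \<and> maps f z v"
    proof (cases "\<exists>i\<in>I. \<not> apart (a i) z")
      case True
      then obtain i where i: "i \<in> I" "\<not> apart (a i) z" by blast
      then obtain u where "word u" "z = a i \<cdot> u"
        using not_disj_extend[of "a i" z] wda[OF i(1)] words_wd[OF z] m[OF i(1)] z by (auto simp: words_def)
      then show ?thesis using maps_wcat[OF mp[OF i(1)]] wdb[OF i(1)] by (intro exI[of _ "b i \<cdot> u"]) simp
    next
      case False
      have "T z x \<notin> S" if "x \<in> X" for x
        using S_cases[of "T z x"] T_disj[of "a _" z _ x] False wda words_wd[OF z] that by metis
      then have "maps f z z" using foff T_in[OF words_wd[OF z]] by (simp add: maps_def)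
      then show ?thesis using words_wd[OF z] by blast
    qed
  qed
  then show ?thesis using mp foff unfolding S_def by blast
qed

text \<open>For apart words the listed properties determine the element, so the choice is
  harmless.\<close>

definition swap :: "(nat \<Rightarrow> nat list) \<Rightarrow> (nat \<Rightarrow> nat list) \<Rightarrow> (nat \<Rightarrow> real) \<Rightarrow> nat \<Rightarrow> real" where
  "swap w v = (SOME f. f \<in> G \<and> maps f w v \<and> maps f v w \<and> (\<forall>x\<in>X. x \<notin> T w ` X \<union> T v ` X \<longrightarrow> f x = x))"

lemma swap:
  assumes "word w" "word v" "apart w v"
  shows swap_G: "swap w v \<in> G" and swap_maps1: "maps (swap w v) w v" and swap_maps2: "maps (swap w v) v w"
    and swap_off: "\<And>x. x \<in> X \<Longrightarrow> x \<notin> T w ` X \<Longrightarrow> x \<notin> T v ` X \<Longrightarrow> swap w v x = x"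
proof -
  have "\<exists>f\<in>G. (\<forall>i\<in>UNIV. maps f (if i then w else v) (if i then v else w)) \<and>
      (\<forall>x\<in>X. x \<notin> (\<Union>i\<in>UNIV. T (if i then w else v) ` X) \<longrightarrow> f x = x)"
    using assms apart_sym by (intro glue) (auto simp: UNIV_bool)
  then have "\<exists>f. f \<in> G \<and> maps f w v \<and> maps f v w \<and> (\<forall>x\<in>X. x \<notin> T w ` X \<union> T v ` X \<longrightarrow> f x = x)"
    by (auto simp: UNIV_bool)
  from someI_ex[OF this, folded swap_def]
  show "swap w v \<in> G" "maps (swap w v) w v" "maps (swap w v) v w"
    "\<And>x. x \<in> X \<Longrightarrow> x \<notin> T w ` X \<Longrightarrow> x \<notin> T v ` X \<Longrightarrow> swap w v x = x"
    by blast+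
qed

lemma swap_maps_disj:
  assumes "word w" "word v" "apart w v" "word z" "apart z w" "apart z v"
  shows "maps (swap w v) z z"
proof (rule maps_idI)
  fix x assume "x \<in> X"
  then show "swap w v (T z x) = T z x"
    using swap_off[OF assms(1-3)] T_disj assms T_in by blast
qed

lemma swap_cases:
  assumes "x \<in> X"
  obtains y where "y \<in> X" "x = T w y" | y where "y \<in> X" "x = T v y" | "x \<notin> T w ` X" "x \<notin> T v ` X"
  using assms by blast

lemma swap_swap:
  assumes "word w" "word v" "apart w v" "x \<in> X"
  shows "swap w v (swap w v x) = x"
  using assms(4)
proof (cases rule: swap_cases[where w = w and v = v])
  case (1 y)
  then show ?thesis using mapsD[OF swap_maps1[OF assms(1-3)]] mapsD[OF swap_maps2[OF assms(1-3)]] by simp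
next
  case (2 y)
  then show ?thesis using mapsD[OF swap_maps1[OF assms(1-3)]] mapsD[OF swap_maps2[OF assms(1-3)]] by simp
next
  case 3
  then show ?thesis using swap_off[OF assms(1-3)] assms(4) by simp
qed

lemma swap_commute:
  assumes "word w" "word v" "apart w v"
  shows "swap w v = swap v w"
proof (rule Bij_eqI)
  have d: "apart v w" using assms apart_sym by blast
  show "swap w v \<in> Bij X" "swap v w \<in> Bij X" using swap_G[OF assms] swap_G[OF assms(2,1) d] G_Bij by auto
  fix x assume x: "x \<in> X"
  then show "swap w v x = swap v w x"
  proof (cases rule: swap_cases[where w = w and v = v])
    case (1 y)
    then show ?thesis using mapsD[OF swap_maps1[OF assms]] mapsD[OF swap_maps2[OF assms(2,1) d]] by simp
  next
    case (2 y)
    then show ?thesis using mapsD[OF swap_maps2[OF assms]] mapsD[OF swap_maps1[OF assms(2,1) d]] by simp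
  next
    case 3
    then show ?thesis using swap_off[OF assms] swap_off[OF assms(2,1) d] x by simp
  qed
qed

lemma maps_notin_image:
  assumes f: "f \<in> Bij X" and "maps f w w'" "word w" "x \<in> X" "x \<notin> T w ` X"
  shows "f x \<notin> T w' ` X"
proof
  assume "f x \<in> T w' ` X"
  then obtain y where y: "y \<in> X" "f x = T w' y" by blast
  then have "f x = f (T w y)" using mapsD[OF assms(2)] by simp
  then have "x = T w y" using Bij_inj[OF f] assms T_in y by blast
  then show False using assms(5) y by blast
qed

text \<open>Conjugation by \<open>f\<close> moves the two bricks along. The intertwining form avoids
  naming an inverse of \<open>f\<close>.\<close>

lemma swap_conj:
  assumes f: "f \<in> G" and w: "maps f w w'" "word w" "word w'" and v: "maps f v v'" "word v" "word v'" and d: "apart w v"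
  shows "compose X f (swap w v) = compose X (swap w' v') f"
proof (rule Bij_eqI)
  have d': "apart w' v'" using maps_disj[OF G_Bij[OF f] w(1) v(1)] w v d by blast
  note s = swap[OF w(2) v(2) d] and s' = swap[OF w(3) v(3) d']
  show "compose X f (swap w v) \<in> Bij X" "compose X (swap w' v') f \<in> Bij X"
    using f s(1) s'(1) compose_G G_Bij by blast+
  fix x assume x: "x \<in> X"
  then show "compose X f (swap w v) x = compose X (swap w' v') f x"
  proof (cases rule: swap_cases[where w = w and v = v])
    case (1 y)
    then show ?thesis using x mapsD[OF s(2)] mapsD[OF s'(2)] mapsD[OF w(1)] mapsD[OF v(1)] by (simp add: compose_eq)
  next
    case (2 y)
    then show ?thesis using x mapsD[OF s(3)] mapsD[OF s'(3)] mapsD[OF w(1)] mapsD[OF v(1)] by (simp add: compose_eq)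
  next
    case 3
    then have "f x \<notin> T w' ` X" "f x \<notin> T v' ` X" using maps_notin_image[OF G_Bij[OF f]] w v x by blast+
    then show ?thesis using s(4)[OF x 3] s'(4)[OF Bij_in[OF G_Bij[OF f] x]] x by (simp add: compose_eq)
  qed
qed

section \<open>Leading digits and baker's maps\<close>

definition digit :: "nat \<Rightarrow> nat \<Rightarrow> nat \<Rightarrow> nat list" where
  "digit i c = (\<lambda>j. if j = i then [c] else [])"

lemma word_sg [simp]: "i < n \<Longrightarrow> c < q \<Longrightarrow> word (digit i c)"
  by (auto simp: word_def digit_def digits_def)

lemma digit_U: "i < n \<Longrightarrow> words (\<lambda>j. if j = i then 1 else 0) = digit i ` {..<q}"
proof (intro equalityI subsetI)
  fix w assume i: "i < n" and w: "w \<in> words (\<lambda>j. if j = i then 1 else 0)"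
  then have "length (w i) = 1" "digits (w i)" by (auto simp: words_def word_def)
  then obtain c where c: "w i = [c]" "c < q" by (auto simp: length_Suc_conv digits_def)
  have "w j = digit i c j" for j
    using w c by (cases "j < n") (auto simp: words_def word_def digit_def)
  then show "w \<in> digit i ` {..<q}" using c by auto
qed (auto simp: words_def, auto simp: digit_def)

lemma digit_cover:
  assumes "i < n" "x \<in> X"
  shows "\<exists>c<q. \<exists>y\<in>X. x = T (digit i c) y"
  using T_cover[OF assms(2), of "\<lambda>j. if j = i then 1 else 0"] digit_U[OF assms(1)] by auto

lemma digit_disj: "i < n \<Longrightarrow> c \<noteq> c' \<Longrightarrow> apart (digit i c) (digit i c')"
  unfolding apart_def by (intro exI[of _ i]) (auto simp: digit_def parallel_def)

lemma digit_commute: "i \<noteq> j \<Longrightarrow> digit i c \<cdot> digit j c' = digit j c' \<cdot> digit i c"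
  by (auto simp: wcat_def digit_def)

lemma digit_union:
  assumes "i < n"
  shows "(\<Union>c\<in>{..<q}. T (w \<cdot> digit i c) ` X) = T w ` X"
proof
  show "(\<Union>c\<in>{..<q}. T (w \<cdot> digit i c) ` X) \<subseteq> T w ` X"
    using T_in[OF word_sg[OF assms]] by (auto simp: T_wcat)
  show "T w ` X \<subseteq> (\<Union>c\<in>{..<q}. T (w \<cdot> digit i c) ` X)"
    using digit_cover[OF assms] by (force simp: T_wcat)
qed

text \<open>The baker's map of the brick \<open>w\<close>: it moves the first digit of coordinate \<open>i\<close> to coordinate \<open>j\<close>.\<close>

definition baker :: "(nat \<Rightarrow> nat list) \<Rightarrow> nat \<Rightarrow> nat \<Rightarrow> (nat \<Rightarrow> real) \<Rightarrow> nat \<Rightarrow> real" where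
  "baker w i j = (SOME f. f \<in> G \<and> (\<forall>c<q. maps f (w \<cdot> digit i c) (w \<cdot> digit j c)) \<and> (\<forall>x\<in>X. x \<notin> T w ` X \<longrightarrow> f x = x))"

lemma baker:
  assumes "word w" "i < n" "j < n"
  shows baker_G: "baker w i j \<in> G" and baker_maps: "\<And>c. c < q \<Longrightarrow> maps (baker w i j) (w \<cdot> digit i c) (w \<cdot> digit j c)"
    and baker_off: "\<And>x. x \<in> X \<Longrightarrow> x \<notin> T w ` X \<Longrightarrow> baker w i j x = x"
proof -
  have "\<exists>f\<in>G. (\<forall>c\<in>{..<q}. maps f (w \<cdot> digit i c) (w \<cdot> digit j c)) \<and>
      (\<forall>x\<in>X. x \<notin> (\<Union>c\<in>{..<q}. T (w \<cdot> digit i c) ` X) \<longrightarrow> f x = x)"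
  proof (rule glue)
    show "(\<Union>c\<in>{..<q}. T (w \<cdot> digit i c) ` X) = (\<Union>c\<in>{..<q}. T (w \<cdot> digit j c) ` X)"
      using assms by (simp only: digit_union)
  qed (use assms digit_disj in auto)
  then have "\<exists>f. f \<in> G \<and> (\<forall>c<q. maps f (w \<cdot> digit i c) (w \<cdot> digit j c)) \<and> (\<forall>x\<in>X. x \<notin> T w ` X \<longrightarrow> f x = x)"
    unfolding digit_union[OF assms(2)] by blast
  from someI_ex[OF this, folded baker_def]
  show "baker w i j \<in> G" "\<And>c. c < q \<Longrightarrow> maps (baker w i j) (w \<cdot> digit i c) (w \<cdot> digit j c)"
    "\<And>x. x \<in> X \<Longrightarrow> x \<notin> T w ` X \<Longrightarrow> baker w i j x = x"
    by blast+
qed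

lemma baker_maps_disj:
  assumes "word w" "i < n" "j < n" "word z" "apart z w"
  shows "maps (baker w i j) z z"
proof (rule maps_idI)
  fix x assume "x \<in> X"
  then show "baker w i j (T z x) = T z x"
    using baker_off[OF assms(1-3)] T_disj assms T_in by blast
qed

lemma baker_conj:
  assumes f: "f \<in> G" and w: "maps f w w'" "word w" "word w'" and ij: "i < n" "j < n"
  shows "compose X f (baker w i j) = compose X (baker w' i j) f"
proof (rule Bij_eqI)
  note b = baker[OF w(2) ij] and b' = baker[OF w(3) ij]
  show "compose X f (baker w i j) \<in> Bij X" "compose X (baker w' i j) f \<in> Bij X"
    using f b(1) b'(1) compose_G G_Bij by blast+
  fix x assume x: "x \<in> X"
  show "compose X f (baker w i j) x = compose X (baker w' i j) f x"
  proof (cases "x \<in> T w ` X")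
    case True
    then obtain c y where cy: "c < q" "y \<in> X" "x = T (w \<cdot> digit i c) y"
      using digit_union[OF ij(1), of w] by blast
    show ?thesis
      using x cy mapsD[OF b(2)[OF cy(1)]] mapsD[OF b'(2)[OF cy(1)]]
        mapsD[OF maps_wcat[OF w(1) word_sg[OF ij(1) cy(1)]]] mapsD[OF maps_wcat[OF w(1) word_sg[OF ij(2) cy(1)]]]
      by (simp add: compose_eq)
  next
    case False
    then have "f x \<notin> T w' ` X" using maps_notin_image[OF G_Bij[OF f]] w x by blast
    then show ?thesis using b(3)[OF x False] b'(3)[OF Bij_in[OF G_Bij[OF f] x]] x by (simp add: compose_eq)
  qed
qed

end

section \<open>Hierarchical divisions\<close>

context adic_bricks
begin

text \<open>Left cancellation stands in for inverses: conjugation arguments use it in this form, and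
  stabilisers of points satisfy it directly.\<close>

definition is_subgroup :: "((nat \<Rightarrow> real) \<Rightarrow> nat \<Rightarrow> real) set \<Rightarrow> bool" where
  "is_subgroup K \<longleftrightarrow> K \<subseteq> G \<and> (\<lambda>x\<in>X. x) \<in> K \<and> (\<forall>f\<in>K. \<forall>g\<in>K. compose X f g \<in> K) \<and>
     (\<forall>g\<in>K. \<forall>f\<in>G. compose X g f \<in> K \<longrightarrow> f \<in> K)"

lemma is_subgroupD:
  assumes K: "is_subgroup K"
  shows "f \<in> K \<Longrightarrow> f \<in> G" "(\<lambda>x\<in>X. x) \<in> K" "f \<in> K \<Longrightarrow> g \<in> K \<Longrightarrow> compose X f g \<in> K"
    "g \<in> K \<Longrightarrow> f \<in> G \<Longrightarrow> compose X g f \<in> K \<Longrightarrow> f \<in> K"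
  using K unfolding is_subgroup_def by blast+

lemma is_subgroup_conj:
  assumes K: "is_subgroup K" and "g \<in> K" "h \<in> K" "f \<in> G" "compose X g f = compose X h g"
  shows "f \<in> K"
  using is_subgroupD(4)[OF K \<open>g \<in> K\<close> \<open>f \<in> G\<close>] is_subgroupD(3)[OF K \<open>h \<in> K\<close> \<open>g \<in> K\<close>] assms(5) by simp

lemma not_disj_wcat [simp]: "\<not> apart w (w \<cdot> u)"
  by (auto simp: apart_def wcat_def)

lemma digit_inject [simp]: "digit i c = digit i c' \<longleftrightarrow> c = c'"
proof
  assume "digit i c = digit i c'"
  from fun_cong[OF this, of i] show "c = c'" by (simp add: digit_def)
qed simp

lemma card_words2: "4 \<le> card (words (\<lambda>_. 2))"
proof -
  define f where "f = (\<lambda>(a, b) j. if j = 0 then [a, b] else if j < n then [0, 0] else ([] :: nat list))"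
  have "inj_on f ({..<2} \<times> {..<2})"
  proof (rule inj_onI)
    fix x y assume "f x = f y"
    from fun_cong[OF this, of 0] show "x = y" by (auto simp: f_def split: prod.splits)
  qed
  moreover have "f ` ({..<2} \<times> {..<2}) \<subseteq> words (\<lambda>_. 2)"
    using q2 n1 by (auto simp: f_def words_def word_def digits_def split: if_splits)
  ultimately have "card ({..<2::nat} \<times> {..<2::nat}) \<le> card (words (\<lambda>_. 2))"
    by (rule card_inj_on_le[OF _ _ finite_words])
  then show ?thesis by (simp add: card_cartesian_product)
qed

text \<open>Two digits per coordinate are the least depth that yields four cells also for q = 2 and
  n = 1.\<close>

lemma fourth_cell: "\<exists>r\<in>words (\<lambda>_. 2). r \<noteq> s \<and> r \<noteq> t \<and> r \<noteq> w"
proof (rule ccontr)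
  assume "\<not> ?thesis"
  then have "words (\<lambda>_. 2) \<subseteq> {s, t, w}" by blast
  then have "card (words (\<lambda>_. 2)) \<le> card {s, t, w}" by (intro card_mono) auto
  also have "\<dots> \<le> 3" by (simp add: card_insert_if)
  finally show False using card_words2 by simp
qed

end

locale grid_cell = adic_bricks +
  fixes D :: "nat \<Rightarrow> nat list"
  assumes D: "D \<in> words (\<lambda>_. 2)"
begin

definition cells :: "(nat \<Rightarrow> nat list) set" where
  "cells = words (\<lambda>_. 2) - {D}"

definition off_cell :: "(nat \<Rightarrow> nat list) \<Rightarrow> bool" where
  "off_cell w \<longleftrightarrow> (\<exists>p\<in>cells. \<exists>u. word u \<and> w = p \<cdot> u)"

text \<open>The pointwise fixator of the cell \<open>D\<close>, since the canonical map from
  \<open>D\<close> to itself is the identity.\<close>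

definition off_grp :: "((nat \<Rightarrow> real) \<Rightarrow> nat \<Rightarrow> real) set" where
  "off_grp = {f \<in> G. maps f D D}"

text \<open>Either two whole cells are swapped, or a slab of one cell with another whole cell. The
  second kind allows digits to be stripped one at a time.\<close>

definition swap_gens :: "((nat \<Rightarrow> real) \<Rightarrow> nat \<Rightarrow> real) set" where
  "swap_gens = (\<lambda>(t, s). swap t s) ` {(t, s). t \<in> cells \<and> s \<in> cells \<and> t \<noteq> s} \<union>
     (\<lambda>(t, s, j, c). swap (t \<cdot> digit j c) s) ` {(t, s, j, c). t \<in> cells \<and> s \<in> cells \<and> t \<noteq> s \<and> j < n \<and> c < q}"

definition baker_gens :: "((nat \<Rightarrow> real) \<Rightarrow> nat \<Rightarrow> real) set" where
  "baker_gens = (\<lambda>(s, i, j). baker s i j) ` {(s, i, j). s \<in> cells \<and> i < n \<and> j < n \<and> i \<noteq> j}"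

lemma cells_wd: "p \<in> cells \<Longrightarrow> word p"
  unfolding cells_def using words_wd by blast

lemma cells_disj: "p \<in> cells \<Longrightarrow> s \<in> cells \<Longrightarrow> p \<noteq> s \<Longrightarrow> apart p s"
  unfolding cells_def using words_disj by blast

lemma cells_disj_D: "p \<in> cells \<Longrightarrow> apart D p"
  using words_disj[OF D] by (auto simp: cells_def)

lemma D_wd: "word D"
  using D words_wd by blast

lemma finite_P0: "finite cells"
  by (simp add: cells_def finite_words)

lemma third_cell: "\<exists>r\<in>cells. r \<noteq> s \<and> r \<noteq> t"
  using fourth_cell[of D s t] by (auto simp: cells_def)

lemma finite_swap_gens: "finite swap_gens"
proof -
  have "finite {(t, s). t \<in> cells \<and> s \<in> cells \<and> t \<noteq> s}"
    by (rule finite_subset[of _ "cells \<times> cells"]) (use finite_P0 in auto)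
  moreover have "finite {(t, s, j, c). t \<in> cells \<and> s \<in> cells \<and> t \<noteq> s \<and> j < n \<and> c < q}"
    by (rule finite_subset[of _ "cells \<times> cells \<times> {..<n} \<times> {..<q}"]) (use finite_P0 in auto)
  ultimately show ?thesis unfolding swap_gens_def by blast
qed

lemma finite_baker_gens: "finite baker_gens"
proof -
  have "finite {(s, i, j). s \<in> cells \<and> i < n \<and> j < n \<and> i \<noteq> j}"
    by (rule finite_subset[of _ "cells \<times> {..<n} \<times> {..<n}"]) (use finite_P0 in auto)
  then show ?thesis unfolding baker_gens_def by blast
qed

lemma off_cell_wd: "off_cell w \<Longrightarrow> word w"
  using cells_wd by (auto simp: off_cell_def)

lemma off_cell_disj_D: "off_cell w \<Longrightarrow> apart D w"
  using cells_disj_D apart_wcat_right by (auto simp: off_cell_def)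

lemma off_cell_wcat: "off_cell w \<Longrightarrow> word u \<Longrightarrow> off_cell (w \<cdot> u)"
  unfolding off_cell_def by (metis wcat_assoc word_wcat)

lemma off_cell_P0: "p \<in> cells \<Longrightarrow> off_cell p"
  unfolding off_cell_def by (intro bexI[of _ p] exI[of _ "\<lambda>_. []"]) auto

lemma word_first_digit:
  assumes "word u" "j < n" "u j \<noteq> []"
  shows "\<exists>c<q. \<exists>u'. word u' \<and> u = digit j c \<cdot> u' \<and> (\<Sum>i<n. length (u' i)) < (\<Sum>i<n. length (u i))"
proof -
  obtain c l where cl: "u j = c # l" using assms(3) by (cases "u j") auto
  define u' where "u' = (\<lambda>i. if i = j then l else u i)"
  have "digits (c # l)" using assms(1,2) cl by (metis word_def)
  then have "c < q" "word u'" using assms(1,2) by (auto simp: word_def digits_def u'_def)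
  moreover have "u = digit j c \<cdot> u'" using cl by (auto simp: wcat_def digit_def u'_def)
  moreover have "(\<Sum>i<n. length (u' i)) < (\<Sum>i<n. length (u i))"
    using assms(2) cl by (intro sum_strict_mono_ex1 bexI[of _ j]) (auto simp: u'_def)
  ultimately show ?thesis by blast
qed

section \<open>Swaps and permutations of bricks in any subgroup that contains the generators\<close>

context
  fixes K
  assumes K: "is_subgroup K" and gens: "swap_gens \<subseteq> K"
begin

text \<open>Induction on the number of digits of \<open>u\<close>. For a third cell
  \<open>r\<close>, the generator that swaps the slab \<open>t \<cdot> digit j c\<close> with
  \<open>r\<close> carries \<open>t \<cdot> u\<close> to the shorter \<open>r \<cdot> u'\<close> and
  fixes \<open>s\<close>, so conjugation by it removes a digit.\<close>

lemma swap_cell_in: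
  assumes "t \<in> cells" "s \<in> cells" "t \<noteq> s" "word u"
  shows "swap (t \<cdot> u) s \<in> K"
  using assms
proof (induction "\<Sum>i<n. length (u i)" arbitrary: u t rule: less_induct)
  case less
  show ?case
  proof (cases "\<exists>j<n. u j \<noteq> []")
    case False
    then have "u j = []" for j using less.prems(4) by (cases "j < n") (auto simp: word_def)
    then have "u = (\<lambda>_. [])" by auto
    moreover have "swap t s \<in> swap_gens" using less.prems by (auto simp: swap_gens_def)
    ultimately show ?thesis using gens by auto
  next
    case True
    then obtain j where j: "j < n" "u j \<noteq> []" by blast
    obtain c u' where c: "c < q" "word u'" "u = digit j c \<cdot> u'" "(\<Sum>i<n. length (u' i)) < (\<Sum>i<n. length (u i))"
      using word_first_digit[OF less.prems(4) j] by blast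
    obtain r where r: "r \<in> cells" "r \<noteq> s" "r \<noteq> t" using third_cell by blast
    have IH: "swap (r \<cdot> u') s \<in> K" using less.hyps[OF c(4) r(1) less.prems(2) r(2) c(2)] .
    have "swap (t \<cdot> digit j c) r \<in> swap_gens"
      unfolding swap_gens_def
      by (rule UnI2, rule image_eqI[of _ _ "(t, r, j, c)"]) (use less.prems(1) r j(1) c(1) in auto)
    then have g: "swap (t \<cdot> digit j c) r \<in> K" using gens by blast
    note d = cells_disj[OF less.prems(1-3)] cells_disj[OF less.prems(1) r(1)] cells_disj[OF less.prems(2) r(1)]
    note w = cells_wd[OF less.prems(1)] cells_wd[OF less.prems(2)] cells_wd[OF r(1)]
    have wt: "word (t \<cdot> digit j c)" using w(1) c(1) j(1) by simp
    have dt: "apart (t \<cdot> digit j c) r" "apart s (t \<cdot> digit j c)" "apart (t \<cdot> u) s" "apart s r"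
      using d r apart_wcat_left apart_wcat_right apart_sym by metis+
    have "maps (swap (t \<cdot> digit j c) r) (t \<cdot> u) (r \<cdot> u')"
      using maps_wcat[OF swap_maps1[OF wt w(3) dt(1)] c(2)] c(3) by (simp add: wcat_assoc)
    moreover have "maps (swap (t \<cdot> digit j c) r) s s"
      by (rule swap_maps_disj[OF wt w(3) dt(1) w(2) dt(2,4)])
    ultimately have "compose X (swap (t \<cdot> digit j c) r) (swap (t \<cdot> u) s) = compose X (swap (r \<cdot> u') s) (swap (t \<cdot> digit j c) r)"
      using swap_conj[of "swap (t \<cdot> digit j c) r" "t \<cdot> u" "r \<cdot> u'" s s] is_subgroupD(1)[OF K g] w less.prems(4) c(2) dt(3) by simp
    then show ?thesis using is_subgroup_conj[OF K g IH] swap_G[of "t \<cdot> u" s] w less.prems(4) dt(3) by simp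
  qed
qed

text \<open>Conjugate \<open>swap r v\<close> by \<open>swap w r\<close>, with a cell
  \<open>r\<close> that contains neither brick. This also covers two bricks inside the same
  cell.\<close>

lemma swap_in:
  assumes "off_cell w" "off_cell v" "apart w v"
  shows "swap w v \<in> K"
proof -
  obtain t u where t: "t \<in> cells" "word u" "w = t \<cdot> u" using assms(1) off_cell_def by blast
  obtain s u' where s: "s \<in> cells" "word u'" "v = s \<cdot> u'" using assms(2) off_cell_def by blast
  obtain r where r: "r \<in> cells" "r \<noteq> t" "r \<noteq> s" using third_cell by blast
  have wr: "swap w r \<in> K" using swap_cell_in[of t r u] t r by simp
  have vr: "swap v r \<in> K" using swap_cell_in[of s r u'] s r by simp
  have word: "word w" "word v" "word r" using assms off_cell_wd cells_wd r by auto
  have d: "apart w r" "apart v r" "apart v w" "apart r v"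
    using t s r cells_disj apart_wcat_left assms(3) apart_sym by metis+
  have "compose X (swap w r) (swap w v) = compose X (swap r v) (swap w r)"
    using swap_conj[of "swap w r" w r v v] swap_G swap_maps1 swap_maps_disj[of w r v] word d assms(3) by blast
  then show ?thesis
    using is_subgroup_conj[OF K wr vr] swap_commute[OF word(2,3) d(2)] swap_G[OF word(1,2) assms(3)] by simp
qed

lemma permutation_in:
  assumes "finite Q" and Q: "\<And>z. z \<in> Q \<Longrightarrow> off_cell z" "\<And>z z'. z \<in> Q \<Longrightarrow> z' \<in> Q \<Longrightarrow> z \<noteq> z' \<Longrightarrow> apart z z'"
    and "\<pi> permutes Q"
  shows "\<exists>g\<in>K. (\<forall>z\<in>Q. maps g z (\<pi> z)) \<and> (\<forall>x\<in>X. x \<notin> (\<Union>z\<in>Q. T z ` X) \<longrightarrow> g x = x)"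
  using assms(4,1)
proof (induction rule: permutes_induct)
  case id
  show ?case
    using is_subgroupD(2)[OF K] T_in off_cell_wd[OF Q(1)] by (intro bexI[of _ "\<lambda>x\<in>X. x"]) (auto simp: maps_def)
next
  case step: (swap a b p)
  obtain g where g: "g \<in> K" "\<And>z. z \<in> Q \<Longrightarrow> maps g z (p z)" "\<And>x. x \<in> X \<Longrightarrow> x \<notin> (\<Union>z\<in>Q. T z ` X) \<Longrightarrow> g x = x"
    using step by blast
  have ab: "off_cell a" "off_cell b" "apart a b" "word a" "word b" using step Q off_cell_wd by auto
  note s = swap[OF ab(4,5,3)]
  show ?case
  proof (intro bexI[of _ "compose X (swap a b) g"] conjI ballI impI)
    show "compose X (swap a b) g \<in> K" using is_subgroupD(3)[OF K swap_in[OF ab(1-3)] g(1)] .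
    fix z assume z: "z \<in> Q"
    have pz: "p z \<in> Q" using permutes_in_image[OF \<open>p permutes Q\<close>] z by blast
    have "maps (swap a b) (p z) (Transposition.transpose a b (p z))"
    proof -
      consider "p z = a" | "p z = b" | "p z \<noteq> a" "p z \<noteq> b" by blast
      then show ?thesis
      proof cases
        case 3
        then show ?thesis
          using swap_maps_disj[OF ab(4,5,3), of "p z"] Q(2)[OF pz] \<open>a \<in> Q\<close> \<open>b \<in> Q\<close> off_cell_wd[OF Q(1)[OF pz]] by simp
      qed (use s in simp_all)
    qed
    then show "maps (compose X (swap a b) g) z ((Transposition.transpose a b \<circ> p) z)"
      using maps_compose[OF g(2)[OF z]] off_cell_wd[OF Q(1)[OF z]] by simp
  next
    fix x assume x: "x \<in> X" "x \<notin> (\<Union>z\<in>Q. T z ` X)"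
    then have "x \<notin> T a ` X" "x \<notin> T b ` X" using \<open>a \<in> Q\<close> \<open>b \<in> Q\<close> by blast+
    then show "compose X (swap a b) g x = x" using g(3)[OF x] s(4)[OF x(1)] x(1) by (simp add: compose_eq)
  qed
qed

lemma permuting_element_in:
  assumes "finite Q" and Q: "\<And>z. z \<in> Q \<Longrightarrow> off_cell z" "\<And>z z'. z \<in> Q \<Longrightarrow> z' \<in> Q \<Longrightarrow> z \<noteq> z' \<Longrightarrow> apart z z'"
    and "\<pi> permutes Q" and f: "f \<in> G" "\<And>z. z \<in> Q \<Longrightarrow> maps f z (\<pi> z)"
      "\<And>x. x \<in> X \<Longrightarrow> x \<notin> (\<Union>z\<in>Q. T z ` X) \<Longrightarrow> f x = x"
  shows "f \<in> K"
proof -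
  obtain g where g: "g \<in> K" "\<And>z. z \<in> Q \<Longrightarrow> maps g z (\<pi> z)" "\<And>x. x \<in> X \<Longrightarrow> x \<notin> (\<Union>z\<in>Q. T z ` X) \<Longrightarrow> g x = x"
    using permutation_in[OF assms(1-4)] by blast
  have "f = g"
  proof (rule Bij_eqI)
    fix x assume x: "x \<in> X"
    show "f x = g x"
    proof (cases "x \<in> (\<Union>z\<in>Q. T z ` X)")
      case True
      then obtain z y where "z \<in> Q" "y \<in> X" "x = T z y" by blast
      then show ?thesis using mapsD[OF f(2)] mapsD[OF g(2)] by simp
    qed (use f(3) g(3) x in simp)
  qed (use f(1) g(1) is_subgroupD(1)[OF K] G_Bij in auto)
  then show ?thesis using g(1) by simp
qed

end

text \<open>Divisions of the complement of \<open>D\<close> obtained by repeated splitting into q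
  slabs; the number counts the splits. For n >= 3 not every division is of this kind, because three
  bars in different directions can block every first cut.\<close>

inductive hdiv :: "nat \<Rightarrow> (nat \<Rightarrow> nat list) set \<Rightarrow> bool" where
  base: "hdiv 0 cells"
| split: "hdiv r P \<Longrightarrow> w \<in> P \<Longrightarrow> i < n \<Longrightarrow> hdiv (Suc r) (P - {w} \<union> (\<lambda>c. w \<cdot> digit i c) ` {..<q})"

lemma hdiv_finite: "hdiv r P \<Longrightarrow> finite P"
  by (induction rule: hdiv.induct) (auto simp: finite_P0)

lemma hdiv_inW: "hdiv r P \<Longrightarrow> p \<in> P \<Longrightarrow> off_cell p"
  by (induction arbitrary: p rule: hdiv.induct) (auto simp: off_cell_P0 off_cell_wcat)

lemma hdiv_disj: "hdiv r P \<Longrightarrow> p \<in> P \<Longrightarrow> p' \<in> P \<Longrightarrow> p \<noteq> p' \<Longrightarrow> apart p p'"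
proof (induction arbitrary: p p' rule: hdiv.induct)
  case (split r P w i)
  have "apart z (w \<cdot> digit i c)" "apart (w \<cdot> digit i c) z" if "z \<in> P - {w}" for z c
    using split.IH[of z w] split.hyps(2) that apart_wcat_right apart_sym by blast+
  moreover have "apart (w \<cdot> digit i c) (w \<cdot> digit i c')" if "w \<cdot> digit i c \<noteq> w \<cdot> digit i c'" for c c'
    using digit_disj[OF split.hyps(3), of c c'] that by auto
  ultimately show ?case using split.prems split.IH by auto
qed (simp add: cells_disj)

lemma hdiv_prefix:
  assumes "hdiv r P" "w \<in> P" "w \<cdot> u \<in> P"
  shows "w \<cdot> u = w"
proof (rule ccontr)
  assume "w \<cdot> u \<noteq> w"
  then have "apart w (w \<cdot> u)" using hdiv_disj[OF assms] by metis
  then show False by simp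
qed

lemma hdiv_cover: "hdiv r P \<Longrightarrow> x \<in> X \<Longrightarrow> x \<notin> T D ` X \<Longrightarrow> \<exists>p\<in>P. \<exists>y\<in>X. x = T p y"
proof (induction rule: hdiv.induct)
  case base
  then show ?case using T_cover[OF base(1), of "\<lambda>_. 2"] by (auto simp: cells_def)
next
  case (split r P w i)
  then obtain p y where p: "p \<in> P" "y \<in> X" "x = T p y" by blast
  show ?case
  proof (cases "p = w")
    case True
    obtain c z where "c < q" "z \<in> X" "y = T (digit i c) z" using digit_cover[OF split.hyps(3) p(2)] by blast
    moreover from this have "x = T (w \<cdot> digit i c) z" using p True by (simp add: T_wcat)
    ultimately show ?thesis by blast
  qed (use p in blast)
qed

text \<open>Every split adds q - 1 bricks, so the cardinality determines the number of splits.
  Divisions in bijection thus have the same \<open>r\<close>.\<close>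

lemma hdiv_card: "hdiv r P \<Longrightarrow> card P = card cells + r * (q - 1)"
proof (induction rule: hdiv.induct)
  case (split r P w i)
  have fin: "finite P" using split.hyps hdiv_finite by blast
  have "w \<cdot> digit i c \<notin> P - {w}" for c
    using hdiv_prefix[OF split.hyps(1,2)] by blast
  then have dj: "(P - {w}) \<inter> (\<lambda>c. w \<cdot> digit i c) ` {..<q} = {}" by blast
  have "card (P - {w} \<union> (\<lambda>c. w \<cdot> digit i c) ` {..<q}) = card (P - {w}) + card ((\<lambda>c. w \<cdot> digit i c) ` {..<q})"
    by (intro card_Un_disjoint[OF _ _ dj] finite_imageI finite_Diff fin finite_lessThan)
  also have "card ((\<lambda>c. w \<cdot> digit i c) ` {..<q}) = q"
    using card_image[of "\<lambda>c. w \<cdot> digit i c" "{..<q}"] by (simp add: inj_on_def)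
  also have "card (P - {w}) = card P - 1" using fin split.hyps(2) by simp
  also have "card P - 1 + q = card P + (q - 1)"
    using split.hyps(2) fin card_gt_0_iff[of P] q2 by force
  finally show ?case using split.IH by simp
qed simp

text \<open>\<open>f\<close> is the identity on \<open>D\<close> and so preserves the complement,
  which both divisions cover. Injectivity comes from \<open>maps_disj\<close>, surjectivity from the
  preimage of the corner of a brick of \<open>Q\<close>.\<close>

lemma hdiv_bij:
  assumes P: "hdiv r P" and Q: "hdiv r' Q" and f: "f \<in> off_grp" "\<And>p. p \<in> P \<Longrightarrow> \<exists>z\<in>Q. maps f p z"
  shows "\<exists>\<sigma>. bij_betw \<sigma> P Q \<and> (\<forall>p\<in>P. maps f p (\<sigma> p))"
proof -
  obtain \<sigma> where \<sigma>: "\<And>p. p \<in> P \<Longrightarrow> \<sigma> p \<in> Q \<and> maps f p (\<sigma> p)" using f(2) by metis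
  have Bij: "f \<in> Bij X" using f(1) G_Bij by (simp add: off_grp_def)
  have wP: "word p" if "p \<in> P" for p using hdiv_inW[OF P that] off_cell_wd by blast
  have wQ: "word p" if "p \<in> Q" for p using hdiv_inW[OF Q that] off_cell_wd by blast
  have "inj_on \<sigma> P"
  proof (rule inj_onI, rule ccontr)
    fix p p' assume p: "p \<in> P" "p' \<in> P" "\<sigma> p = \<sigma> p'" "p \<noteq> p'"
    then have "apart (\<sigma> p) (\<sigma> p')"
      using maps_disj[OF Bij, of p "\<sigma> p" p' "\<sigma> p'"] \<sigma> wP wQ hdiv_disj[OF P p(1,2,4)] by blast
    then show False using p(3) apart_irrefl by simp
  qed
  moreover have "\<sigma> ` P = Q"
  proof
    show "Q \<subseteq> \<sigma> ` P"
    proof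
      fix z assume z: "z \<in> Q"
      define x where "x = T z (\<lambda>j\<in>{..<n}. 0)"
      have xX: "x \<in> X" unfolding x_def using T_in[OF wQ[OF z] X_ne] .
      then obtain y where y: "y \<in> X" "x = f y" using Bij by (auto simp: Bij_def bij_betw_def)
      have "y \<notin> T D ` X"
      proof
        assume "y \<in> T D ` X"
        then obtain y' where "y' \<in> X" "y = T D y'" by blast
        then have "x = T D y'" using f(1) y mapsD[of f D D y'] by (simp add: off_grp_def)
        then show False
          using T_disj[OF off_cell_disj_D[OF hdiv_inW[OF Q z]] D_wd wQ[OF z] \<open>y' \<in> X\<close> X_ne] by (simp add: x_def)
      qed
      then obtain p y' where p: "p \<in> P" "y' \<in> X" "y = T p y'" using hdiv_cover[OF P y(1)] by blast
      then have "x = T (\<sigma> p) y'" using \<sigma> y mapsD by simp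
      then have "\<not> apart z (\<sigma> p)" using T_disj[of z "\<sigma> p" _ y'] wQ z \<sigma> p X_ne unfolding x_def by metis
      then have "z = \<sigma> p" using hdiv_disj[OF Q z] \<sigma> p by blast
      then show "z \<in> \<sigma> ` P" using p by blast
    qed
  qed (use \<sigma> in blast)
  ultimately show ?thesis using \<sigma> by (auto simp: bij_betw_def)
qed

text \<open>The bricks are replaced one after another. By \<open>sub\<close> the new bricks lie
  inside the old ones, so removing the next brick cannot delete one of them.\<close>

lemma hdiv_replace_all:
  assumes "finite A" "A \<subseteq> P" "hdiv r P"
    and R: "\<And>r P a. a \<in> A \<Longrightarrow> hdiv r P \<Longrightarrow> a \<in> P \<Longrightarrow> \<exists>r'. hdiv r' (P - {a} \<union> R a)"
    and sub: "\<And>a. a \<in> A \<Longrightarrow> R a \<subseteq> range ((\<cdot>) a)"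
  shows "\<exists>r'. hdiv r' (P - A \<union> (\<Union>a\<in>A. R a))"
  using assms
proof (induction A rule: finite_induct)
  case (insert a A)
  then obtain r' where r': "hdiv r' (P - A \<union> (\<Union>a\<in>A. R a))" by auto
  have "a \<notin> R b" if b: "b \<in> A" for b
  proof
    assume aR: "a \<in> R b"
    have "R b \<subseteq> range ((\<cdot>) b)" using insert.prems(4) b by simp
    then obtain u where "a = b \<cdot> u" using aR by blast
    moreover have "apart b a"
      using hdiv_disj[OF insert.prems(2), of b a] insert.prems(1) insert.hyps(2) b by blast
    ultimately show False by simp
  qed
  then have "P - A \<union> (\<Union>a\<in>A. R a) - {a} \<union> R a = P - insert a A \<union> (\<Union>a\<in>insert a A. R a)" by blast
  moreover have "a \<in> P - A \<union> (\<Union>a\<in>A. R a)" using insert by blast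
  ultimately show ?case using insert.prems(3)[OF insertI1 r'] by simp
qed auto

text \<open>Induction on the total depth: split along a coordinate with \<open>0 < e i\<close>, then
  refine each slab with that depth lowered by one.\<close>

lemma hdiv_refine:
  assumes "hdiv r P" "a \<in> P"
  shows "\<exists>r'. hdiv r' (P - {a} \<union> (\<cdot>) a ` words e)"
  using assms
proof (induction "\<Sum>j<n. e j" arbitrary: e r P a rule: less_induct)
  case less
  show ?case
  proof (cases "\<exists>i<n. 0 < e i")
    case False
    then have "words e = {\<lambda>_. []}"
    proof (intro equalityI subsetI)
      fix u assume u: "u \<in> words e"
      have "u j = []" for j using u False by (cases "j < n") (auto simp: words_def word_def)
      then show "u \<in> {\<lambda>_. []}" by auto
    qed (use False in \<open>auto simp: words_def\<close>)
    then have "P - {a} \<union> (\<cdot>) a ` words e = P" using less.prems by auto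
    then show ?thesis using less.prems by auto
  next
    case True
    then obtain i where i: "i < n" "0 < e i" by blast
    define e' where "e' = e(i := e i - 1)"
    define A where "A = (\<lambda>c. a \<cdot> digit i c) ` {..<q}"
    have lt: "(\<Sum>j<n. e' j) < (\<Sum>j<n. e j)"
      using i by (intro sum_strict_mono_ex1 bexI[of _ i]) (auto simp: e'_def)
    have "hdiv (Suc r) (P - {a} \<union> A)" unfolding A_def using split less.prems i(1) by blast
    moreover have "\<exists>r'. hdiv r' (P' - {b} \<union> (\<cdot>) b ` words e')" if "hdiv r' P'" "b \<in> P'" for r' P' b
      using less.hyps[OF lt that] .
    ultimately obtain r' where r': "hdiv r' (P - {a} \<union> A - A \<union> (\<Union>b\<in>A. (\<cdot>) b ` words e'))"
      using hdiv_replace_all[of A "P - {a} \<union> A" "Suc r" "\<lambda>b. (\<cdot>) b ` words e'"] unfolding A_def by blast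
    have Ue: "words e = (\<Union>c\<in>{..<q}. (\<cdot>) (digit i c) ` words e')"
    proof (intro equalityI subsetI)
      fix u assume u: "u \<in> words e"
      then have "u i \<noteq> []" using i by (auto simp: words_def)
      then obtain c u' where c: "c < q" "word u'" "u = digit i c \<cdot> u'"
        using word_first_digit[of u i] words_wd[OF u] i by blast
      have "u' \<in> words e'" using u c by (auto simp: words_def wcat_def digit_def e'_def)
      then show "u \<in> (\<Union>c\<in>{..<q}. (\<cdot>) (digit i c) ` words e')" using c by blast
    next
      fix u assume "u \<in> (\<Union>c\<in>{..<q}. (\<cdot>) (digit i c) ` words e')"
      then obtain c u' where c: "c < q" "u' \<in> words e'" "u = digit i c \<cdot> u'" by blast
      then have "word u" using i by (simp add: words_wd)
      then show "u \<in> words e" using c i by (auto simp: words_def wcat_def digit_def e'_def split: if_splits)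
    qed
    have disjA: "A \<inter> (P - {a}) = {}"
      using hdiv_prefix[OF less.prems(1,2)] unfolding A_def by blast
    moreover have "(\<Union>b\<in>A. (\<cdot>) b ` words e') = (\<cdot>) a ` words e"
    proof -
      have eq: "(\<cdot>) (a \<cdot> digit i c) = (\<cdot>) a \<circ> (\<cdot>) (digit i c)" for c by (simp add: fun_eq_iff wcat_assoc)
      have "(\<Union>b\<in>A. (\<cdot>) b ` words e') = (\<Union>c\<in>{..<q}. (\<cdot>) (a \<cdot> digit i c) ` words e')"
        unfolding A_def by (rule UN_simps(10))
      also have "\<dots> = (\<Union>c\<in>{..<q}. (\<cdot>) a ` (\<cdot>) (digit i c) ` words e')" by (simp only: eq image_comp)
      also have "\<dots> = (\<cdot>) a ` words e" unfolding Ue by (rule image_UN[symmetric])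
      finally show ?thesis .
    qed
    moreover have "P - {a} \<union> A - A = P - {a}" using disjA by (simp add: Un_Diff Diff_triv Int_commute)
    ultimately show ?thesis using r' by auto
  qed
qed

lemma hdiv_refine_all:
  assumes "hdiv r P"
  shows "\<exists>r'. hdiv r' (\<Union>a\<in>P. (\<cdot>) a ` words (e a))"
proof -
  have "\<exists>r'. hdiv r' (P - P \<union> (\<Union>a\<in>P. (\<cdot>) a ` words (e a)))"
  proof (rule hdiv_replace_all[OF hdiv_finite[OF assms] order_refl assms])
    fix r P a assume "hdiv r P" "a \<in> P"
    then show "\<exists>r'. hdiv r' (P - {a} \<union> (\<cdot>) a ` words (e a))" by (rule hdiv_refine)
  qed (rule image_mono[OF subset_UNIV])
  then show ?thesis by (simp only: Diff_cancel Un_empty_left)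
qed

end

section \<open>Generation and bounded factorization\<close>

context adic_bricks
begin

text \<open>\<open>glue\<close> demands equal unions, so the element is taken to exchange each
  \<open>p\<close> with \<open>y p\<close>; the Boolean index says which of the two is the
  source.\<close>

lemma exists_mover:
  assumes "finite P" and P: "\<And>p. p \<in> P \<Longrightarrow> word p" "\<And>p p'. p \<in> P \<Longrightarrow> p' \<in> P \<Longrightarrow> p \<noteq> p' \<Longrightarrow> apart p p'"
    and y: "\<And>p. p \<in> P \<Longrightarrow> word (y p)" "\<And>p p'. p \<in> P \<Longrightarrow> p' \<in> P \<Longrightarrow> p \<noteq> p' \<Longrightarrow> apart (y p) (y p')"
      "\<And>p p'. p \<in> P \<Longrightarrow> p' \<in> P \<Longrightarrow> apart p (y p')"
  shows "\<exists>g\<in>G. \<forall>p\<in>P. maps g p (y p)"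
proof -
  let ?a = "\<lambda>(p, b). if b then p else y p" and ?b = "\<lambda>(p, b). if b then y p else p"
  have un: "(\<Union>i\<in>P \<times> UNIV. F (?a i)) = (\<Union>i\<in>P \<times> UNIV. F (?b i))" for F :: "(nat \<Rightarrow> nat list) \<Rightarrow> (nat \<Rightarrow> real) set"
  proof (intro equalityI UN_least)
    fix i :: "(nat \<Rightarrow> nat list) \<times> bool" assume "i \<in> P \<times> UNIV"
    then have i': "(fst i, \<not> snd i) \<in> P \<times> UNIV" by auto
    show "F (?a i) \<subseteq> (\<Union>i\<in>P \<times> UNIV. F (?b i))" "F (?b i) \<subseteq> (\<Union>i\<in>P \<times> UNIV. F (?a i))"
      using UN_upper[OF i', of "\<lambda>i. F (?b i)"] UN_upper[OF i', of "\<lambda>i. F (?a i)"] by (auto simp: case_prod_beta)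
  qed
  have "apart (?a i) (?a j)" "apart (?b i) (?b j)" if "i \<in> P \<times> UNIV" "j \<in> P \<times> UNIV" "i \<noteq> j" for i j
    using that P(2)[of "fst i" "fst j"] y(2)[of "fst i" "fst j"] y(3)[of "fst i" "fst j"] y(3)[of "fst j" "fst i"]
      apart_sym[of "y (fst i)" "fst j"]
    by (auto simp: case_prod_beta prod_eq_iff mem_Times_iff)
  then have "\<exists>f\<in>G. (\<forall>i\<in>P \<times> UNIV. maps f (?a i) (?b i)) \<and> (\<forall>x\<in>X. x \<notin> (\<Union>i\<in>P \<times> UNIV. T (?a i) ` X) \<longrightarrow> f x = x)"
    using \<open>finite P\<close> P(1) y(1) by (intro glue un) (auto simp: case_prod_beta mem_Times_iff)
  then obtain f where f: "f \<in> G" "\<And>i. i \<in> P \<times> UNIV \<Longrightarrow> maps f (?a i) (?b i)" by blast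
  have "maps f p (y p)" if "p \<in> P" for p using f(2)[of "(p, True)"] that by simp
  then show ?thesis using f(1) by blast
qed

lemma maps_id: "word z \<Longrightarrow> maps (\<lambda>x\<in>X. x) z z"
  using T_in by (simp add: maps_def)

definition supported_off :: "(nat \<Rightarrow> nat list) \<Rightarrow> ((nat \<Rightarrow> real) \<Rightarrow> nat \<Rightarrow> real) set" where
  "supported_off D = {f \<in> G. maps f D D}"

lemma swap_supported_off:
  assumes "z \<in> words (\<lambda>_. 2)" "y \<in> words (\<lambda>_. 2)" "word u" "word v" "apart (z \<cdot> u) (y \<cdot> v)"
  shows "\<exists>D\<in>words (\<lambda>_. 2). swap (z \<cdot> u) (y \<cdot> v) \<in> supported_off D"
proof -
  obtain D where D: "D \<in> words (\<lambda>_. 2)" "D \<noteq> z" "D \<noteq> y" using fourth_cell by blast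
  have "apart D (z \<cdot> u)" "apart D (y \<cdot> v)"
    using words_disj[OF D(1) assms(1)] words_disj[OF D(1) assms(2)] D apart_wcat_right by blast+
  then have "maps (swap (z \<cdot> u) (y \<cdot> v)) D D"
    using assms words_wd D(1) by (intro swap_maps_disj) (auto dest: words_wd)
  moreover have "swap (z \<cdot> u) (y \<cdot> v) \<in> G"
    using assms by (intro swap_G) (auto dest: words_wd)
  ultimately show ?thesis using D(1) unfolding supported_off_def by blast
qed

lemma id_supported_off: "\<exists>D\<in>words (\<lambda>_. 2). (\<lambda>x\<in>X. x) \<in> supported_off D"
proof -
  obtain D where D: "D \<in> words (\<lambda>_. 2)" using fourth_cell by blast
  then have "maps (\<lambda>x\<in>X. x) D D" using maps_id words_wd by blast
  then show ?thesis using D id_G unfolding supported_off_def by blast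
qed

text \<open>The cell \<open>z0\<close> is squeezed into a tiny brick on which \<open>f\<close> is canonical,
  and the image of this brick is expanded to \<open>z0\<close> again.\<close>

lemma bounded_factorization:
  assumes f: "f \<in> G"
  shows "\<exists>s\<in>\<Union>(supported_off ` words (\<lambda>_. 2)). \<exists>t\<in>\<Union>(supported_off ` words (\<lambda>_. 2)). \<exists>t'\<in>\<Union>(supported_off ` words (\<lambda>_. 2)).
           compose X t' (compose X t (compose X f s)) \<in> \<Union>(supported_off ` words (\<lambda>_. 2))"
proof -
  let ?E = "\<Union>(supported_off ` words (\<lambda>_. 2))"
  have E_G: "h \<in> G" if "h \<in> ?E" for h using that unfolding supported_off_def by blast
  have E_swap: "swap (z \<cdot> u) (y \<cdot> v) \<in> ?E"
    if "z \<in> words (\<lambda>_. 2)" "y \<in> words (\<lambda>_. 2)" "word u" "word v" "apart (z \<cdot> u) (y \<cdot> v)" for z u y v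
    using swap_supported_off[OF that] by blast
  have E_id: "(\<lambda>x\<in>X. x) \<in> ?E" using id_supported_off by blast
  obtain z0 where z0: "z0 \<in> words (\<lambda>_. 2)" using fourth_cell by blast
  obtain z1 where z1: "z1 \<in> words (\<lambda>_. 2)" "z1 \<noteq> z0" using fourth_cell by blast
  have d01: "apart z0 z1" "apart z1 z0" using words_disj z0 z1 by blast+
  obtain m where m: "\<And>w. w \<in> words (\<lambda>_. m) \<Longrightarrow> \<exists>v. word v \<and> maps f w v" using G_maps[OF f] by blast
  define zero where "zero = (\<lambda>k j. if j < n then replicate k (0::nat) else [])"
  have zero: "zero k \<in> words (\<lambda>_. k)" for k
    using q2 by (auto simp: zero_def words_def word_def digits_def)
  \<comment> \<open>This gives \<open>w\<close> exactly m + 4 digits per coordinate. The first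
    \<open>m\<close> make \<open>f\<close> canonical on it; the others reappear at the end of the
    image word, which is thus long enough to lie in a single cell.\<close>
  define u where "u = zero (m + 2)"
  define w where "w = z1 \<cdot> u"
  have wdu: "word u" "word w" using zero words_wd z1 unfolding u_def w_def by auto
  obtain a b where ab: "a \<in> words (\<lambda>_. m)" "word b" "w = a \<cdot> b"
    using word_cut[OF wdu(2), of m] by (auto simp: w_def u_def wcat_def zero_def)
  have lb: "2 \<le> length (b j)" if "j < n" for j
  proof -
    have "length (w j) = 2 + (m + 2)" using that z1 by (simp add: w_def u_def wcat_def zero_def words_def)
    moreover have "length (w j) = m + length (b j)" using that ab by (simp add: wcat_def words_def)
    ultimately show ?thesis by simp
  qed
  obtain v0 where v0: "word v0" "maps f a v0" using m[OF ab(1)] by blast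
  define v where "v = v0 \<cdot> b"
  have v: "word v" "maps f w v" using v0 ab maps_wcat[OF v0(2) ab(2)] by (auto simp: v_def)
  obtain y v' where y: "y \<in> words (\<lambda>_. 2)" "word v'" "v = y \<cdot> v'"
    using word_cut[OF v(1), of 2] lb by (fastforce simp: v_def wcat_def)
  have dw: "apart z0 w" unfolding w_def using d01 apart_wcat_right by blast
  define s where "s = swap z0 w"
  have sE: "s \<in> ?E" unfolding s_def w_def
    using E_swap[OF z0 z1(1) word_empty wdu(1)] dw by (simp add: w_def)
  have s: "maps s z0 w" unfolding s_def using swap_maps1[OF words_wd[OF z0] wdu(2) dw] .
  have fs: "maps (compose X f s) z0 v" using maps_compose[OF s v(2) words_wd[OF z0]] .
  have fsG: "compose X f s \<in> G" using compose_G f E_G[OF sE] by blast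
  show ?thesis
  \<comment> \<open>A swap needs apart bricks. If the image is outside \<open>z0\<close>, one swap
    brings it back and the identity fills the place of \<open>t'\<close>; otherwise it returns by
    way of \<open>z1\<close>.\<close>
  proof (cases "y = z0")
    case False
    then have d: "apart v z0" using words_disj[OF y(1) z0] apart_wcat_left y(3) by blast
    define t where "t = swap v z0"
    have tE: "t \<in> ?E" unfolding t_def y(3) using E_swap[OF y(1) z0 y(2) word_empty] d by (simp add: y(3))
    have "maps t v z0" unfolding t_def using swap_maps1[OF v(1) words_wd[OF z0] d] .
    then have tfs: "maps (compose X t (compose X f s)) z0 z0" using maps_compose[OF fs _ words_wd[OF z0]] by blast
    have tG: "compose X t (compose X f s) \<in> G" using compose_G E_G[OF tE] fsG by blast
    have id_z0: "maps (\<lambda>x\<in>X. x) z0 z0" using maps_id[OF words_wd[OF z0]] .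
    have "maps (compose X (\<lambda>x\<in>X. x) (compose X t (compose X f s))) z0 z0"
      using maps_compose[OF tfs id_z0 words_wd[OF z0]] .
    then have "compose X (\<lambda>x\<in>X. x) (compose X t (compose X f s)) \<in> supported_off z0"
      unfolding supported_off_def using compose_G[OF id_G tG] by blast
    then show ?thesis using sE tE E_id z0 by blast
  next
    case True
    then have d: "apart v z1" using d01 apart_wcat_left y(3) by blast
    define t where "t = swap v z1"
    define t' where "t' = swap z1 z0"
    have tE: "t \<in> ?E" unfolding t_def y(3) using E_swap[OF y(1) z1(1) y(2) word_empty] d by (simp add: y(3))
    have t'E: "t' \<in> ?E" unfolding t'_def using E_swap[OF z1(1) z0 word_empty word_empty] d01 by simp
    have t: "maps t v z1" unfolding t_def using swap_maps1[OF v(1) words_wd[OF z1(1)] d] .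
    have t': "maps t' z1 z0" unfolding t'_def using swap_maps1[OF words_wd[OF z1(1)] words_wd[OF z0] d01(2)] .
    have "maps (compose X t' (compose X t (compose X f s))) z0 z0"
      using maps_compose[OF maps_compose[OF fs t words_wd[OF z0]] t' words_wd[OF z0]] .
    then have "compose X t' (compose X t (compose X f s)) \<in> supported_off z0"
      unfolding supported_off_def using compose_G E_G[OF tE] E_G[OF t'E] fsG by blast
    then show ?thesis using sE tE t'E z0 by blast
  qed
qed

lemma baker_inverse:
  assumes "word w" "i < n" "j < n" "x \<in> X"
  shows "baker w j i (baker w i j x) = x"
proof (cases "x \<in> T w ` X")
  case True
  then obtain c y where c: "c < q" "y \<in> X" "x = T (w \<cdot> digit i c) y" using digit_union[OF assms(2), of w] by blast
  then show ?thesis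
    using mapsD[OF baker_maps[OF assms(1-3) c(1)] c(2)] mapsD[OF baker_maps[OF assms(1,3,2) c(1)] c(2)] by simp
next
  case False
  then show ?thesis using baker_off[OF assms(1-3)] baker_off[OF assms(1,3,2)] assms(4) by simp
qed

end

context grid_cell
begin

lemma off_grp_eq: "off_grp = supported_off D"
  by (simp add: off_grp_def supported_off_def)

context
  fixes K
  assumes K: "is_subgroup K" and gens: "swap_gens \<subseteq> K"
begin

text \<open>The index involution induces a permutation of the bricks. Working with indices helps
  where the bricks are images under a baker's map and have no explicit formula.\<close>

lemma involution_in:
  fixes c :: "'i \<Rightarrow> nat \<Rightarrow> nat list"
  assumes "finite J" and c: "\<And>i. i \<in> J \<Longrightarrow> off_cell (c i)" "\<And>i j. i \<in> J \<Longrightarrow> j \<in> J \<Longrightarrow> i \<noteq> j \<Longrightarrow> apart (c i) (c j)"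
    and \<tau>: "\<And>i. i \<in> J \<Longrightarrow> \<tau> i \<in> J \<and> \<tau> (\<tau> i) = i"
    and f: "f \<in> G" "\<And>i. i \<in> J \<Longrightarrow> maps f (c i) (c (\<tau> i))" "\<And>x. x \<in> X \<Longrightarrow> x \<notin> (\<Union>i\<in>J. T (c i) ` X) \<Longrightarrow> f x = x"
  shows "f \<in> K"
proof -
  have inj: "inj_on c J" using c(2) apart_irrefl by (metis inj_onI)
  define \<pi> where "\<pi> = (\<lambda>y. if y \<in> c ` J then c (\<tau> (inv_into J c y)) else y)"
  have \<pi>: "\<pi> (c i) = c (\<tau> i)" if "i \<in> J" for i using that inj by (simp add: \<pi>_def)
  have "\<pi> permutes c ` J"
  proof (rule bij_imp_permutes)
    show "bij_betw \<pi> (c ` J) (c ` J)"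
      by (rule bij_betw_byWitness[of _ \<pi>]) (use \<pi> \<tau> in auto)
  qed (simp add: \<pi>_def)
  then show ?thesis
    by (rule permuting_element_in[OF K gens finite_imageI[OF \<open>finite J\<close>], rotated 2])
      (use c f \<pi> in auto)
qed

text \<open>A baker's map may cut a brick that has no digit to be moved. Three digits rule this out:
  beyond the two of \<open>s\<close> at least one remains.\<close>

lemma baker_word:
  assumes s: "s \<in> cells" and ij: "i < n" "j < n" and z: "off_cell z" "\<And>l. l < n \<Longrightarrow> 3 \<le> length (z l)"
  shows "\<exists>z'. off_cell z' \<and> maps (baker s i j) z z'"
proof (cases "apart z s")
  case True
  then show ?thesis using baker_maps_disj[OF cells_wd[OF s] ij off_cell_wd[OF z(1)]] z(1) by blast
next
  case False
  have ls: "length (s l) = 2" if "l < n" for l using s that by (simp add: cells_def words_def)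
  obtain u where u: "word u" "z = s \<cdot> u"
    using not_disj_extend[of s z] False apart_sym cells_wd[OF s] off_cell_wd[OF z(1)] ls z(2) by force
  have "u i \<noteq> []" using z(2)[OF ij(1)] ls[OF ij(1)] u(2) by (auto simp: wcat_def)
  then obtain c u' where c: "c < q" "word u'" "u = digit i c \<cdot> u'" using word_first_digit[OF u(1) ij(1)] by blast
  have "maps (baker s i j) z (s \<cdot> digit j c \<cdot> u')"
    using maps_wcat[OF baker_maps[OF cells_wd[OF s] ij c(1)] c(2)] u c by (simp add: wcat_assoc)
  moreover have "off_cell (s \<cdot> digit j c \<cdot> u')" using off_cell_wcat[OF off_cell_P0[OF s]] c ij by simp
  ultimately show ?thesis by blast
qed

text \<open>Baker's maps normalise the group generated by the swaps. They may cut \<open>w\<close>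
  and \<open>v\<close>, but the sub-bricks with three further digits are carried to bricks, and the
  conjugate exchanges these in pairs.\<close>

lemma baker_conj_swap_in:
  assumes s: "s \<in> cells" and ij: "i < n" "j < n" and wv: "off_cell w" "off_cell v" "apart w v"
  shows "compose X (baker s j i) (compose X (swap w v) (baker s i j)) \<in> K"
proof -
  have ws: "word s" "word w" "word v" using cells_wd[OF s] off_cell_wd wv by auto
  note sw = swap[OF ws(2,3) wv(3)]
  define J where "J = (UNIV :: bool set) \<times> words (\<lambda>_. 3)"
  define a where "a = (\<lambda>(b, u). if b then w \<cdot> u else v \<cdot> u)"
  define \<tau> where "\<tau> = (\<lambda>(b, u :: nat \<Rightarrow> nat list). (\<not> b, u))"
  have \<tau>: "\<tau> i \<in> J \<and> \<tau> (\<tau> i) = i" if "i \<in> J" for i using that by (auto simp: \<tau>_def J_def)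
  have wdu: "word (snd i)" if "i \<in> J" for i using that words_wd by (auto simp: J_def)
  have aW: "off_cell (a i)" if "i \<in> J" for i
    using off_cell_wcat[OF wv(1) wdu[OF that]] off_cell_wcat[OF wv(2) wdu[OF that]] by (simp add: a_def case_prod_beta)
  have "\<exists>z'. off_cell z' \<and> maps (baker s j i) (a l) z'" if l: "l \<in> J" for l
    by (rule baker_word[OF s ij(2,1) aW[OF l]]) (use l in \<open>auto simp: J_def a_def words_def wcat_def\<close>)
  then obtain c where c: "\<And>l. l \<in> J \<Longrightarrow> off_cell (c l) \<and> maps (baker s j i) (a l) (c l)" by metis
  have adisj: "apart (a l) (a l')" if "l \<in> J" "l' \<in> J" "l \<noteq> l'" for l l'
  proof -
    obtain b u b' u' where l: "l = (b, u)" "l' = (b', u')" by fastforce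
    have "apart (v \<cdot> u1) (w \<cdot> u2)" "apart (w \<cdot> u1) (v \<cdot> u2)" for u1 u2
      using apart_wcat[OF wv(3)] apart_sym by blast+
    moreover have "apart u u'" if "u \<noteq> u'"
      using words_disj[OF _ _ that] \<open>l \<in> J\<close> \<open>l' \<in> J\<close> unfolding J_def l by blast
    ultimately show ?thesis using that(3) unfolding l a_def by (cases b; cases b') auto
  qed
  have cdisj: "apart (c l) (c l')" if "l \<in> J" "l' \<in> J" "l \<noteq> l'" for l l'
    using maps_disj[OF G_Bij[OF baker_G[OF ws(1) ij(2,1)]], of "a l" "c l" "a l'" "c l'"]
      c that aW off_cell_wd adisj by blast
  have inv: "maps (baker s i j) (c l) (a l)" if l: "l \<in> J" for l
    unfolding maps_def
  proof
    fix x assume x: "x \<in> X"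
    have "baker s i j (baker s j i (T (a l) x)) = T (a l) x"
      using baker_inverse[OF ws(1) ij(2,1) T_in[OF off_cell_wd[OF aW[OF l]] x]] .
    then show "baker s i j (T (c l) x) = T (a l) x" using c[OF l] mapsD x by metis
  qed
  have mid: "maps (swap w v) (a l) (a (\<tau> l))" if l: "l \<in> J" for l
    using maps_wcat[OF sw(2) wdu[OF l]] maps_wcat[OF sw(3) wdu[OF l]] by (auto simp: a_def \<tau>_def case_prod_beta)
  let ?g = "compose X (baker s j i) (compose X (swap w v) (baker s i j))"
  show ?thesis
  proof (rule involution_in[of J c \<tau>])
    show "finite J" by (simp add: J_def finite_words)
    show "?g \<in> G" using compose_G baker_G[OF ws(1)] ij sw(1) by blast
    show "maps ?g (c l) (c (\<tau> l))" if l: "l \<in> J" for l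
    proof -
      have "word (c l)" using c[OF l] off_cell_wd by blast
      then show ?thesis using maps_compose[OF maps_compose[OF inv[OF l] mid[OF l]]] c[of "\<tau> l"] \<tau>[OF l] by blast
    qed
    fix x assume x: "x \<in> X" "x \<notin> (\<Union>l\<in>J. T (c l) ` X)"
    define y where "y = baker s i j x"
    have yX: "y \<in> X" unfolding y_def using Bij_in[OF G_Bij[OF baker_G[OF ws(1) ij]] x(1)] .
    have back_y: "baker s j i y = x" unfolding y_def using baker_inverse[OF ws(1) ij x(1)] .
    have na: "y \<noteq> T (a l) z" if "l \<in> J" "z \<in> X" for l z
    proof
      assume "y = T (a l) z"
      then have "x = T (c l) z" using back_y mapsD[OF conjunct2[OF c[OF that(1)]] that(2)] by simp
      then show False using x(2) that by blast
    qed
    have "y \<noteq> T (if b then w else v) z" if "z \<in> X" for b z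
    proof
      assume y: "y = T (if b then w else v) z"
      obtain u z' where u: "u \<in> words (\<lambda>_. 3)" "z' \<in> X" "z = T u z'" using T_cover[OF \<open>z \<in> X\<close>] by blast
      then have "y = T (a (b, u)) z'" using y by (simp add: a_def T_wcat)
      then show False using na[of "(b, u)" z'] u by (simp add: J_def)
    qed
    from this[of _ True] this[of _ False] have "y \<notin> T w ` X" "y \<notin> T v ` X" by auto
    then have "swap w v y = y" using sw(4)[OF yX] by blast
    then show "?g x = x" using x(1) back_y by (simp add: compose_eq y_def)
  qed (use c cdisj \<tau> in auto)
qed

end

text \<open>Up to a permutation of bricks, the baker's map of a cell is the product of the \<open>q\<close> baker's maps
  of its slabs; since all baker's maps are conjugate, this bounds its order modulo the swaps.\<close>

primrec baker_quotient :: "(nat \<Rightarrow> nat list) \<Rightarrow> nat \<Rightarrow> nat \<Rightarrow> nat \<Rightarrow> (nat \<Rightarrow> real) \<Rightarrow> nat \<Rightarrow> real" where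
  "baker_quotient s i j 0 = baker s i j"
| "baker_quotient s i j (Suc k) = compose X (baker_quotient s i j k) (baker (s \<cdot> digit i k) j i)"

text \<open>In a treated slab the baker's map of the slab puts the digit \<open>a\<close> of
  coordinate \<open>j\<close> behind \<open>c\<close> in coordinate \<open>i\<close>, and the
  baker's map of \<open>s\<close> then moves \<open>c\<close> to coordinate \<open>j\<close>. When k
  = q, every slab is treated and the leading digits of the two coordinates have been
  exchanged.\<close>

lemma baker_quotient_props:
  assumes s: "s \<in> cells" and ij: "i < n" "j < n" "i \<noteq> j" and "k \<le> q"
  shows "baker_quotient s i j k \<in> G \<and>
    (\<forall>c<k. \<forall>a<q. maps (baker_quotient s i j k) (s \<cdot> digit i c \<cdot> digit j a) (s \<cdot> digit i a \<cdot> digit j c)) \<and>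
    (\<forall>c. k \<le> c \<and> c < q \<longrightarrow> maps (baker_quotient s i j k) (s \<cdot> digit i c) (s \<cdot> digit j c)) \<and>
    (\<forall>x\<in>X. x \<notin> T s ` X \<longrightarrow> baker_quotient s i j k x = x)"
  using assms(5)
proof (induction k)
  case 0
  then show ?case using baker[OF cells_wd[OF s] ij(1,2)] by auto
next
  case (Suc k)
  let ?f = "baker_quotient s i j k" and ?b = "baker (s \<cdot> digit i k) j i"
  have k: "k < q" using Suc.prems by simp
  have wk: "word (s \<cdot> digit i k)" using cells_wd[OF s] ij k by simp
  note b = baker[OF wk ij(2,1)]
  have f: "?f \<in> G" "\<And>c a. c < k \<Longrightarrow> a < q \<Longrightarrow> maps ?f (s \<cdot> digit i c \<cdot> digit j a) (s \<cdot> digit i a \<cdot> digit j c)"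
    "\<And>c. k \<le> c \<Longrightarrow> c < q \<Longrightarrow> maps ?f (s \<cdot> digit i c) (s \<cdot> digit j c)"
    "\<And>x. x \<in> X \<Longrightarrow> x \<notin> T s ` X \<Longrightarrow> ?f x = x"
    using Suc by simp_all
  have fix_b: "maps ?b (s \<cdot> digit i c \<cdot> u) (s \<cdot> digit i c \<cdot> u)" if "c \<noteq> k" "c < q" "word u" for c u
    using that cells_wd[OF s] ij apart_wcat_left[OF digit_disj[OF ij(1) that(1)], of u]
    by (intro baker_maps_disj[OF wk ij(2,1)]) simp_all
  show ?case
  proof (intro conjI allI impI ballI)
    show "baker_quotient s i j (Suc k) \<in> G" using compose_G f(1) b(1) by simp
    fix c a assume c: "c < Suc k" and a: "a < q"
    have wca: "word (s \<cdot> digit i c \<cdot> digit j a)" using cells_wd[OF s] ij c k a by simp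
    show "maps (baker_quotient s i j (Suc k)) (s \<cdot> digit i c \<cdot> digit j a) (s \<cdot> digit i a \<cdot> digit j c)"
    proof (cases "c = k")
      case True
      have "maps ?b (s \<cdot> digit i c \<cdot> digit j a) (s \<cdot> digit i k \<cdot> digit i a)"
        using b(2)[OF a] True by (simp add: wcat_assoc)
      moreover have "maps ?f (s \<cdot> digit i k \<cdot> digit i a) (s \<cdot> digit i a \<cdot> digit j c)"
        using maps_wcat[OF f(3)[OF order_refl k] word_sg[OF ij(1) a]] True digit_commute[OF ij(3), of a k]
        by (simp add: wcat_assoc)
      ultimately show ?thesis using maps_compose wca by simp
    next
      case False
      then have "maps ?b (s \<cdot> digit i c \<cdot> digit j a) (s \<cdot> digit i c \<cdot> digit j a)"
        using fix_b[of c "digit j a"] c k a ij by simp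
      then show ?thesis using maps_compose[OF _ f(2)[of c a] wca] False c a by simp
    qed
  next
    fix c assume c: "Suc k \<le> c \<and> c < q"
    then have "maps ?b (s \<cdot> digit i c) (s \<cdot> digit i c)" using fix_b[of c "\<lambda>_. []"] by simp
    then show "maps (baker_quotient s i j (Suc k)) (s \<cdot> digit i c) (s \<cdot> digit j c)"
      using maps_compose[OF _ f(3)[of c]] c cells_wd[OF s] ij by simp
  next
    fix x assume x: "x \<in> X" "x \<notin> T s ` X"
    then have "x \<notin> T (s \<cdot> digit i k) ` X" using T_in[OF word_sg[OF ij(1) k]] by (auto simp: T_wcat)
    then show "baker_quotient s i j (Suc k) x = x" using b(3)[OF x(1)] f(4)[OF x] x(1) by (simp add: compose_eq)
  qed
qed

lemma baker_quotient_in: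
  assumes K: "is_subgroup K" "swap_gens \<subseteq> K" and s: "s \<in> cells" and ij: "i < n" "j < n" "i \<noteq> j"
  shows "baker_quotient s i j q \<in> K"
proof (rule involution_in[OF K, of "{..<q} \<times> {..<q}" "\<lambda>(c, a). s \<cdot> digit i c \<cdot> digit j a" "\<lambda>(c, a). (a, c)"])
  note bq = baker_quotient_props[OF s ij order_refl]
  show "baker_quotient s i j q \<in> G" using bq by blast
  show "off_cell (case l of (c, a) \<Rightarrow> s \<cdot> digit i c \<cdot> digit j a)" if "l \<in> {..<q} \<times> {..<q}" for l
    using that off_cell_wcat[OF off_cell_P0[OF s]] ij by auto
  show "apart (case l of (c, a) \<Rightarrow> s \<cdot> digit i c \<cdot> digit j a) (case l' of (c, a) \<Rightarrow> s \<cdot> digit i c \<cdot> digit j a)"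
    if "l \<in> {..<q} \<times> {..<q}" "l' \<in> {..<q} \<times> {..<q}" "l \<noteq> l'" for l l'
  proof -
    obtain c a c' a' where l: "l = (c, a)" "l' = (c', a')" by fastforce
    show ?thesis
      using that apart_wcat[OF digit_disj[OF ij(1), of c c']] digit_disj[OF ij(2), of a a'] by (cases "c = c'") (auto simp: l)
  qed
  show "maps (baker_quotient s i j q) (case l of (c, a) \<Rightarrow> s \<cdot> digit i c \<cdot> digit j a)
      (case case l of (c, a) \<Rightarrow> (a, c) of (c, a) \<Rightarrow> s \<cdot> digit i c \<cdot> digit j a)" if "l \<in> {..<q} \<times> {..<q}" for l
    using bq that by auto
  fix x assume x: "x \<in> X" "x \<notin> (\<Union>l\<in>{..<q} \<times> {..<q}. T (case l of (c, a) \<Rightarrow> s \<cdot> digit i c \<cdot> digit j a) ` X)"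
  have "x \<notin> T s ` X"
  proof
    assume "x \<in> T s ` X"
    then obtain c y where c: "c < q" "y \<in> X" "x = T (s \<cdot> digit i c) y" using digit_union[OF ij(1), of s] by blast
    obtain a z where a: "a < q" "z \<in> X" "y = T (digit j a) z" using digit_cover[OF ij(2) c(2)] by blast
    have "x = T (s \<cdot> digit i c \<cdot> digit j a) z" using c a by (simp add: T_wcat)
    then show False using x(2) c(1) a(1,2) by force
  qed
  then show "baker_quotient s i j q x = x" using bq x(1) by blast
qed auto

context
  fixes K
  assumes K: "is_subgroup K" and gens: "swap_gens \<subseteq> K" and bgens: "baker_gens \<subseteq> K"
begin

text \<open>Baker's maps with the same two directions are conjugate by swaps; a cell
  \<open>s\<close> apart from \<open>w\<close> makes such a swap available.\<close>

lemma baker_in: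
  assumes w: "off_cell w" and ij: "i < n" "j < n" "i \<noteq> j"
  shows "baker w i j \<in> K"
proof -
  obtain t u where t: "t \<in> cells" "word u" "w = t \<cdot> u" using w off_cell_def by blast
  obtain s where s: "s \<in> cells" "s \<noteq> t" using third_cell by blast
  have d: "apart w s" unfolding t(3) using cells_disj[OF t(1) s(1)] s(2) apart_wcat_left by blast
  have word: "word w" "word s" using off_cell_wd w cells_wd s by auto
  have "baker s i j \<in> baker_gens"
    unfolding baker_gens_def by (rule image_eqI[of _ _ "(s, i, j)"]) (use s(1) ij in auto)
  then have b: "baker s i j \<in> K" using bgens by blast
  have "compose X (swap w s) (baker w i j) = compose X (baker s i j) (swap w s)"
    using baker_conj[OF swap_G[OF word d] swap_maps1[OF word d] word ij(1,2)] .
  then show ?thesis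
    using is_subgroup_conj[OF K swap_in[OF K gens w off_cell_P0[OF s(1)] d] b] baker_G[OF word(1) ij(1,2)] by blast
qed

text \<open>Undo the last split on both sides. An element for the coarser divisions is corrected by
  a swap, which puts the brick to be split in place, and by a baker's map, which turns slabs in
  direction \<open>i\<close> into slabs in direction \<open>j\<close>.\<close>

lemma hdiv_map:
  assumes "hdiv r P" "hdiv r Q"
  shows "\<exists>g\<in>K. g \<in> off_grp \<and> (\<forall>p\<in>P. \<exists>z\<in>Q. maps g p z)"
  using assms
proof (induction r arbitrary: P Q)
  case 0
  then have "P = cells" "Q = cells" by (auto elim: hdiv.cases)
  moreover have "\<exists>z\<in>cells. maps (\<lambda>x\<in>X. x) p z" if "p \<in> cells" for p
    using maps_id[OF cells_wd[OF that]] that by blast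
  ultimately show ?case
    using is_subgroupD(2)[OF K] id_G maps_id[OF D_wd] unfolding off_grp_def by blast
next
  case (Suc r)
  obtain P' w i where P: "hdiv r P'" "w \<in> P'" "i < n" "P = P' - {w} \<union> (\<lambda>c. w \<cdot> digit i c) ` {..<q}"
    using Suc.prems(1) by (auto elim: hdiv.cases)
  obtain Q' v j where Q: "hdiv r Q'" "v \<in> Q'" "j < n" "Q = Q' - {v} \<union> (\<lambda>c. v \<cdot> digit j c) ` {..<q}"
    using Suc.prems(2) by (auto elim: hdiv.cases)
  obtain g where g: "g \<in> K" "g \<in> off_grp" "\<And>p. p \<in> P' \<Longrightarrow> \<exists>z\<in>Q'. maps g p z"
    using Suc.IH[OF P(1) Q(1)] by blast
  have wP: "off_cell p" "word p" if "p \<in> P'" for p using hdiv_inW[OF P(1) that] off_cell_wd by auto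
  have wQ: "off_cell p" "word p" if "p \<in> Q'" for p using hdiv_inW[OF Q(1) that] off_cell_wd by auto
  obtain v1 where v1: "v1 \<in> Q'" "maps g w v1" using g(3)[OF P(2)] by blast
  have "\<exists>h\<in>K. h \<in> off_grp \<and> (\<forall>z\<in>Q'. \<exists>z'\<in>Q'. maps h z z') \<and> maps h v1 v"
  proof (cases "v1 = v")
    case True
    then show ?thesis
      using is_subgroupD(2)[OF K] id_G maps_id[OF D_wd] maps_id[OF wQ(2)] v1(1) unfolding off_grp_def by blast
  next
    case False
    have d: "apart v1 v" using hdiv_disj[OF Q(1) v1(1) Q(2) False] .
    note sw = swap[OF wQ(2)[OF v1(1)] wQ(2)[OF Q(2)] d]
    have "maps (swap v1 v) D D"
      using swap_maps_disj[OF wQ(2)[OF v1(1)] wQ(2)[OF Q(2)] d D_wd] off_cell_disj_D wQ v1(1) Q(2) by blast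
    moreover have "\<exists>z'\<in>Q'. maps (swap v1 v) z z'" if z: "z \<in> Q'" for z
    proof -
      consider "z = v1" | "z = v" | "z \<noteq> v1" "z \<noteq> v" by blast
      then show ?thesis
      proof cases
        case 3
        then show ?thesis
          using swap_maps_disj[OF wQ(2)[OF v1(1)] wQ(2)[OF Q(2)] d wQ(2)[OF z]] hdiv_disj[OF Q(1) z] v1(1) Q(2) z by blast
      qed (use sw v1(1) Q(2) in blast)+
    qed
    ultimately show ?thesis
      using swap_in[OF K gens wQ(1)[OF v1(1)] wQ(1)[OF Q(2)] d] sw unfolding off_grp_def by blast
  qed
  then obtain h where h: "h \<in> K" "h \<in> off_grp" "\<And>z. z \<in> Q' \<Longrightarrow> \<exists>z'\<in>Q'. maps h z z'" "maps h v1 v" by blast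
  define g1 where "g1 = compose X h g"
  have g1: "g1 \<in> K" "maps g1 D D" "maps g1 w v"
    unfolding g1_def using is_subgroupD(3)[OF K h(1) g(1)] maps_compose g h v1 D_wd wP(2)[OF P(2)] by (auto simp: off_grp_def)
  have g1P: "\<exists>z\<in>Q'. maps g1 p z" if p: "p \<in> P'" for p
  proof -
    obtain z where z: "z \<in> Q'" "maps g p z" using g(3)[OF p] by blast
    obtain z' where "z' \<in> Q'" "maps h z z'" using h(3)[OF z(1)] by blast
    then show ?thesis unfolding g1_def using maps_compose[OF z(2)] wP(2)[OF p] by blast
  qed
  have "\<exists>b\<in>K. (\<forall>c<q. maps b (v \<cdot> digit i c) (v \<cdot> digit j c)) \<and> (\<forall>z. word z \<and> apart z v \<longrightarrow> maps b z z)"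
  proof (cases "i = j")
    case True
    have "maps (\<lambda>x\<in>X. x) (v \<cdot> digit i c) (v \<cdot> digit j c)" if "c < q" for c
      unfolding True using wQ(2)[OF Q(2)] Q(3) that by (intro maps_id) simp
    then show ?thesis using is_subgroupD(2)[OF K] maps_id by blast
  next
    case False
    then show ?thesis
      using baker_in[OF wQ(1)[OF Q(2)] P(3) Q(3)] baker_maps[OF wQ(2)[OF Q(2)] P(3) Q(3)]
        baker_maps_disj[OF wQ(2)[OF Q(2)] P(3) Q(3)] by blast
  qed
  then obtain b where b: "b \<in> K" "\<And>c. c < q \<Longrightarrow> maps b (v \<cdot> digit i c) (v \<cdot> digit j c)"
    "\<And>z. word z \<Longrightarrow> apart z v \<Longrightarrow> maps b z z" by blast
  define g2 where "g2 = compose X b g1"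
  have g2K: "g2 \<in> K" unfolding g2_def using is_subgroupD(3)[OF K b(1) g1(1)] .
  have "maps g2 D D"
    unfolding g2_def using maps_compose[OF g1(2) b(3)] D_wd off_cell_disj_D wQ(1)[OF Q(2)] by blast
  then have "g2 \<in> off_grp" using is_subgroupD(1)[OF K g2K] by (simp add: off_grp_def)
  moreover have "\<exists>z\<in>Q. maps g2 p z" if pP: "p \<in> P" for p
  proof (cases "p \<in> P' - {w}")
    case True
    then have p: "p \<in> P'" "p \<noteq> w" by auto
    obtain z where z: "z \<in> Q'" "maps g1 p z" using g1P[OF p(1)] by blast
    have "apart z v"
      using maps_disj[OF G_Bij[OF is_subgroupD(1)[OF K g1(1)]] z(2) g1(3)] wP p P(2) wQ z(1) Q(2) hdiv_disj[OF P(1)] by blast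
    then have "z \<in> Q" using z(1) apart_irrefl unfolding Q(4) by blast
    then show ?thesis unfolding g2_def using maps_compose[OF z(2) b(3)] wQ(2)[OF z(1)] \<open>apart z v\<close> wP(2)[OF p(1)] by blast
  next
    case False
    then obtain c where c: "c < q" "p = w \<cdot> digit i c" using pP unfolding P(4) by blast
    have "maps g1 p (v \<cdot> digit i c)" unfolding c(2) using maps_wcat[OF g1(3) word_sg[OF P(3) c(1)]] .
    moreover have "word p" unfolding c(2) using wP(2)[OF P(2)] P(3) c(1) by simp
    ultimately have "maps g2 p (v \<cdot> digit j c)" unfolding g2_def using maps_compose b(2)[OF c(1)] by blast
    then show ?thesis unfolding Q(4) using c(1) by blast
  qed
  ultimately show ?case using g2K by blast
qed

text \<open>Once the \<open>g\<close> from \<open>hdiv_map\<close> is divided out, a permutation of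
  the bricks of \<open>Q\<close> remains of \<open>f\<close>, hence a product of swaps.\<close>

lemma off_grp_in_if_hdiv:
  assumes P: "hdiv r P" and Q: "hdiv r Q" and f: "f \<in> off_grp" "\<And>p. p \<in> P \<Longrightarrow> \<exists>z\<in>Q. maps f p z"
  shows "f \<in> K"
proof -
  obtain g where g: "g \<in> K" "g \<in> off_grp" "\<And>p. p \<in> P \<Longrightarrow> \<exists>z\<in>Q. maps g p z" using hdiv_map[OF P Q] by blast
  obtain \<sigma> where \<sigma>: "bij_betw \<sigma> P Q" "\<And>p. p \<in> P \<Longrightarrow> maps f p (\<sigma> p)" using hdiv_bij[OF P Q f] by blast
  obtain \<rho> where \<rho>: "bij_betw \<rho> P Q" "\<And>p. p \<in> P \<Longrightarrow> maps g p (\<rho> p)" using hdiv_bij[OF P Q g(2,3)] by blast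
  define \<pi> where "\<pi> = (\<lambda>z. if z \<in> Q then \<sigma> (inv_into P \<rho> z) else z)"
  have \<pi>: "\<pi> (\<rho> p) = \<sigma> p" if "p \<in> P" for p
    using that \<rho>(1) by (auto simp: \<pi>_def bij_betw_def)
  have "bij_betw (\<sigma> \<circ> inv_into P \<rho>) Q Q"
    using bij_betw_trans[OF bij_betw_inv_into[OF \<rho>(1)] \<sigma>(1)] .
  then have "bij_betw \<pi> Q Q" by (rule bij_betw_cong[THEN iffD1, rotated]) (simp add: \<pi>_def)
  then have "\<pi> permutes Q" by (rule bij_imp_permutes) (simp add: \<pi>_def)
  then obtain h where h: "h \<in> K" "\<And>z. z \<in> Q \<Longrightarrow> maps h z (\<pi> z)" "\<And>x. x \<in> X \<Longrightarrow> x \<notin> (\<Union>z\<in>Q. T z ` X) \<Longrightarrow> h x = x"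
    using permutation_in[OF K gens hdiv_finite[OF Q] hdiv_inW[OF Q] hdiv_disj[OF Q] \<open>\<pi> permutes Q\<close>] by blast
  have hg: "compose X h g \<in> K" using is_subgroupD(3)[OF K h(1) g(1)] .
  have fD: "maps f D D" "f \<in> Bij X" and gD: "maps g D D" using f(1) g(2) G_Bij by (auto simp: off_grp_def)
  have "compose X h g = f"
  proof (rule Bij_eqI)
    show "compose X h g \<in> Bij X" using G_Bij is_subgroupD(1)[OF K hg] by blast
    fix x assume x: "x \<in> X"
    show "compose X h g x = f x"
    proof (cases "x \<in> T D ` X")
      case True
      then obtain y where y: "y \<in> X" "x = T D y" by blast
      have "T D y \<notin> (\<Union>z\<in>Q. T z ` X)"
        using T_disj[OF off_cell_disj_D[OF hdiv_inW[OF Q]] D_wd off_cell_wd[OF hdiv_inW[OF Q]]] y(1) by blast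
      then have "h (T D y) = T D y" using h(3) T_in[OF D_wd y(1)] by blast
      then show ?thesis using x y mapsD[OF fD(1) y(1)] mapsD[OF gD y(1)] by (simp add: compose_eq)
    next
      case False
      then obtain p y where p: "p \<in> P" "y \<in> X" "x = T p y" using hdiv_cover[OF P x] by blast
      have "\<rho> p \<in> Q" using \<rho>(1) p(1) by (auto simp: bij_betw_def)
      then show ?thesis
        using x p \<pi>[OF p(1)] mapsD[OF \<sigma>(2)[OF p(1)] p(2)] mapsD[OF \<rho>(2)[OF p(1)] p(2)] mapsD[OF h(2)[of "\<rho> p"] p(2)]
        by (simp add: compose_eq)
    qed
  qed (rule fD(2))
  then show ?thesis using hg by simp
qed

text \<open>After refining both divisions suitably, an element supported off \<open>D\<close> maps a hierarchical division
  to a regular grid.\<close>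

theorem off_grp_in:
  assumes f: "f \<in> off_grp"
  shows "f \<in> K"
proof -
  have fG: "f \<in> G" and fD: "maps f D D" using f by (auto simp: off_grp_def)
  obtain m where m: "\<And>w. w \<in> words (\<lambda>_. m) \<Longrightarrow> \<exists>v. word v \<and> maps f w v" using G_maps[OF fG] by blast
  define P1 where "P1 = (\<Union>a\<in>cells. (\<cdot>) a ` words (\<lambda>_. m))"
  obtain r1 where r1: "hdiv r1 P1" using hdiv_refine_all[OF hdiv.base, of "\<lambda>_ _. m"] unfolding P1_def by blast
  have "\<exists>v. word v \<and> maps f w v" if w: "w \<in> P1" for w
  proof -
    have ww: "word w" using hdiv_inW[OF r1 w] off_cell_wd by blast
    obtain a u where au: "u \<in> words (\<lambda>_. m)" "w = a \<cdot> u" using w unfolding P1_def by blast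
    obtain b b' where b: "b \<in> words (\<lambda>_. m)" "word b'" "w = b \<cdot> b'"
      using word_cut[OF ww, of m] au by (auto simp: words_def wcat_def)
    obtain v where "word v" "maps f b v" using m[OF b(1)] by blast
    then show ?thesis using maps_wcat[of f b v b'] b by (intro exI[of _ "v \<cdot> b'"]) simp
  qed
  then obtain v where v: "\<And>w. w \<in> P1 \<Longrightarrow> word (v w) \<and> maps f w (v w)" by metis
  have finP1: "finite P1" using hdiv_finite[OF r1] .
  define M where "M = (\<Sum>w\<in>P1. \<Sum>j<n. length (v w j))"
  have M: "length (v w j) \<le> M" if "w \<in> P1" "j < n" for w j
  proof -
    have "length (v w j) \<le> (\<Sum>j<n. length (v w j))" using that by (intro member_le_sum) auto
    also have "\<dots> \<le> M" unfolding M_def using that finP1 by (intro member_le_sum) auto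
    finally show ?thesis .
  qed
  \<comment> \<open>The depths vary with \<open>w\<close> and the coordinate so that every image
    word has length M + 2: two digits for the cell and \<open>M\<close> inside it, as in the grid
    \<open>Q2\<close>.\<close>
  define P2 where "P2 = (\<Union>w\<in>P1. (\<cdot>) w ` words (\<lambda>j. M + 2 - length (v w j)))"
  define Q2 where "Q2 = (\<Union>a\<in>cells. (\<cdot>) a ` words (\<lambda>_. M))"
  obtain r2 where r2: "hdiv r2 P2"
    using hdiv_refine_all[OF r1, of "\<lambda>w j. M + 2 - length (v w j)"] unfolding P2_def by blast
  obtain r3 where r3: "hdiv r3 Q2" using hdiv_refine_all[OF hdiv.base, of "\<lambda>_ _. M"] unfolding Q2_def by blast
  have fPQ: "\<exists>z\<in>Q2. maps f p z" if p: "p \<in> P2" for p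
  proof -
    obtain w u where wu: "w \<in> P1" "u \<in> words (\<lambda>j. M + 2 - length (v w j))" "p = w \<cdot> u"
      using p unfolding P2_def by blast
    define z where "z = v w \<cdot> u"
    have fz: "maps f p z" unfolding z_def wu(3) using maps_wcat v[OF wu(1)] words_wd[OF wu(2)] by blast
    have wz: "word z" unfolding z_def using v[OF wu(1)] words_wd[OF wu(2)] by simp
    have lz: "length (z j) = M + 2" if "j < n" for j
      using wu(2) M[OF wu(1) that] that by (simp add: z_def wcat_def words_def)
    obtain a b where ab: "a \<in> words (\<lambda>_. 2)" "word b" "z = a \<cdot> b"
      using word_cut[OF wz, of 2] lz by auto
    have "b \<in> words (\<lambda>_. M)" using ab lz by (auto simp: words_def wcat_def)
    \<comment> \<open>\<open>f\<close> is the identity on \<open>D\<close>, so by injectivity no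
      brick off \<open>D\<close> lands there.\<close>
    moreover have "a \<noteq> D"
    proof
      assume "a = D"
      then have "maps f (D \<cdot> b) z" using maps_wcat[OF fD ab(2)] ab(3) by simp
      moreover have "apart (D \<cdot> b) p" using off_cell_disj_D[OF hdiv_inW[OF r2 p]] apart_wcat_left by blast
      ultimately have "apart z z"
        using maps_disj[OF G_Bij[OF fG] _ fz] D_wd ab(2) off_cell_wd[OF hdiv_inW[OF r2 p]] wz by simp
      then show False using apart_irrefl by blast
    qed
    ultimately have "z \<in> Q2" using ab unfolding Q2_def cells_def by blast
    then show ?thesis using fz by blast
  qed
  obtain \<sigma> where "bij_betw \<sigma> P2 Q2" using hdiv_bij[OF r2 r3 f fPQ] by blast
  then have "card P2 = card Q2" by (rule bij_betw_same_card)
  then have "r2 = r3" using hdiv_card[OF r2] hdiv_card[OF r3] q2 by simp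
  then show ?thesis using off_grp_in_if_hdiv[OF r2 _ f fPQ] r3 by blast
qed

end
end

section \<open>Fixed points\<close>

lemma group_action_carrier_inverse:
  assumes "group H" "g \<in> carrier H"
  shows "\<exists>h\<in>carrier H. g \<otimes>\<^bsub>H\<^esub> h = \<one>\<^bsub>H\<^esub> \<and> h \<otimes>\<^bsub>H\<^esub> g = \<one>\<^bsub>H\<^esub>"
  using assms by (intro bexI[of _ "inv\<^bsub>H\<^esub> g"]) (simp_all add: group.r_inv group.l_inv group.inv_closed)

context CAT0
begin

lemma isometry_in: "isometry_of M d h \<Longrightarrow> x \<in> M \<Longrightarrow> h x \<in> M"
  by (auto simp: isometry_of_def bij_betw_def)

lemma isometry_inj: "isometry_of M d h \<Longrightarrow> x \<in> M \<Longrightarrow> y \<in> M \<Longrightarrow> h x = h y \<Longrightarrow> x = y"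
  by (auto simp: isometry_of_def bij_betw_def inj_on_def)

lemma isometry_dist: "isometry_of M d h \<Longrightarrow> x \<in> M \<Longrightarrow> y \<in> M \<Longrightarrow> d (h x) (h y) = d x y"
  by (auto simp: isometry_of_def)

text \<open>\<open>h\<close> permutes the finite orbit of \<open>x\<close> and hence fixes its
  circumcentre.\<close>

lemma periodic_point_imp_fixed_point:
  assumes "mcomplete" and h: "isometry_of M d h" and x: "x \<in> M" and r: "0 < r" "(h ^^ r) x = x"
  shows "\<exists>c\<in>M. h c = c"
proof -
  define B where "B = (\<lambda>i. (h ^^ i) x) ` {..<r}"
  have in_M: "(h ^^ i) x \<in> M" for i by (induction i) (auto simp: x isometry_in[OF h])
  have "h ` B = (\<lambda>i. (h ^^ i) x) ` Suc ` {..<r}"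
    unfolding B_def image_image by simp
  also have "Suc ` {..<r} = insert r ({..<r} - {0})"
    unfolding image_Suc_lessThan using r(1) by auto
  also have "(\<lambda>i. (h ^^ i) x) ` insert r ({..<r} - {0}) = (\<lambda>i. (h ^^ i) x) ` insert 0 ({..<r} - {0})"
    unfolding image_insert using r(2) by simp
  also have "insert 0 ({..<r} - {0}) = {..<r}" using r(1) by auto
  finally have hB: "h ` B = B" by (simp add: B_def)
  have fin: "finite B" by (simp add: B_def)
  have "d x b \<le> Max (d x ` B)" if "b \<in> B" for b using fin that by simp
  moreover have "B \<subseteq> M" "B \<noteq> {}" using in_M r(1) by (auto simp: B_def)
  moreover have "closedin mtopology M" using closedin_topspace[of mtopology] by simp
  ultimately obtain c where "c \<in> M" "\<And>h. isometry_of M d h \<Longrightarrow> h ` B = B \<Longrightarrow> h ` M \<subseteq> M \<Longrightarrow> h c = c"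
    using circumcenter_exists[OF \<open>mcomplete\<close> convex_subset_M _ _ _ _ x, of B "Max (d x ` B)"] x by blast
  then show ?thesis using h hB isometry_in[OF h] by blast
qed

end

context adic_bricks
begin

lemma disjoint_supports_commute:
  assumes f: "f \<in> Bij X" and g: "g \<in> Bij X" and off: "\<And>x. x \<in> X \<Longrightarrow> x \<notin> S \<Longrightarrow> f x = x" "\<And>x. x \<in> X \<Longrightarrow> x \<notin> S' \<Longrightarrow> g x = x"
    and "S \<inter> S' = {}"
  shows "compose X f g = compose X g f"
proof -
  have stay: "h x \<in> R" if "h \<in> Bij X" "\<And>x. x \<in> X \<Longrightarrow> x \<notin> R \<Longrightarrow> h x = x" "x \<in> X" "x \<in> R" for h x R
  proof (rule ccontr)
    assume "h x \<notin> R"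
    then have "h (h x) = h x" using that(2) Bij_in[OF that(1,3)] by blast
    then have "h x = x" using Bij_inj[OF that(1)] Bij_in[OF that(1,3)] that(3) by blast
    then show False using \<open>h x \<notin> R\<close> that(4) by simp
  qed
  have "f (g x) = g (f x)" if x: "x \<in> X" for x
  proof -
    consider "x \<in> S" "x \<notin> S'" | "x \<in> S'" "x \<notin> S" | "x \<notin> S" "x \<notin> S'" using assms(5) by blast
    then show ?thesis
    proof cases
      case 1
      then have "f x \<notin> S'" using stay[OF f off(1) x] assms(5) by blast
      then show ?thesis using off(2)[OF x 1(2)] off(2)[OF Bij_in[OF f x]] by simp
    next
      case 2
      then have "g x \<notin> S" using stay[OF g off(2) x] assms(5) by blast
      then show ?thesis using off(1)[OF x 2(2)] off(1)[OF Bij_in[OF g x]] by simp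
    next
      case 3
      then show ?thesis using off x by simp
    qed
  qed
  then show ?thesis by (auto simp: compose_def)
qed

lemma parallel_unary: "i \<noteq> j \<Longrightarrow> parallel (replicate i (1::nat) @ [0]) (replicate j 1 @ [0])"
proof (induction i arbitrary: j)
  case 0
  then show ?case by (cases j) (auto simp: parallel_def)
next
  case (Suc i)
  then show ?case by (cases j) (auto simp: parallel_def)
qed

end

section \<open>Disjoint copies of the complement of a cell\<close>

context grid_cell
begin

lemma swap_gens_cases:
  assumes "g \<in> swap_gens"
  shows "\<exists>w v. off_cell w \<and> off_cell v \<and> apart w v \<and> g = swap w v"
  using assms unfolding swap_gens_def
proof (elim UnE)
  assume "g \<in> (\<lambda>(t, s). swap t s) ` {(t, s). t \<in> cells \<and> s \<in> cells \<and> t \<noteq> s}"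
  then obtain t s where "t \<in> cells" "s \<in> cells" "t \<noteq> s" "g = swap t s" by auto
  then show ?thesis using off_cell_P0 cells_disj by blast
next
  assume "g \<in> (\<lambda>(t, s, j, c). swap (t \<cdot> digit j c) s) ` {(t, s, j, c). t \<in> cells \<and> s \<in> cells \<and> t \<noteq> s \<and> j < n \<and> c < q}"
  then obtain t s j c where *: "t \<in> cells" "s \<in> cells" "t \<noteq> s" "j < n" "c < q" "g = swap (t \<cdot> digit j c) s" by auto
  have "apart (t \<cdot> digit j c) s" using cells_disj[OF *(1-3)] apart_wcat_left by blast
  moreover have "off_cell (t \<cdot> digit j c)" using off_cell_wcat[OF off_cell_P0[OF *(1)]] * by simp
  ultimately show ?thesis using * off_cell_P0 by blast
qed

lemma swap_GD:
  assumes "off_cell w" "off_cell v" "apart w v"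
  shows "swap w v \<in> off_grp"
  using swap_G swap_maps_disj[OF _ _ assms(3) D_wd] off_cell_disj_D off_cell_wd assms unfolding off_grp_def by blast

lemma baker_GD:
  assumes "off_cell w" "i < n" "j < n"
  shows "baker w i j \<in> off_grp"
  using baker_G baker_maps_disj[OF _ assms(2,3) D_wd] off_cell_disj_D off_cell_wd assms unfolding off_grp_def by blast

lemma off_grp_G: "off_grp \<subseteq> G"
  by (auto simp: off_grp_def)

lemma off_grp_fixed: "f \<in> off_grp \<Longrightarrow> x \<in> T D ` X \<Longrightarrow> f x = x"
  by (auto simp: off_grp_def maps_def)

text \<open>The unary suffix makes room for infinitely many disjoint copies of the complement of \<open>D\<close> in \<open>D\<close>.\<close>

definition copy :: "nat \<Rightarrow> (nat \<Rightarrow> nat list) \<Rightarrow> nat \<Rightarrow> nat list" where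
  "copy i p = D \<cdot> p \<cdot> (\<lambda>l. if l = 0 then replicate i 1 @ [0] else [])"

lemma copy_wd: "p \<in> cells \<Longrightarrow> word (copy i p)"
  using D_wd cells_wd q2 n1 by (auto simp: copy_def word_def digits_def wcat_def)

lemma copy_disj:
  assumes "p \<in> cells" "p' \<in> cells" "i \<noteq> j \<or> p \<noteq> p'"
  shows "apart (copy i p) (copy j p')"
proof (cases "p = p'")
  case True
  then have "apart (\<lambda>l. if l = 0 then replicate i 1 @ [0] else []) (\<lambda>l. if l = 0 then replicate j 1 @ [0] else [])"
    using parallel_unary[of i j] assms(3) n1 unfolding apart_def by (intro exI[of _ 0]) auto
  then show ?thesis unfolding copy_def True by simp
next
  case False
  then show ?thesis unfolding copy_def using cells_disj[OF assms(1,2)] apart_wcat by simp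
qed

lemma mover: "\<exists>g\<in>G. \<forall>p\<in>cells. maps g p (copy i p)"
proof (rule exists_mover[OF finite_P0])
  fix p p' assume "p \<in> cells" "p' \<in> cells"
  then show "apart p (copy i p')"
    unfolding copy_def using cells_disj_D[of p] apart_sym apart_wcat_right by blast
qed (use cells_wd cells_disj copy_wd copy_disj in auto)

definition copies :: "nat \<Rightarrow> (nat \<Rightarrow> real) set" where
  "copies i = (\<Union>p\<in>cells. T (copy i p) ` X)"

lemma copies_disjoint: "i \<noteq> j \<Longrightarrow> copies i \<inter> copies j = {}"
  unfolding copies_def using T_disj[OF copy_disj copy_wd copy_wd] by blast

text \<open>\<open>h\<close> is the inverse of \<open>g\<close>. If \<open>h x\<close> were off
  \<open>D\<close>, then \<open>x\<close> would lie in a copy; so outside \<open>copies i\<close>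
  the conjugate evaluates \<open>f\<close> on \<open>D\<close> only, where it is the
  identity.\<close>

lemma conj_supported:
  assumes g: "\<forall>p\<in>cells. maps g p (copy i p)" and f: "f \<in> off_grp" and h: "h \<in> G" "compose X g h = (\<lambda>x\<in>X. x)"
    and x: "x \<in> X" "x \<notin> copies i"
  shows "compose X g (compose X f h) x = x"
proof -
  have hx: "h x \<in> X" using Bij_in[OF G_Bij[OF h(1)] x(1)] .
  have gh: "g (h x) = x" using fun_cong[OF h(2), of x] x(1) by (simp add: compose_eq)
  have "h x \<in> T D ` X"
  proof (rule ccontr)
    assume "h x \<notin> T D ` X"
    then obtain p y where p: "p \<in> cells" "y \<in> X" "h x = T p y" using hdiv_cover[OF hdiv.base hx] by blast
    then have "x = T (copy i p) y" using gh mapsD[of g p "copy i p" y] g by simp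
    then have "x \<in> copies i" unfolding copies_def using p by blast
    then show False using x(2) by blast
  qed
  then show ?thesis using off_grp_fixed[OF f] gh x(1) by (simp add: compose_eq)
qed

end

section \<open>Isometric actions of the group and fixed points off a cell\<close>

locale BHT_action = adic_bricks n q + CAT0 M d
  for n q and M :: "'a set" and d +
  fixes \<phi> :: "((nat \<Rightarrow> real) \<Rightarrow> nat \<Rightarrow> real) \<Rightarrow> 'a \<Rightarrow> 'a" and k
  assumes complete: "mcomplete" and dim: "covering_dim_le mtopology k"
    and action: "group_action (BHT_group n q) M \<phi>"
    and iso: "\<And>g. g \<in> G \<Longrightarrow> isometry_of M d (\<phi> g)"
begin

lemma BHT_carrier: "carrier (BHT_group n q) = G"
  by (simp add: BHT_group_def)

lemma BHT_mult: "f \<in> G \<Longrightarrow> g \<in> G \<Longrightarrow> f \<otimes>\<^bsub>BHT_group n q\<^esub> g = compose X f g"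
  using G_Bij by (simp add: BHT_group_def BijGroup_def)

lemma BHT_one: "\<one>\<^bsub>BHT_group n q\<^esub> = (\<lambda>x\<in>X. x)"
  by (simp add: BHT_group_def BijGroup_def)

lemma act_compose: "f \<in> G \<Longrightarrow> g \<in> G \<Longrightarrow> x \<in> M \<Longrightarrow> \<phi> (compose X f g) x = \<phi> f (\<phi> g x)"
  using group_action.composition_rule[OF action, of x f g] by (simp add: BHT_carrier BHT_mult)

lemma act_id: "x \<in> M \<Longrightarrow> \<phi> (\<lambda>x\<in>X. x) x = x"
  using group_action.id_eq_one[OF action] BHT_one by (metis restrict_apply')

lemma act_in: "g \<in> G \<Longrightarrow> x \<in> M \<Longrightarrow> \<phi> g x \<in> M"
  using iso isometry_in by blast

lemma act_inj: "g \<in> G \<Longrightarrow> x \<in> M \<Longrightarrow> y \<in> M \<Longrightarrow> \<phi> g x = \<phi> g y \<Longrightarrow> x = y"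
  using iso isometry_inj by blast

lemma G_inverse:
  assumes "g \<in> G"
  shows "\<exists>h\<in>G. compose X g h = (\<lambda>x\<in>X. x) \<and> compose X h g = (\<lambda>x\<in>X. x)"
proof -
  have "group (BHT_group n q)"
    using action by (simp add: group_action_def group_hom_def)
  from group_action_carrier_inverse[OF this] show ?thesis
    using assms unfolding BHT_carrier BHT_one by (metis BHT_mult)
qed

text \<open>The subgroups to which the generation results are applied: a point fixed by the
  generators is fixed by all that they generate.\<close>

lemma stabilizer_subgrp:
  assumes "x \<in> M"
  shows "is_subgroup {g \<in> G. \<phi> g x = x}"
  unfolding is_subgroup_def
proof (intro conjI ballI impI)
  show "(\<lambda>x\<in>X. x) \<in> {g \<in> G. \<phi> g x = x}" using id_G act_id[OF assms] by simp
next
  fix f g assume "f \<in> {g \<in> G. \<phi> g x = x}" "g \<in> {g \<in> G. \<phi> g x = x}"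
  then show "compose X f g \<in> {g \<in> G. \<phi> g x = x}" using compose_G act_compose[OF _ _ assms] by simp
next
  fix g f assume g: "g \<in> {g \<in> G. \<phi> g x = x}" and f: "f \<in> G" and "compose X g f \<in> {g \<in> G. \<phi> g x = x}"
  then have "\<phi> g (\<phi> f x) = \<phi> g x" using act_compose[OF _ f assms, of g] by simp
  then show "f \<in> {g \<in> G. \<phi> g x = x}" using act_inj[of g "\<phi> f x" x] act_in[OF f assms] g f assms by simp
qed blast

lemma act_inverse:
  assumes "f \<in> G" "g \<in> G" "\<And>x. x \<in> X \<Longrightarrow> f (g x) = x" "x \<in> M"
  shows "\<phi> f (\<phi> g x) = x"
proof -
  have "compose X f g = (\<lambda>x\<in>X. x)" using assms(3) by (auto simp: compose_def)
  then show ?thesis using act_compose[OF assms(1,2,4)] act_id[OF assms(4)] by simp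
qed

end

locale BHT_cell_action = BHT_action n q M d \<phi> k + grid_cell n q D
  for n q and M :: "'a set" and d \<phi> k D
begin

text \<open>The elements are conjugated into the disjoint sets \<open>copies i\<close>. Conjugates
  for different \<open>i\<close> commute, so \<open>commuting_pairs_meet\<close> yields a common
  fixed point for one conjugated pair, and \<open>h i\<close> carries it back.\<close>

lemma fixed_points_meet:
  assumes "A \<subseteq> off_grp" "B \<subseteq> off_grp" and a: "a \<in> M" "\<And>f. f \<in> A \<Longrightarrow> \<phi> f a = a" and b: "b \<in> M" "\<And>f. f \<in> B \<Longrightarrow> \<phi> f b = b"
  shows "\<exists>x\<in>M. \<forall>f\<in>A \<union> B. \<phi> f x = x"
proof -
  have AG: "A \<subseteq> G" "B \<subseteq> G" using assms(1,2) off_grp_G by auto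
  obtain g where g: "\<And>i. g i \<in> G" "\<And>i. \<forall>p\<in>cells. maps (g i) p (copy i p)" using mover by metis
  obtain h where h: "\<And>i. h i \<in> G" "\<And>i. compose X (g i) (h i) = (\<lambda>x\<in>X. x)" "\<And>i. compose X (h i) (g i) = (\<lambda>x\<in>X. x)"
    using G_inverse[OF g(1)] by metis
  have gh: "\<phi> (g i) (\<phi> (h i) x) = x" "\<phi> (h i) (\<phi> (g i) x) = x" if "x \<in> M" for i x
    using act_compose[OF g(1)[of i] h(1)[of i] that] act_compose[OF h(1)[of i] g(1)[of i] that] act_id[OF that]
    by (simp_all add: h(2,3))
  define cj where "cj = (\<lambda>i f. compose X (g i) (compose X f (h i)))"
  have cjG: "cj i f \<in> G" if "f \<in> G" for i f unfolding cj_def using compose_G g(1) h(1) that by blast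
  have cj_act: "\<phi> (cj i f) x = \<phi> (g i) (\<phi> f (\<phi> (h i) x))" if "f \<in> G" "x \<in> M" for i f x
    unfolding cj_def using act_compose act_in compose_G g(1) h(1) that by simp
  define L where "L = (\<lambda>S i. (\<lambda>f. \<phi> (cj i f)) ` S)"
  have L_iso: "isometry_of M d u" if "u \<in> L S i" "S \<subseteq> G" for u S i
    using that iso cjG unfolding L_def by blast
  have L_fix: "\<phi> (g i) z \<in> fixset (L S i)" if "S \<subseteq> G" "z \<in> M" "\<And>f. f \<in> S \<Longrightarrow> \<phi> f z = z" for S i z
    unfolding fixset_def L_def using that cj_act act_in g(1) gh by auto
  have "\<exists>i\<le>k. fixset (L A i \<union> L B i) \<noteq> {}"
  proof (rule commuting_pairs_meet[OF complete dim])
    fix i j u v x assume ij: "i \<noteq> j" and u: "u \<in> L A i \<union> L B i" and v: "v \<in> L A j \<union> L B j" and x: "x \<in> M"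
    obtain f where f: "f \<in> off_grp" "u = \<phi> (cj i f)" using u assms(1,2) unfolding L_def by blast
    obtain f' where f': "f' \<in> off_grp" "v = \<phi> (cj j f')" using v assms(1,2) unfolding L_def by blast
    have G': "cj i f \<in> G" "cj j f' \<in> G" using cjG f f' off_grp_G by auto
    have "compose X (cj i f) (cj j f') = compose X (cj j f') (cj i f)"
    proof (rule disjoint_supports_commute[OF _ _ _ _ copies_disjoint[OF ij]])
      show "cj i f x = x" if "x \<in> X" "x \<notin> copies i" for x
        unfolding cj_def using conj_supported[OF g(2) f(1) h(1,2) that] .
      show "cj j f' x = x" if "x \<in> X" "x \<notin> copies j" for x
        unfolding cj_def using conj_supported[OF g(2) f'(1) h(1,2) that] .
    qed (use G' G_Bij in auto)
    then show "u (v x) = v (u x)"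
      unfolding f f' using act_compose[OF G' x] act_compose[OF G'(2,1) x] by simp
  next
    fix i show "fixset (L A i) \<noteq> {} \<and> fixset (L B i) \<noteq> {}"
      using L_fix[OF AG(1) a] L_fix[OF AG(2) b] by blast
  qed (use L_iso AG in blast)+
  then obtain i z where z: "z \<in> M" "\<And>f. f \<in> A \<union> B \<Longrightarrow> \<phi> (cj i f) z = z"
    unfolding fixset_def L_def by blast
  have "\<phi> f (\<phi> (h i) z) = \<phi> (h i) z" if f: "f \<in> A \<union> B" for f
  proof -
    have fG: "f \<in> G" using f AG by blast
    have "\<phi> (g i) (\<phi> f (\<phi> (h i) z)) = z" using z(2)[OF f] cj_act[OF fG z(1)] by simp
    then show ?thesis using gh(2)[OF act_in[OF fG act_in[OF h(1)[of i] z(1)]], of i] by simp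
  qed
  then show ?thesis using act_in[OF h(1) z(1)] by blast
qed

lemma finite_fixed_points_meet:
  assumes "finite S" "S \<subseteq> off_grp" "\<And>f. f \<in> S \<Longrightarrow> \<exists>x\<in>M. \<phi> f x = x"
  shows "\<exists>x\<in>M. \<forall>f\<in>S. \<phi> f x = x"
  using assms
proof (induction S rule: finite_induct)
  case empty
  then show ?case using cat0 by (auto simp: CAT0_space_def)
next
  case (insert f S)
  obtain b where "b \<in> M" "\<forall>f\<in>S. \<phi> f b = b" using insert by blast
  moreover obtain a where "a \<in> M" "\<phi> f a = a" using insert.prems(2) by blast
  ultimately show ?case using fixed_points_meet[of "{f}" S a b] insert.prems(1) by auto
qed

lemma swap_fixed_point:
  assumes "off_cell w" "off_cell v" "apart w v"
  shows "\<exists>x\<in>M. \<phi> (swap w v) x = x"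
proof -
  obtain x where x: "x \<in> M" using cat0 by (auto simp: CAT0_space_def)
  have word: "word w" "word v" using assms off_cell_wd by auto
  have g: "swap w v \<in> G" using swap_G[OF word assms(3)] .
  have "(\<phi> (swap w v) ^^ 2) x = x"
    using act_inverse[OF g g swap_swap[OF word assms(3)] x] by (simp add: numeral_2_eq_2)
  then show ?thesis using periodic_point_imp_fixed_point[OF complete iso[OF g] x, of 2] by simp
qed

lemma swap_gens_fixed_point: "\<exists>x\<in>M. \<forall>f\<in>swap_gens. \<phi> f x = x"
proof (rule finite_fixed_points_meet[OF finite_swap_gens])
  show "swap_gens \<subseteq> off_grp" using swap_gens_cases swap_GD by blast
  show "\<exists>x\<in>M. \<phi> f x = x" if "f \<in> swap_gens" for f
    using swap_gens_cases[OF that] swap_fixed_point by blast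
qed

text \<open>Baker's maps preserve this set, and on it their powers can be controlled.\<close>

definition swap_fixed :: "'a set" where
  "swap_fixed = {x \<in> M. \<forall>w v. off_cell w \<and> off_cell v \<and> apart w v \<longrightarrow> \<phi> (swap w v) x = x}"

lemma swap_fixed_if_swap_gens:
  assumes "x \<in> M" "\<forall>f\<in>swap_gens. \<phi> f x = x"
  shows "x \<in> swap_fixed"
proof -
  have "swap_gens \<subseteq> {g \<in> G. \<phi> g x = x}"
    using assms swap_gens_cases swap_GD off_grp_G by blast
  then show ?thesis
    unfolding swap_fixed_def using swap_in[OF stabilizer_subgrp[OF assms(1)]] assms(1) by blast
qed

lemma swap_fixed_stabilizer:
  assumes "x \<in> swap_fixed"
  shows "is_subgroup {g \<in> G. \<phi> g x = x}" "swap_gens \<subseteq> {g \<in> G. \<phi> g x = x}"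
  using assms stabilizer_subgrp swap_gens_cases swap_GD off_grp_G unfolding swap_fixed_def by blast+

text \<open>A normalising element permutes the fixed points of the group that it normalises: the
  swap conjugated by the baker's map still fixes \<open>x\<close>.\<close>

lemma baker_Y:
  assumes x: "x \<in> swap_fixed" and s: "s \<in> cells" and ij: "i < n" "j < n"
  shows "\<phi> (baker s i j) x \<in> swap_fixed"
  unfolding swap_fixed_def
proof (intro CollectI conjI allI impI)
  have xM: "x \<in> M" using x by (simp add: swap_fixed_def)
  note bG = baker_G[OF cells_wd[OF s] ij] and bG' = baker_G[OF cells_wd[OF s] ij(2,1)]
  show yM: "\<phi> (baker s i j) x \<in> M" using act_in[OF bG xM] .
  fix w v assume wv: "off_cell w \<and> off_cell v \<and> apart w v"
  then have sG: "swap w v \<in> G" using swap_GD off_grp_G by blast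
  have "compose X (baker s j i) (compose X (swap w v) (baker s i j)) \<in> {g \<in> G. \<phi> g x = x}"
    using baker_conj_swap_in[OF swap_fixed_stabilizer[OF x] s ij] wv by blast
  then have "\<phi> (baker s j i) (\<phi> (swap w v) (\<phi> (baker s i j) x)) = x"
    using act_compose[OF bG' compose_G[OF sG bG] xM] act_compose[OF sG bG xM] by simp
  moreover have "\<phi> (baker s j i) (\<phi> (baker s i j) x) = x"
    using act_inverse[OF bG' bG baker_inverse[OF cells_wd[OF s] ij] xM] .
  ultimately show "\<phi> (swap w v) (\<phi> (baker s i j) x) = \<phi> (baker s i j) x"
    using act_inj[OF bG' act_in[OF sG yM] yM] by simp
qed

text \<open>The swap of \<open>w\<close> and \<open>t\<close> intertwines the two baker's maps and
  fixes both \<open>x\<close> and its image under the second one.\<close>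

lemma baker_Y_eq_disj:
  assumes x: "x \<in> swap_fixed" and w: "off_cell w" and t: "t \<in> cells" "apart w t" and ij: "i < n" "j < n"
  shows "\<phi> (baker w i j) x = \<phi> (baker t i j) x"
proof -
  have xM: "x \<in> M" using x by (simp add: swap_fixed_def)
  have word: "word w" "word t" using off_cell_wd w cells_wd t by auto
  note sG = swap_G[OF word t(2)] and bw = baker_G[OF word(1) ij] and bt = baker_G[OF word(2) ij]
  have "compose X (swap w t) (baker w i j) = compose X (baker t i j) (swap w t)"
    using baker_conj[OF sG swap_maps1[OF word t(2)] word ij] .
  then have "\<phi> (swap w t) (\<phi> (baker w i j) x) = \<phi> (baker t i j) (\<phi> (swap w t) x)"
    using act_compose[OF sG bw xM] act_compose[OF bt sG xM] by simp
  moreover have "\<phi> (swap w t) x = x" "\<phi> (swap w t) (\<phi> (baker t i j) x) = \<phi> (baker t i j) x"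
    using x baker_Y[OF x t(1) ij] w off_cell_P0[OF t(1)] t(2) unfolding swap_fixed_def by blast+
  ultimately show ?thesis using act_inj[OF sG act_in[OF bw xM] act_in[OF bt xM]] by simp
qed

text \<open>The nested bricks \<open>s \<cdot> u\<close> and \<open>s\<close> cannot be swapped, so
  another cell \<open>t\<close> mediates.\<close>

lemma baker_Y_eq:
  assumes x: "x \<in> swap_fixed" and s: "s \<in> cells" and u: "word u" and ij: "i < n" "j < n"
  shows "\<phi> (baker (s \<cdot> u) i j) x = \<phi> (baker s i j) x"
proof -
  obtain t where t: "t \<in> cells" "t \<noteq> s" using third_cell by blast
  have d: "apart s t" using cells_disj[OF s t(1)] t(2) by blast
  show ?thesis
    using baker_Y_eq_disj[OF x off_cell_wcat[OF off_cell_P0[OF s] u] t(1) apart_wcat_left[OF d] ij]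
      baker_Y_eq_disj[OF x off_cell_P0[OF s] t(1) d ij] by simp
qed

text \<open>On \<open>swap_fixed\<close> the baker's map of each slab acts like that of
  \<open>s\<close>, so the factors for the slabs become powers of a single isometry.\<close>

lemma baker_quotient_act:
  assumes s: "s \<in> cells" and ij: "i < n" "j < n" "i \<noteq> j" and "l \<le> q" "x \<in> swap_fixed"
  shows "\<phi> (baker_quotient s i j l) x = \<phi> (baker s i j) ((\<phi> (baker s j i) ^^ l) x)"
  using assms(5,6)
proof (induction l arbitrary: x)
  case (Suc l)
  have l: "l < q" "l \<le> q" using Suc.prems(1) by auto
  have xM: "x \<in> M" using Suc.prems(2) by (simp add: swap_fixed_def)
  have wl: "word (s \<cdot> digit i l)" using cells_wd[OF s] ij l by simp
  have "\<phi> (baker_quotient s i j (Suc l)) x = \<phi> (baker_quotient s i j l) (\<phi> (baker (s \<cdot> digit i l) j i) x)"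
    using act_compose[OF _ baker_G[OF wl ij(2,1)] xM] baker_quotient_props[OF s ij l(2)] by simp
  also have "\<dots> = \<phi> (baker_quotient s i j l) (\<phi> (baker s j i) x)"
    using baker_Y_eq[OF Suc.prems(2) s word_sg[OF ij(1) l(1)] ij(2,1)] by simp
  also have "\<dots> = \<phi> (baker s i j) ((\<phi> (baker s j i) ^^ l) (\<phi> (baker s j i) x))"
    using Suc.IH[OF l(2) baker_Y[OF Suc.prems(2) s ij(2,1)]] .
  finally show ?case by (simp add: funpow_swap1)
qed simp

text \<open>Let b be the isometry of \<open>baker s j i\<close>, with inverse that of
  \<open>baker s i j\<close>. On a point fixed by the swaps the quotient acts as b^-1 b^q, and it
  fixes the point as a product of swaps. So b^(q - 1) fixes it, and q >= 2 makes the exponent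
  positive.\<close>

lemma baker_fixed_point:
  assumes s: "s \<in> cells" and ij: "i < n" "j < n" "i \<noteq> j"
  shows "\<exists>x\<in>M. \<phi> (baker s j i) x = x"
proof -
  obtain x where "x \<in> M" "\<forall>f\<in>swap_gens. \<phi> f x = x" using swap_gens_fixed_point by blast
  then have x: "x \<in> M" "x \<in> swap_fixed" using swap_fixed_if_swap_gens by auto
  note bG = baker_G[OF cells_wd[OF s] ij(1,2)] and bG' = baker_G[OF cells_wd[OF s] ij(2,1)]
  have "baker_quotient s i j q \<in> {g \<in> G. \<phi> g x = x}"
    using baker_quotient_in[OF swap_fixed_stabilizer[OF x(2)] s ij] .
  then have "\<phi> (baker s i j) ((\<phi> (baker s j i) ^^ q) x) = x"
    using baker_quotient_act[OF s ij order_refl x(2)] by simp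
  moreover have "(\<phi> (baker s j i) ^^ l) x \<in> M" for l
    by (induction l) (auto simp: x(1) act_in[OF bG'])
  then have "\<phi> (baker s i j) (\<phi> (baker s j i) ((\<phi> (baker s j i) ^^ (q - 1)) x)) = (\<phi> (baker s j i) ^^ (q - 1)) x"
    using act_inverse[OF bG bG' baker_inverse[OF cells_wd[OF s] ij(2,1)]] by blast
  moreover have "(\<phi> (baker s j i) ^^ q) x = \<phi> (baker s j i) ((\<phi> (baker s j i) ^^ (q - 1)) x)"
    using q2 by (cases q) auto
  ultimately have "(\<phi> (baker s j i) ^^ (q - 1)) x = x" by simp
  then show ?thesis using periodic_point_imp_fixed_point[OF complete iso[OF bG'] x(1), of "q - 1"] q2 by simp
qed

theorem off_grp_fixed_point: "\<exists>x\<in>M. \<forall>f\<in>off_grp. \<phi> f x = x"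
proof -
  have swG: "swap_gens \<subseteq> off_grp" using swap_gens_cases swap_GD by blast
  have bkG: "baker_gens \<subseteq> off_grp" using baker_GD off_cell_P0 unfolding baker_gens_def by auto
  have "\<exists>x\<in>M. \<forall>f\<in>swap_gens \<union> baker_gens. \<phi> f x = x"
  proof (rule finite_fixed_points_meet)
    fix f assume "f \<in> swap_gens \<union> baker_gens"
    then show "\<exists>x\<in>M. \<phi> f x = x"
    proof
      assume "f \<in> swap_gens"
      then show ?thesis using swap_gens_cases swap_fixed_point by blast
    next
      assume "f \<in> baker_gens"
      then obtain s i j where "s \<in> cells" "i < n" "j < n" "j \<noteq> i" "f = baker s i j" unfolding baker_gens_def by auto
      then show ?thesis using baker_fixed_point by blast
    qed
  qed (use finite_swap_gens finite_baker_gens swG bkG in auto)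
  then obtain x where x: "x \<in> M" "\<forall>f\<in>swap_gens \<union> baker_gens. \<phi> f x = x" by blast
  have "f \<in> {g \<in> G. \<phi> g x = x}" if "f \<in> off_grp" for f
    by (rule off_grp_in[OF stabilizer_subgrp[OF x(1)] _ _ that]) (use x swG bkG off_grp_G in auto)
  then show ?thesis using x(1) by blast
qed

end

context BHT_action
begin

lemma global_fixed_point_exists: "\<exists>x\<in>M. \<forall>f\<in>G. \<phi> f x = x"
proof -
  let ?E = "\<Union>(supported_off ` words (\<lambda>_. 2))"
  have "\<exists>x\<in>M. \<forall>f\<in>supported_off D. \<phi> f x = x" if "D \<in> words (\<lambda>_. 2)" for D
  proof -
    interpret BHT_cell_action n q M d \<phi> k D by unfold_locales (rule that)
    show ?thesis using off_grp_fixed_point unfolding off_grp_eq .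
  qed
  then obtain p where p: "\<And>D. D \<in> words (\<lambda>_. 2) \<Longrightarrow> p D \<in> M \<and> (\<forall>f\<in>supported_off D. \<phi> f (p D) = p D)" by metis
  obtain x where x: "x \<in> M" using cat0 by (auto simp: CAT0_space_def)
  \<comment> \<open>An element that fixes \<open>p D\<close> moves \<open>x\<close> by at most twice
    the distance to \<open>p D\<close>; the sum over the finitely many cells bounds all these
    displacements.\<close>
  define R where "R = (\<Sum>D\<in>words (\<lambda>_. 2). 2 * d x (p D))"
  have EG: "f \<in> G" if "f \<in> ?E" for f using that unfolding supported_off_def by blast
  have E: "d x (\<phi> f x) \<le> R" if fE: "f \<in> ?E" for f
  proof -
    obtain D where D: "D \<in> words (\<lambda>_. 2)" "f \<in> supported_off D" using fE by blast
    have fG: "f \<in> G" using EG[OF fE] .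
    have "d (p D) (\<phi> f x) = d (p D) x"
      using isometry_dist[OF iso[OF fG], of "p D" x] p[OF D(1)] D(2) x by simp
    then have "d x (\<phi> f x) \<le> 2 * d x (p D)"
      using triangle[of x "p D" "\<phi> f x"] p[OF D(1)] x act_in[OF fG x] commute[of x "p D"] by simp
    also have "\<dots> \<le> R" unfolding R_def using D(1) finite_words by (intro member_le_sum) auto
    finally show ?thesis .
  qed
  \<comment> \<open>Each of the three factors and the resulting product costs at most
    \<open>R\<close>.\<close>
  have bound: "d x (\<phi> f x) \<le> 4 * R" if f: "f \<in> G" for f
  proof -
    obtain s t t' where E': "s \<in> ?E" "t \<in> ?E" "t' \<in> ?E" "compose X t' (compose X t (compose X f s)) \<in> ?E"
      using bounded_factorization[OF f] by blast
    have sG: "s \<in> G" and tG: "t \<in> G" and t'G: "t' \<in> G" using E' EG by auto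
    define y where "y = \<phi> f (\<phi> s x)"
    have yM: "y \<in> M" unfolding y_def using act_in f sG x by blast
    have "\<phi> (compose X t' (compose X t (compose X f s))) x = \<phi> t' (\<phi> t y)"
      unfolding y_def using act_compose compose_G act_in f sG tG t'G x by simp
    then have 1: "d x (\<phi> t' (\<phi> t y)) \<le> R" using E[OF E'(4)] by simp
    have step: "d x z \<le> R + d x (\<phi> u z)" if "u \<in> ?E" "z \<in> M" for u z
      using triangle[of "\<phi> u x" x "\<phi> u z"] isometry_dist[OF iso[OF EG[OF that(1)]] x that(2)] E[OF that(1)]
        act_in[OF EG[OF that(1)]] x that(2) commute[of x "\<phi> u x"] by simp
    have "d x y \<le> R + (R + R)"
      using step[OF E'(2) yM] step[OF E'(3) act_in[OF tG yM]] 1 by linarith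
    moreover have "d y (\<phi> f x) \<le> R"
      unfolding y_def using isometry_dist[OF iso[OF f] act_in[OF sG x] x] E[OF E'(1)] commute[of x "\<phi> s x"] by simp
    ultimately show ?thesis using triangle[OF x yM act_in[OF f x]] by linarith
  qed
  define B where "B = (\<lambda>f. \<phi> f x) ` G"
  have B: "B \<subseteq> M" "B \<noteq> {}" using act_in x id_G unfolding B_def by blast+
  have "closedin mtopology M" using closedin_topspace[of mtopology] by simp
  then obtain c where c: "c \<in> M" "\<And>h. isometry_of M d h \<Longrightarrow> h ` B = B \<Longrightarrow> h ` M \<subseteq> M \<Longrightarrow> h c = c"
    using circumcenter_exists[OF complete convex_subset_M _ _ B x, of "4 * R"] bound x unfolding B_def by blast
  have "\<phi> f c = c" if f: "f \<in> G" for f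
  proof (rule c(2)[OF iso[OF f]])
    obtain h where h: "h \<in> G" "compose X f h = (\<lambda>x\<in>X. x)" using G_inverse[OF f] by blast
    have sub: "\<phi> u ` B \<subseteq> B" if u: "u \<in> G" for u
      unfolding B_def using act_compose[OF u _ x] compose_G[OF u] by (auto simp: image_iff) metis
    have "B \<subseteq> \<phi> f ` B"
    proof
      fix b assume b: "b \<in> B"
      have "\<phi> f (\<phi> h b) = b" using act_compose[OF f h(1)] act_id h(2) b B(1) by (metis subsetD)
      moreover have "\<phi> h b \<in> B" using sub[OF h(1)] b by blast
      ultimately show "b \<in> \<phi> f ` B" by (metis imageI)
    qed
    then show "\<phi> f ` B = B" using sub[OF f] by blast
    show "\<phi> f ` M \<subseteq> M" using act_in[OF f] by blast
  qed
  then show ?thesis using c(1) by blast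
qed

end

theorem corollary3p3:
  fixes q n k :: nat
    and M :: "'a set" and d :: "'a \<Rightarrow> 'a \<Rightarrow> real"
    and \<phi> :: "((nat \<Rightarrow> real) \<Rightarrow> (nat \<Rightarrow> real)) \<Rightarrow> 'a \<Rightarrow> 'a"
  assumes "q \<ge> 2" and "n \<ge> 1"
    and "CAT0_space M d" and "Metric_space.mcomplete M d"
    and "has_covering_dim (Metric_space.mtopology M d) k"
    and "semisimple_action (BHT_group n q) M d \<phi>"
  shows "\<exists>x. global_fixed_point (BHT_group n q) M \<phi> x"
proof -
  have carrier: "carrier (BHT_group n q) = BHT_elements n q" by (simp add: BHT_group_def)
  have "Metric_space M d" using assms(3) by (simp add: CAT0_space_def)
  then interpret Metric_space M d .
  have "isometry_of M d (\<phi> g)" if "g \<in> BHT_elements n q" for g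
    using assms(6) that by (simp add: semisimple_action_def semisimple_isometry_def carrier)
  moreover have "group_action (BHT_group n q) M \<phi>" using assms(6) by (simp add: semisimple_action_def)
  moreover have "covering_dim_le mtopology k" using assms(5) by (simp add: has_covering_dim_def)
  ultimately interpret BHT_action n q M d \<phi> k
    using assms(1-4) Metric_space_axioms
    by (intro BHT_action.intro adic_bricks.intro CAT0.intro CAT0_axioms.intro BHT_action_axioms.intro) auto
  show ?thesis
    using global_fixed_point_exists unfolding global_fixed_point_def carrier by blast
qed

end
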